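(* The triple $(\mathcal B^*,\Cup,\Delta_* )$ is a Hopf algebra that is dual to $(\mathcal B,\star,\Delta)$ (i.e. it is the graded dual of the Hopf algebra $(\mathcal B,\star,\Delta)$ with respect to the pairing $\langle D_G,G'\rangle=\delta_{G,G'}$).
   Context: All vector spaces are over $\mathbb C$; $\llbracket a,b\rrbracket=\{a,a+1,\dots,b\}$. **$B$-diagrams.** For a vector $\lambda=[\lambda_1,\dots,\lambda_n]$ of positive integers put $|\lambda|=\lambda_1+\cdots+\lambda_n$; for $k\in\llbracket 1,|\lambda|\rrbracket$, $\mathrm{block}_\lambda(k)$ is the unique $i$ with $\lambda_1+\cdots+\lambda_{i-1}<k\le\lambda_1+\cdots+\lambda_i$. A $B$-diagram is a 5-tuple $G=(n,\lambda,\varphi,F^\uparrow,F_\downarrow)$ where $n\ge 0$ is an integer, $\lambda=[\lambda_1,\dots,\lambda_n]$ with all $\lambda_i\ge1$, $\varphi:E^\uparrow(G)\to E_\downarrow(G)$ is a bijection between two subsets of $\llbracket 1,|\lambda|\rrbracket$ with $\mathrm{block}_\lambda(a)<\mathrm{block}_\lambda(\varphi(a))$ for all $a\in E^\uparrow(G)$, $F^\uparrow\subset\llbracket1,|\lambda|\rrbracket\setminus E^\uparrow(G)$ and $F_\downarrow\subset\llbracket1,|\lambda|\rrbracket\setminus E_\downarrow(G)$. Write $|G|=n$ (number of vertices), $\omega(G)=|\lambda|$ (weight). The edges of $G$ are the pairs $(a,\varphi(a))$, $a\in E^\uparrow(G)$; such an edge joins the vertices $\mathrm{block}_\lambda(a)$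 and $\mathrm{block}_\lambda(\varphi(a))$. The empty $B$-diagram ($n=0$) is denoted $\varepsilon$. **Composition.** Let $G=(n,\lambda,\varphi,F^\uparrow,F_\downarrow)$ and $G'=(n',\lambda',\varphi',F'^\uparrow,F'_\downarrow)$ be $B$-diagrams. For $k\ge0$, $a_1<\dots<a_k$ in $F^\uparrow$ and distinct $b_1,\dots,b_k\in F'_\downarrow$, the composition of $G$ and $G'$ along $(a_i),(b_i)$ is the $B$-diagram $(n+n',[\lambda_1,\dots,\lambda_n,\lambda'_1,\dots,\lambda'_{n'}],\varphi'',F''^\uparrow,F''_\downarrow)$ whose edges are the edges of $G$, the edges of $G'$ with both entries shifted by $\omega(G)$, and the edges $(a_i,b_i+\omega(G))$ for $1\le i\le k$, with $F''^\uparrow=(F^\uparrow\setminus\{a_1,\dots,a_k\})\cup\{i+\omega(G)\mid i\in F'^\uparrow\}$ and $F''_\downarrow=F_\downarrow\cup\{i+\omega(G)\mid i\in F'_\downarrow\setminus\{b_1,\dots,b_k\}\}$. The case $k=0$ is the juxtaposition $G|G'$. $G\circledast G'$ denotes the set of all compositions of $G$ and $G'$ (all $k\ge0$ and all admissible $(a_i),(b_i)$); distinct choices give distinct diagrams. **The Hopf algebra $(\mathcal B,\star,\Delta)$.** $\mathcal B$ is the vector space with basis the set of $B$-diagrams, graded by $\omega$ (each component $\mathcal B_k=\mathrm{span}\{G\mid\omega(G)=k\}$ is finite dimensional). Its product is $G'\star G''=\sum_{G\in G'\circledast G''}G$, with unit $\varepsilon$. An increasing sequence (identified with a set) $I$ of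 vertices is isolated in $G$ if each edge of $G$ has both its end vertices in $I$ or both in the complement $\complement_GI=\llbracket1,|G|\rrbracket\setminus I$; $\mathrm{Iso}(G)$ is the set of isolated $I$. For $I=[i_1<\dots<i_{m}]\in\mathrm{Iso}(G)$, the sub-$B$-diagram $G[I]=(m,[\lambda_{i_1},\dots,\lambda_{i_m}],\varphi',F'^\uparrow,F'_\downarrow)$ is obtained as follows: let $\hat H=\{a\in\llbracket1,\omega(G)\rrbracket\mid\mathrm{block}_\lambda(a)\in I\}$ and let $\phi:\hat H\to\llbracket1,\lambda_{i_1}+\dots+\lambda_{i_m}\rrbracket$ be the increasing bijection; then $\varphi':\phi(E^\uparrow(G)\cap\hat H)\to\phi(E_\downarrow(G)\cap\hat H)$ is given by $\varphi'\circ\phi=\phi\circ\varphi$, $F'^\uparrow=\phi(F^\uparrow\cap\hat H)$, $F'_\downarrow=\phi(F_\downarrow\cap\hat H)$. The coproduct is $\Delta(G)=\sum_{I\in\mathrm{Iso}(G)}G[I]\otimes G[\complement_GI]$. It is known that $(\mathcal B,\star,\Delta)$ is a graded Hopf algebra with finite-dimensional graded components. **Permuting vertices.** For $\sigma\in\mathfrak S_n$ put $\lambda^\sigma=[\lambda_{\sigma(1)},\dots,\lambda_{\sigma(n)}]$ and let $\sigma[\lambda]\in\mathfrak S_{|\lambda|}$ be the permutation whose word is obtained by listing, successively for $i=1,\dots,n$, the elements of $\{k\mid\mathrm{block}_\lambda(k)=\sigma(i)\}$ in increasing order. Define $G^\sigma=(n,\lambda^\sigma,\widetilde\varphi,\widetilde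 F^\uparrow,\widetilde F_\downarrow)$ by: $i\in\widetilde F^\uparrow\iff\sigma[\lambda](i)\in F^\uparrow$; $i\in\widetilde F_\downarrow\iff\sigma[\lambda](i)\in F_\downarrow$; $\widetilde\varphi(i)=j\iff\varphi(\sigma[\lambda](i))=\sigma[\lambda](j)$. The set $1\cdots n\,\text{ш}\,(n+1)\cdots(n+n')$ consists of the permutations $\sigma\in\mathfrak S_{n+n'}$ in whose word $\sigma(1)\cdots\sigma(n+n')$ the letters $1,\dots,n$ appear in increasing order and the letters $n+1,\dots,n+n'$ appear in increasing order. **The triple $(\mathcal B^*,\Cup,\Delta_* )$.** $\mathcal B^*=\bigoplus_k\mathcal B_k^*$ is the graded dual of $\mathcal B$, with basis $(D_G)$ given by $D_G(G')=\langle D_G,G'\rangle=\delta_{G,G'}$. Its product is $$D_G\Cup D_{G'}=\sum_{\sigma\in1\cdots n\,\text{ш}\,(n+1)\cdots(n+n')}D_{(G|G')^\sigma},\qquad n=|G|,\ n'=|G'|,$$ (each $(G|G')^\sigma$ occurring is a $B$-diagram) and its coproduct is $\Delta_*(D_G)=\sum_{(G',G''):\,G\in G'\circledast G''}D_{G'}\otimes D_{G''}$, the sum being over ordered pairs of $B$-diagrams. *)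

theory Defs
  imports
    Complex_Main
    "HOL-Library.Poly_Mapping"
    "HOL-Combinatorics.Permutations"
begin

section \<open>Vector spaces with a distinguished basis and their tensor products\<close>

text \<open>
  The complex vector space with basis \<open>'a\<close> is \<open>'a \<Rightarrow>\<^sub>0 complex\<close>. The tensor product of the spaces
  with bases \<open>'a\<close> and \<open>'b\<close> is the space with basis \<open>'a \<times> 'b\<close>, where the pair
  \<open>(a, b)\<close> stands for the pure tensor of \<open>a\<close> and \<open>b\<close>.
\<close>

type_synonym 'a free = "'a \<Rightarrow>\<^sub>0 complex"

definition scl :: "complex \<Rightarrow> 'a free \<Rightarrow> 'a free" where
  "scl c x = Poly_Mapping.map ((*) c) x"

lemma lookup_scl [simp]: "Poly_Mapping.lookup (scl c x) a = c * Poly_Mapping.lookup x a"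
  unfolding scl_def by transfer (simp add: when_def)

global_interpretation free: vector_space "scl :: complex \<Rightarrow> 'a free \<Rightarrow> 'a free"
  by unfold_locales (auto intro!: poly_mapping_eqI simp: lookup_add algebra_simps)

definition basis :: "'a \<Rightarrow> 'a free" where
  "basis a = Poly_Mapping.single a 1"

definition lin_ext :: "('a \<Rightarrow> 'b free) \<Rightarrow> 'a free \<Rightarrow> 'b free" where
  "lin_ext f x = (\<Sum>a\<in>Poly_Mapping.keys x. scl (Poly_Mapping.lookup x a) (f a))"

definition tensor :: "'a free \<Rightarrow> 'b free \<Rightarrow> ('a \<times> 'b) free" where
  "tensor x y = lin_ext (\<lambda>a. lin_ext (\<lambda>b. basis (a, b)) y) x"

definition tensor_map ::
    "('a free \<Rightarrow> 'c free) \<Rightarrow> ('b free \<Rightarrow> 'd free) \<Rightarrow> ('a \<times> 'b) free \<Rightarrow> ('c \<times> 'd) free" where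
  "tensor_map f g = lin_ext (\<lambda>(a, b). tensor (f (basis a)) (g (basis b)))"

definition tensor_assoc :: "(('a \<times> 'b) \<times> 'c) free \<Rightarrow> ('a \<times> ('b \<times> 'c)) free" where
  "tensor_assoc = lin_ext (\<lambda>((a, b), c). basis (a, (b, c)))"

text \<open>The middle-four interchange, i.e. the flip of the two inner tensor factors.\<close>

definition tensor_swap ::
    "(('a \<times> 'b) \<times> ('c \<times> 'd)) free \<Rightarrow> (('a \<times> 'c) \<times> ('b \<times> 'd)) free" where
  "tensor_swap = lin_ext (\<lambda>((a, b), (c, d)). basis ((a, c), (b, d)))"

text \<open>For a linear functional \<open>e\<close>, the maps \<open>e \<otimes> id\<close> and \<open>id \<otimes> e\<close>, followed by the
  identification of \<open>\<complex> \<otimes> V\<close> and \<open>V \<otimes> \<complex>\<close> with \<open>V\<close>.\<close>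

definition contract_left :: "('a free \<Rightarrow> complex) \<Rightarrow> ('a \<times> 'b) free \<Rightarrow> 'b free" where
  "contract_left e = lin_ext (\<lambda>(a, b). scl (e (basis a)) (basis b))"

definition contract_right :: "('b free \<Rightarrow> complex) \<Rightarrow> ('a \<times> 'b) free \<Rightarrow> 'a free" where
  "contract_right e = lin_ext (\<lambda>(a, b). scl (e (basis b)) (basis a))"


section \<open>Graded Hopf algebras\<close>

locale algebra_axms =
  fixes mult :: "('a \<times> 'a) free \<Rightarrow> 'a free"
    and unit :: "'a free"
  assumes mult_linear: "Vector_Spaces.linear scl scl mult"
    and mult_assoc: "mult (tensor_map mult id z) = mult (tensor_map id mult (tensor_assoc z))"
    and unit_left: "mult (tensor unit x) = x"
    and unit_right: "mult (tensor x unit) = x"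

locale coalgebra_axms =
  fixes comult :: "'a free \<Rightarrow> ('a \<times> 'a) free"
    and counit :: "'a free \<Rightarrow> complex"
  assumes comult_linear: "Vector_Spaces.linear scl scl comult"
    and counit_linear: "Vector_Spaces.linear scl (*) counit"
    and comult_coassoc:
      "tensor_assoc (tensor_map comult id (comult x)) = tensor_map id comult (comult x)"
    and counit_left: "contract_left counit (comult x) = x"
    and counit_right: "contract_right counit (comult x) = x"

locale bialgebra = algebra_axms mult unit + coalgebra_axms comult counit
  for mult :: "('a \<times> 'a) free \<Rightarrow> 'a free" and unit and comult and counit +
  assumes comult_mult:
      "comult (mult z) = tensor_map mult mult (tensor_swap (tensor_map comult comult z))"
    and comult_unit: "comult unit = tensor unit unit"
    and counit_mult: "counit (mult (tensor x y)) = counit x * counit y"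
    and counit_unit: "counit unit = 1"

locale hopf_algebra = bialgebra mult unit comult counit
  for mult :: "('a \<times> 'a) free \<Rightarrow> 'a free" and unit and comult and counit +
  fixes antipode :: "'a free \<Rightarrow> 'a free"
  assumes antipode_linear: "Vector_Spaces.linear scl scl antipode"
    and antipode_left: "mult (tensor_map antipode id (comult x)) = scl (counit x) unit"
    and antipode_right: "mult (tensor_map id antipode (comult x)) = scl (counit x) unit"

text \<open>A grading is given by the degrees \<open>deg\<close> of the (homogeneous) basis vectors.\<close>

definition component :: "('a \<Rightarrow> nat) \<Rightarrow> nat \<Rightarrow> 'a free set" where
  "component deg k = free.span {basis a | a. deg a = k}"

abbreviation tensor_deg :: "('a \<Rightarrow> nat) \<Rightarrow> 'a \<times> 'a \<Rightarrow> nat" where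
  "tensor_deg deg \<equiv> (\<lambda>(a, b). deg a + deg b)"

locale graded_hopf_algebra = hopf_algebra mult unit comult counit antipode
  for deg :: "'a \<Rightarrow> nat"
    and mult :: "('a \<times> 'a) free \<Rightarrow> 'a free" and unit and comult and counit and antipode +
  assumes component_finite_dim: "\<exists>B. finite B \<and> component deg k = free.span B"
    and mult_graded: "mult ` component (tensor_deg deg) k \<subseteq> component deg k"
    and unit_graded: "unit \<in> component deg 0"
    and comult_graded: "comult ` component deg k \<subseteq> component (tensor_deg deg) k"
    and counit_graded: "k \<noteq> 0 \<Longrightarrow> counit ` component deg k \<subseteq> {0}"
    and antipode_graded: "antipode ` component deg k \<subseteq> component deg k"


section \<open>Graded duals\<close>

text \<open>The functionals in the degree-\<open>k\<close> component of the graded dual are those which vanish on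
  every other component; the graded dual is the direct sum of these, i.e. it consists of the
  functionals which vanish on all but finitely many components.\<close>

definition dual_component :: "('a \<Rightarrow> nat) \<Rightarrow> nat \<Rightarrow> ('a free \<Rightarrow> complex) set" where
  "dual_component deg k =
     {f. Vector_Spaces.linear scl (*) f \<and> (\<forall>j. j \<noteq> k \<longrightarrow> (\<forall>x\<in>component deg j. f x = 0))}"

definition graded_dual :: "('a \<Rightarrow> nat) \<Rightarrow> ('a free \<Rightarrow> complex) set" where
  "graded_dual deg =
     {f. Vector_Spaces.linear scl (*) f \<and> finite {k. \<exists>x\<in>component deg k. f x \<noteq> 0}}"

text \<open>The pairing of tensor squares determined by
  \<open>\<langle>f \<otimes> g, x \<otimes> y\<rangle> = \<langle>f, x\<rangle> \<langle>g, y\<rangle>\<close>.\<close>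

definition tensor_pairing ::
    "('b free \<Rightarrow> 'a free \<Rightarrow> complex) \<Rightarrow> ('b \<times> 'b) free \<Rightarrow> ('a \<times> 'a) free \<Rightarrow> complex" where
  "tensor_pairing p z w =
     (\<Sum>(b, b')\<in>Poly_Mapping.keys z. \<Sum>(a, a')\<in>Poly_Mapping.keys w.
        Poly_Mapping.lookup z (b, b') * Poly_Mapping.lookup w (a, a') *
        (p (basis b) (basis a) * p (basis b') (basis a')))"

text \<open>The Hopf algebra with basis \<open>'b\<close> is the graded dual of the Hopf algebra with basis \<open>'a\<close> by
  means of the pairing \<open>p\<close>.\<close>

locale graded_dual_hopf_algebra =
  H: graded_hopf_algebra deg mult unit comult counit antipode +
  D: graded_hopf_algebra deg' mult' unit' comult' counit' antipode'
  for deg :: "'a \<Rightarrow> nat"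
    and mult unit comult counit antipode
    and deg' :: "'b \<Rightarrow> nat"
    and mult' unit' comult' counit' antipode' +
  fixes p :: "'b free \<Rightarrow> 'a free \<Rightarrow> complex"
  assumes pairing_linear_left: "Vector_Spaces.linear scl (*) (\<lambda>f. p f x)"
    and pairing_linear_right: "Vector_Spaces.linear scl (*) (\<lambda>x. p f x)"
    and pairing_bij: "bij_betw p UNIV (graded_dual deg)"
    and pairing_component: "p ` component deg' k = dual_component deg k"
    and mult_dual: "p (mult' z) x = tensor_pairing p z (comult x)"
    and unit_dual: "p unit' x = counit x"
    and comult_dual: "tensor_pairing p (comult' f) w = p f (mult w)"
    and counit_dual: "counit' f = p f unit"
    and antipode_dual: "p (antipode' f) x = p f (antipode x)"


section \<open>B-diagrams\<close>

text \<open>Positions and vertices are numbered from 1, whereas list indices start at 0.\<close>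

definition block :: "nat list \<Rightarrow> nat \<Rightarrow> nat" where
  "block ls k =
     (THE i. 1 \<le> i \<and> i \<le> length ls \<and> sum_list (take (i - 1) ls) < k \<and> k \<le> sum_list (take i ls))"

text \<open>The number of vertices is the length of the list \<open>\<lambda>\<close>. The bijection \<open>\<phi>\<close> is represented by
  its graph, the set of edges; its domain and range are the two projections of this set.\<close>

datatype pre_bdiag = Pre_bdiag
  (pre_lam: "nat list") (pre_edges: "(nat \<times> nat) set") (pre_up: "nat set") (pre_down: "nat set")

definition valid_bdiag :: "pre_bdiag \<Rightarrow> bool" where
  "valid_bdiag G \<longleftrightarrow>
     (let ls = pre_lam G; P = {1..sum_list ls}; E = pre_edges G in
       (\<forall>l\<in>set ls. 1 \<le> l) \<and>
       E \<subseteq> P \<times> P \<and> inj_on fst E \<and> inj_on snd E \<and>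
       (\<forall>(a, b)\<in>E. block ls a < block ls b) \<and>
       pre_up G \<subseteq> P - fst ` E \<and>
       pre_down G \<subseteq> P - snd ` E)"

typedef bdiag = "{G. valid_bdiag G}"
proof
  show "Pre_bdiag [] {} {} {} \<in> {G. valid_bdiag G}"
    by (simp add: valid_bdiag_def)
qed

setup_lifting type_definition_bdiag

lift_definition lam :: "bdiag \<Rightarrow> nat list" is pre_lam .
lift_definition edges :: "bdiag \<Rightarrow> (nat \<times> nat) set" is pre_edges .
lift_definition up :: "bdiag \<Rightarrow> nat set" is pre_up .
lift_definition down :: "bdiag \<Rightarrow> nat set" is pre_down .

definition vertices :: "bdiag \<Rightarrow> nat" where "vertices G = length (lam G)"
definition weight :: "bdiag \<Rightarrow> nat" where "weight G = sum_list (lam G)"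

lift_definition empty_bdiag :: bdiag is "Pre_bdiag [] {} {} {}"
  by (simp add: valid_bdiag_def)

subsection \<open>Facts about blocks\<close>

lemma sum_take_mono: "i \<le> j \<Longrightarrow> sum_list (take i ls) \<le> sum_list (take j (ls :: nat list))"
  by (metis le_add1 le_add_diff_inverse sum_list_append take_add)

lemma block_eqI:
  assumes "1 \<le> i" "i \<le> length ls" "sum_list (take (i - 1) ls) < k" "k \<le> sum_list (take i ls)"
  shows "block ls k = i"
  unfolding block_def
proof (rule the_equality)
  fix j assume j: "1 \<le> j \<and> j \<le> length ls \<and> sum_list (take (j - 1) ls) < k \<and> k \<le> sum_list (take j ls)"
  show "j = i"
  proof (rule ccontr)
    assume "j \<noteq> i"
    then consider "j \<le> i - 1" | "i \<le> j - 1" by linarith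
    then show False
    proof cases
      case 1
      then show False using sum_take_mono[of j "i - 1" ls] j assms by linarith
    next
      case 2
      then show False using sum_take_mono[of i "j - 1" ls] j assms by linarith
    qed
  qed
qed (use assms in auto)

lemma block_bounds:
  assumes "k \<in> {1..sum_list ls}"
  shows "1 \<le> block ls k" "block ls k \<le> length ls"
    "sum_list (take (block ls k - 1) ls) < k" "k \<le> sum_list (take (block ls k) ls)"
proof -
  define i where "i = (LEAST i. k \<le> sum_list (take i ls))"
  have ex: "k \<le> sum_list (take (length ls) ls)" using assms by simp
  have 1: "k \<le> sum_list (take i ls)" unfolding i_def by (rule LeastI) (rule ex)
  have 2: "i \<le> length ls" unfolding i_def by (rule Least_le) (rule ex)
  have 3: "1 \<le> i" using 1 assms by (cases i) auto
  have "\<not> k \<le> sum_list (take (i - 1) ls)"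
    by (rule not_less_Least) (use 3 i_def in linarith)
  then have "block ls k = i" by (intro block_eqI) (use 1 2 3 in auto)
  with 1 2 3 \<open>\<not> k \<le> _\<close> show "1 \<le> block ls k" "block ls k \<le> length ls"
    "sum_list (take (block ls k - 1) ls) < k" "k \<le> sum_list (take (block ls k) ls)" by auto
qed

lemma block_le_iff:
  assumes "k \<in> {1..sum_list ls}"
  shows "block ls k \<le> r \<longleftrightarrow> k \<le> sum_list (take r ls)"
proof
  assume "block ls k \<le> r"
  then show "k \<le> sum_list (take r ls)"
    using block_bounds(4)[OF assms] sum_take_mono[of "block ls k" r ls] by linarith
next
  assume *: "k \<le> sum_list (take r ls)"
  show "block ls k \<le> r"
  proof (rule ccontr)
    assume "\<not> block ls k \<le> r"
    then have "r \<le> block ls k - 1" by simp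
    then show False using * block_bounds(3)[OF assms] sum_take_mono[of r "block ls k - 1" ls] by linarith
  qed
qed

lemma block_append_left:
  assumes "k \<in> {1..sum_list ls}"
  shows "block (ls @ ls') k = block ls k"
  by (rule block_eqI) (use block_bounds[OF assms] in auto)

lemma block_append_right:
  assumes "k \<in> {1..sum_list ls'}"
  shows "block (ls @ ls') (k + sum_list ls) = length ls + block ls' k"
proof (rule block_eqI)
  show "1 \<le> length ls + block ls' k" "length ls + block ls' k \<le> length (ls @ ls')"
    using block_bounds[OF assms] by auto
  show "sum_list (take (length ls + block ls' k - 1) (ls @ ls')) < k + sum_list ls"
    using block_bounds[OF assms] by auto
  show "k + sum_list ls \<le> sum_list (take (length ls + block ls' k) (ls @ ls'))"
    using block_bounds[OF assms] by auto
qed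


subsection \<open>Composition\<close>

definition compose_pre :: "pre_bdiag \<Rightarrow> pre_bdiag \<Rightarrow> nat list \<Rightarrow> nat list \<Rightarrow> pre_bdiag" where
  "compose_pre G G' as bs =
     (let w = sum_list (pre_lam G) in
       Pre_bdiag (pre_lam G @ pre_lam G')
         (pre_edges G \<union> (\<lambda>(a, b). (a + w, b + w)) ` pre_edges G' \<union>
            (\<lambda>(a, b). (a, b + w)) ` set (zip as bs))
         ((pre_up G - set as) \<union> (\<lambda>i. i + w) ` pre_up G')
         (pre_down G \<union> (\<lambda>i. i + w) ` (pre_down G' - set bs)))"

definition composable :: "bdiag \<Rightarrow> bdiag \<Rightarrow> nat list \<Rightarrow> nat list \<Rightarrow> bool" where
  "composable G G' as bs \<longleftrightarrow>
     length as = length bs \<and> sorted_wrt (<) as \<and> set as \<subseteq> up G \<and> distinct bs \<and> set bs \<subseteq> down G'"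

lemma inj_on_fst_iff: "inj_on fst E \<longleftrightarrow> (\<forall>a b b'. (a, b) \<in> E \<longrightarrow> (a, b') \<in> E \<longrightarrow> b = b')"
  by (force simp: inj_on_def)

lemma inj_on_snd_iff: "inj_on snd E \<longleftrightarrow> (\<forall>a a' b. (a, b) \<in> E \<longrightarrow> (a', b) \<in> E \<longrightarrow> a = a')"
  by (force simp: inj_on_def)

lemma valid_compose_pre:
  assumes "composable G G' as bs"
  shows "valid_bdiag (compose_pre (Rep_bdiag G) (Rep_bdiag G') as bs)"
proof -
  obtain ls E U D where G: "Rep_bdiag G = Pre_bdiag ls E U D" by (cases "Rep_bdiag G")
  obtain ls' E' U' D' where G': "Rep_bdiag G' = Pre_bdiag ls' E' U' D'" by (cases "Rep_bdiag G'")
  have v: "valid_bdiag (Pre_bdiag ls E U D)" "valid_bdiag (Pre_bdiag ls' E' U' D')"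
    using Rep_bdiag[of G] Rep_bdiag[of G'] G G' by auto
  define w where "w = sum_list ls"
  define M where "M = set (zip as bs)"
  have c: "set as \<subseteq> U" "set bs \<subseteq> D'" "length as = length bs" "distinct as" "distinct bs"
    using assms strict_sorted_imp_sorted
    by (auto simp: composable_def up.rep_eq down.rep_eq G G' strict_sorted_iff)
  have M: "fst ` M = set as" "snd ` M = set bs" "inj_on fst M" "inj_on snd M"
    using c unfolding M_def
    by (auto simp flip: set_map simp: distinct_map[symmetric])
       (metis c distinct_map map_fst_zip, metis c distinct_map map_snd_zip)
  note V = v[unfolded valid_bdiag_def Let_def pre_bdiag.sel]
  define P where "P = {1..w}"
  define P' where "P' = {1..sum_list ls'}"
  have VG: "\<forall>l\<in>set ls. 1 \<le> l" "E \<subseteq> P \<times> P" "inj_on fst E" "inj_on snd E"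
      "\<And>a b. (a, b) \<in> E \<Longrightarrow> block ls a < block ls b" "U \<subseteq> P - fst ` E" "D \<subseteq> P - snd ` E"
    using V(1) unfolding P_def w_def by (auto simp del: atLeastAtMost_iff)
  have VG': "\<forall>l\<in>set ls'. 1 \<le> l" "E' \<subseteq> P' \<times> P'" "inj_on fst E'" "inj_on snd E'"
      "\<And>a b. (a, b) \<in> E' \<Longrightarrow> block ls' a < block ls' b" "U' \<subseteq> P' - fst ` E'" "D' \<subseteq> P' - snd ` E'"
    using V(2) unfolding P'_def by (auto simp del: atLeastAtMost_iff)
  have Mm: "a \<in> U" "b \<in> D'" if "(a, b) \<in> M" for a b
    using that c M_def by (meson in_mono set_zip_leftD set_zip_rightD)+
  have PE: "a \<in> P" "b \<in> P" if "(a, b) \<in> E" for a b using that VG by auto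
  have PE': "a \<in> P'" "b \<in> P'" if "(a, b) \<in> E'" for a b using that VG' by auto
  let ?E = "E \<union> (\<lambda>(a, b). (a + w, b + w)) ` E' \<union> (\<lambda>(a, b). (a, b + w)) ` M"
  let ?E' = "(\<lambda>(a, b). (a + w, b + w)) ` E'"
  let ?M = "(\<lambda>(a, b). (a, b + w)) ` M"
  let ?sh = "\<lambda>X. (\<lambda>i. i + w) ` X"
  have f: "fst ` ?E' = ?sh (fst ` E')" "snd ` ?E' = ?sh (snd ` E')"
      "fst ` ?M = set as" "snd ` ?M = ?sh (set bs)"
    unfolding M(1,2)[symmetric] by (auto simp: image_image image_iff split_beta)
  have sh: "?sh X \<inter> P = {}" if "X \<subseteq> P'" for X
    using that by (auto simp: P_def P'_def)
  have shi: "?sh X \<inter> ?sh Y = {}" if "X \<inter> Y = {}" for X Y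
    using that by auto
  have ran: "fst ` E \<subseteq> P" "snd ` E \<subseteq> P" "fst ` E' \<subseteq> P'" "snd ` E' \<subseteq> P'"
      "set as \<subseteq> P" "set bs \<subseteq> P'" "set as \<inter> fst ` E = {}" "set bs \<inter> snd ` E' = {}"
    using PE PE' c VG(6) VG'(7) by auto
  have injUn: "inj_on g (X \<union> Y)" if "inj_on g X" "inj_on g Y" "g ` X \<inter> g ` Y = {}"
    for g :: "nat \<times> nat \<Rightarrow> nat" and X Y
    using that by (auto simp: inj_on_Un)
  have inj4: "inj_on fst ?E'" "inj_on snd ?E'" "inj_on fst ?M" "inj_on snd ?M"
    using VG'(3,4) M(3,4) unfolding inj_on_fst_iff inj_on_snd_iff by auto
  have d1: "fst ` E \<inter> fst ` ?E' = {}" "snd ` E \<inter> snd ` ?E' = {}"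
    unfolding f using sh[OF ran(3)] sh[OF ran(4)] ran(1,2) by blast+
  have d2: "fst ` (E \<union> ?E') \<inter> fst ` ?M = {}" "snd ` (E \<union> ?E') \<inter> snd ` ?M = {}"
  proof -
    have "?sh (fst ` E') \<inter> set as = {}" using sh[OF ran(3)] ran(5) by blast
    then show "fst ` (E \<union> ?E') \<inter> fst ` ?M = {}"
      unfolding image_Un f Int_Un_distrib2 using ran(7) by (simp add: Int_commute)
    have "snd ` E \<inter> ?sh (set bs) = {}" using sh[OF ran(6)] ran(2) by blast
    then show "snd ` (E \<union> ?E') \<inter> snd ` ?M = {}"
      unfolding image_Un f Int_Un_distrib2 using shi[OF ran(8)] by (simp add: Int_commute)
  qed
  have i1: "inj_on fst ?E"
    by (intro injUn VG(3) inj4 d1 d2)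
  have i2: "inj_on snd ?E"
    by (intro injUn VG(4) inj4 d1 d2)
  have lt: "block (ls @ ls') a < block (ls @ ls') b" if e: "(a, b) \<in> ?E" for a b
  proof -
    consider "(a, b) \<in> E" | a' b' where "(a', b') \<in> E'" "a = a' + w" "b = b' + w"
      | b' where "(a, b') \<in> M" "b = b' + w"
      using e unfolding Un_iff by fast
    then show ?thesis
    proof cases
      case 1
      then show ?thesis using VG(5) PE[OF 1] by (simp add: P_def w_def block_append_left)
    next
      case 2
      then show ?thesis using VG'(5) PE'[OF 2(1)]
        by (simp add: P'_def w_def block_append_right)
    next
      case 3
      have "a \<in> P" "b' \<in> P'" using Mm[OF 3(1)] VG VG' by auto
      then show ?thesis using block_bounds[of a ls] block_bounds[of b' ls']
        by (simp add: P_def P'_def w_def 3 block_append_left block_append_right)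
    qed
  qed
  have sub: "?E \<subseteq> {1..w + sum_list ls'} \<times> {1..w + sum_list ls'}"
    using PE PE' Mm VG(6) VG'(7) by (fastforce simp: P_def P'_def)
  have PP: "P \<subseteq> {1..w + sum_list ls'}" "?sh P' \<subseteq> {1..w + sum_list ls'}"
    by (auto simp: P_def P'_def)
  have up: "(U - set as) \<union> ?sh U' \<subseteq> {1..w + sum_list ls'} - fst ` ?E"
  proof -
    have U: "U \<subseteq> P" "U' \<subseteq> P'" "U \<inter> fst ` E = {}" "U' \<inter> fst ` E' = {}" using VG(6) VG'(6) by auto
    have "(U - set as) \<union> ?sh U' \<subseteq> {1..w + sum_list ls'}"
      using image_mono[OF U(2), of "\<lambda>i. i + w"] U(1) PP by blast
    moreover have "((U - set as) \<union> ?sh U') \<inter> fst ` ?E = {}"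
    proof -
      have "(U - set as) \<inter> ?sh (fst ` E') = {}" "?sh U' \<inter> fst ` E = {}" "?sh U' \<inter> set as = {}"
        using U(1) sh[OF ran(3)] sh[OF U(2)] ran(1,5) by blast+
      moreover have "(U - set as) \<inter> fst ` E = {}" "(U - set as) \<inter> set as = {}" using U(3) by auto
      ultimately show ?thesis
        unfolding image_Un f Int_Un_distrib Int_Un_distrib2 using shi[OF U(4)] by simp
    qed
    ultimately show ?thesis unfolding Diff_eq disjoint_eq_subset_Compl by simp
  qed
  have down: "D \<union> ?sh (D' - set bs) \<subseteq> {1..w + sum_list ls'} - snd ` ?E"
  proof -
    have D: "D \<subseteq> P" "D' - set bs \<subseteq> P'" "D \<inter> snd ` E = {}" "(D' - set bs) \<inter> snd ` E' = {}"
      "(D' - set bs) \<inter> set bs = {}"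
      using VG(7) VG'(7) by blast+
    have "D \<union> ?sh (D' - set bs) \<subseteq> {1..w + sum_list ls'}"
      using image_mono[OF D(2), of "\<lambda>i. i + w"] D(1) PP by blast
    moreover have "(D \<union> ?sh (D' - set bs)) \<inter> snd ` ?E = {}"
    proof -
      have "D \<inter> ?sh (snd ` E') = {}" "D \<inter> ?sh (set bs) = {}" "?sh (D' - set bs) \<inter> snd ` E = {}"
        subgoal using sh[OF ran(4)] D(1) by blast
        subgoal using sh[OF ran(6)] D(1) by blast
        subgoal using sh[OF D(2)] ran(2) by blast
        done
      then show ?thesis
        unfolding image_Un f Int_Un_distrib Int_Un_distrib2 using D(3) shi[OF D(4)] shi[OF D(5)] by simp
    qed
    ultimately show ?thesis unfolding Diff_eq disjoint_eq_subset_Compl by simp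
  qed
  show ?thesis
    unfolding valid_bdiag_def compose_pre_def G G' Let_def pre_bdiag.sel sum_list_append
      w_def[symmetric] M_def[symmetric]
  proof (intro conjI)
    show "\<forall>l\<in>set (ls @ ls'). 1 \<le> l" using VG(1) VG'(1) by auto
    show "\<forall>(a, b)\<in>?E. block (ls @ ls') a < block (ls @ ls') b" using lt by fast
  qed (fact sub i1 i2 up down)+
qed

definition compositions :: "bdiag \<Rightarrow> bdiag \<Rightarrow> bdiag set" where
  "compositions G G' =
     {Abs_bdiag (compose_pre (Rep_bdiag G) (Rep_bdiag G') as bs) | as bs. composable G G' as bs}"

definition juxtapose :: "bdiag \<Rightarrow> bdiag \<Rightarrow> bdiag" where
  "juxtapose G G' = Abs_bdiag (compose_pre (Rep_bdiag G) (Rep_bdiag G') [] [])"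


subsection \<open>Isolated sets of vertices and sub-B-diagrams\<close>

definition Iso :: "bdiag \<Rightarrow> nat set set" where
  "Iso G = {I. I \<subseteq> {1..vertices G} \<and>
     (\<forall>(a, b)\<in>edges G.
        (block (lam G) a \<in> I \<and> block (lam G) b \<in> I) \<or>
        (block (lam G) a \<in> {1..vertices G} - I \<and> block (lam G) b \<in> {1..vertices G} - I))}"

text \<open>\<open>rank_in A\<close> restricts to the increasing bijection from the finite set \<open>A\<close> onto
  \<open>{1..card A}\<close>. For \<open>I\<close> isolated, every edge with an end in \<open>H\<close> lies in \<open>H \<times> H\<close>.\<close>

definition rank_in :: "nat set \<Rightarrow> nat \<Rightarrow> nat" where
  "rank_in A a = card {h \<in> A. h \<le> a}"

definition sub_pre :: "pre_bdiag \<Rightarrow> nat set \<Rightarrow> pre_bdiag" where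
  "sub_pre G I =
     (let ls = pre_lam G; H = {a \<in> {1..sum_list ls}. block ls a \<in> I}; r = rank_in H in
       Pre_bdiag (nths ls {i. Suc i \<in> I})
         ((\<lambda>(a, b). (r a, r b)) ` (pre_edges G \<inter> H \<times> H))
         (r ` (pre_up G \<inter> H))
         (r ` (pre_down G \<inter> H)))"

lemma rank_in_less:
  assumes "finite A" "b \<in> A" "a < b" shows "rank_in A a < rank_in A b"
proof -
  have "b \<in> {h \<in> A. h \<le> b}" "b \<notin> {h \<in> A. h \<le> a}" using assms by auto
  moreover have "{h \<in> A. h \<le> a} \<subseteq> {h \<in> A. h \<le> b}" using assms by auto
  ultimately have "{h \<in> A. h \<le> a} \<subset> {h \<in> A. h \<le> b}" by blast
  then show ?thesis unfolding rank_in_def by (rule psubset_card_mono[rotated]) (use assms in simp)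
qed

lemma inj_on_rank_in: "finite A \<Longrightarrow> inj_on (rank_in A) A"
  by (rule linorder_inj_onI') (use rank_in_less in fastforce)

lemma card_block_in:
  "card {h \<in> {1..sum_list ls}. block ls h \<in> I} = sum_list (nths ls {i. Suc i \<in> I})"
proof (induction ls rule: rev_induct)
  case Nil
  then show ?case by simp
next
  case (snoc x ls)
  let ?s = "sum_list ls"
  have e: "{h \<in> {1..sum_list (ls @ [x])}. block (ls @ [x]) h \<in> I} =
    {h \<in> {1..?s}. block ls h \<in> I} \<union> {h \<in> {?s + 1..?s + x}. Suc (length ls) \<in> I}"
  proof -
    have "block (ls @ [x]) h = Suc (length ls)" if "h \<in> {?s + 1..?s + x}" for h
      by (rule block_eqI) (use that in auto)
    moreover have "{1..sum_list (ls @ [x])} = {1..?s} \<union> {?s + 1..?s + x}" by auto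
    ultimately show ?thesis
      using block_append_left[of _ ls "[x]"] by (auto simp: Suc_le_eq)
  qed
  have "card {h \<in> {1..sum_list (ls @ [x])}. block (ls @ [x]) h \<in> I} =
    card {h \<in> {1..?s}. block ls h \<in> I} + card {h \<in> {?s + 1..?s + x}. Suc (length ls) \<in> I}"
    unfolding e by (rule card_Un_disjoint) auto
  also have "\<dots> = sum_list (nths (ls @ [x]) {i. Suc i \<in> I})"
  proof -
    have "card {h \<in> {?s + 1..?s + x}. Suc (length ls) \<in> I} = (if Suc (length ls) \<in> I then x else 0)"
      by (cases "Suc (length ls) \<in> I") (simp_all del: atLeastAtMost_iff)
    then show ?thesis using snoc by (simp add: nths_append)
  qed
  finally show ?case .
qed

lemma take_nths: "take (card {i. i < m \<and> i \<in> A}) (nths ls A) = nths ls (A \<inter> {..<m})"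
proof (cases "m \<le> length ls")
  case True
  have "ls = take m ls @ drop m ls" by simp
  then have "nths ls A = nths (take m ls) A @ nths (drop m ls) {j. j + m \<in> A}"
    using True by (metis length_take min.absorb2 nths_append)
  moreover have "length (nths (take m ls) A) = card {i. i < m \<and> i \<in> A}"
    using True by (simp add: length_nths)
  moreover have "nths ls (A \<inter> {..<m}) = nths (take m ls) (A \<inter> {..<m}) @ nths (drop m ls) {j. j + m \<in> A \<inter> {..<m}}"
    using True by (metis append_take_drop_id length_take min.absorb2 nths_append)
  moreover have "nths (take m ls) (A \<inter> {..<m}) = nths (take m ls) A"
    unfolding nths_def by (rule arg_cong[where f = "map fst"], rule filter_cong) (auto simp: set_zip)
  ultimately show ?thesis by simp
next
  case False
  have "nths ls (A \<inter> {..<m}) = nths ls A"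
    unfolding nths_def using False by (intro arg_cong[where f = "map fst"] filter_cong) (auto simp: set_zip)
  moreover have "length (nths ls A) \<le> card {i. i < m \<and> i \<in> A}"
    unfolding length_nths using False by (intro card_mono) auto
  ultimately show ?thesis by simp
qed

lemma block_rank_in_less:
  fixes ls :: "nat list" and I :: "nat set"
  defines "H \<equiv> {a \<in> {1..sum_list ls}. block ls a \<in> I}"
  assumes a: "a \<in> H" and b: "b \<in> H" and ab: "block ls a < block ls b"
  shows "block (nths ls {i. Suc i \<in> I}) (rank_in H a) < block (nths ls {i. Suc i \<in> I}) (rank_in H b)"
proof -
  define i where "i = block ls a"
  define A where "A = {i. Suc i \<in> I}"
  define ls' where "ls' = nths ls A"
  define r where "r = card {j. j < i \<and> j \<in> A}"
  have fin: "finite H" unfolding H_def by simp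
  have range: "rank_in H x \<in> {1..sum_list ls'}" if "x \<in> H" for x
  proof -
    have "card {h \<in> H. h \<le> x} \<le> card H" by (rule card_mono) (use fin in auto)
    moreover have "card H = sum_list ls'" unfolding H_def ls'_def A_def by (rule card_block_in)
    moreover have "card {h \<in> H. h \<le> x} > 0" using fin that by (auto simp: card_gt_0_iff)
    ultimately show ?thesis by (simp add: rank_in_def)
  qed
  have "{i. Suc i \<in> I} \<inter> {..<i} = {j. Suc j \<in> I \<inter> {..i}}" by auto
  then have "sum_list (take r ls') = sum_list (nths ls {j. Suc j \<in> I \<inter> {..i}})"
    unfolding r_def ls'_def take_nths by (simp add: A_def)
  also have "\<dots> = card {h \<in> H. block ls h \<le> i}"
    unfolding card_block_in[symmetric] H_def by (rule arg_cong[where f = card]) auto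
  finally have take: "sum_list (take r ls') = card {h \<in> H. block ls h \<le> i}" .
  have mono: "block ls h \<le> i" if "h \<in> H" "h \<le> a" for h
    using that a block_le_iff[of a ls i] block_le_iff[of h ls i] by (auto simp: H_def i_def)
  have "rank_in H a \<le> card {h \<in> H. block ls h \<le> i}"
    unfolding rank_in_def by (rule card_mono) (use fin mono in auto)
  then have 1: "block ls' (rank_in H a) \<le> r"
    using block_le_iff[OF range[OF a]] take by simp
  have le_b: "h \<le> b" if "h \<in> H" "block ls h \<le> i" for h
  proof (rule ccontr)
    assume "\<not> h \<le> b"
    then have "block ls b \<le> i"
      using that b block_le_iff[of b ls i] block_le_iff[of h ls i] by (auto simp: H_def)
    then show False using ab i_def by simp
  qed
  have "card {h \<in> H. block ls h \<le> i} < rank_in H b"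
  proof -
    have "b \<in> {h \<in> H. h \<le> b}" "b \<notin> {h \<in> H. block ls h \<le> i}" using b ab i_def by auto
    moreover have "{h \<in> H. block ls h \<le> i} \<subseteq> {h \<in> H. h \<le> b}"
      using le_b by blast
    ultimately have "{h \<in> H. block ls h \<le> i} \<subset> {h \<in> H. h \<le> b}" by blast
    then show ?thesis unfolding rank_in_def by (rule psubset_card_mono[rotated]) (use fin in simp)
  qed
  then have 2: "\<not> block ls' (rank_in H b) \<le> r"
    using block_le_iff[OF range[OF b]] take by simp
  from 1 2 show ?thesis by (simp add: ls'_def A_def)
qed

lift_definition sub_bdiag :: "bdiag \<Rightarrow> nat set \<Rightarrow> bdiag" is sub_pre
proof -
  fix G :: pre_bdiag and I assume v: "valid_bdiag G"
  obtain ls E U D where G: "G = Pre_bdiag ls E U D" by (cases G)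
  define H where "H = {a \<in> {1..sum_list ls}. block ls a \<in> I}"
  define r where "r = rank_in H"
  define ls' where "ls' = nths ls {i. Suc i \<in> I}"
  have fin: "finite H" unfolding H_def by simp
  have V: "\<forall>l\<in>set ls. 1 \<le> l" "inj_on fst E" "inj_on snd E"
      "\<And>a b. (a, b) \<in> E \<Longrightarrow> block ls a < block ls b" "U \<inter> fst ` E = {}" "D \<inter> snd ` E = {}"
    using v unfolding valid_bdiag_def G Let_def pre_bdiag.sel by blast+
  have inj: "inj_on r H" unfolding r_def by (rule inj_on_rank_in[OF fin])
  have range: "r x \<in> {1..sum_list ls'}" if "x \<in> H" for x
  proof -
    have "card {h \<in> H. h \<le> x} \<le> card H" by (rule card_mono) (use fin in auto)
    moreover have "card H = sum_list ls'" unfolding H_def ls'_def by (rule card_block_in)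
    moreover have "card {h \<in> H. h \<le> x} > 0" using fin that by (auto simp: card_gt_0_iff)
    ultimately show ?thesis by (simp add: rank_in_def r_def)
  qed
  let ?E = "(\<lambda>(a, b). (r a, r b)) ` (E \<inter> H \<times> H)"
  have i1: "inj_on fst ?E" and i2: "inj_on snd ?E"
    using V(2,3) inj unfolding inj_on_fst_iff inj_on_snd_iff by (auto dest!: inj_onD) metis
  have lt: "block ls' a < block ls' b" if e: "(a, b) \<in> ?E" for a b
  proof -
    from e obtain z where z: "(a, b) = (\<lambda>(a, b). (r a, r b)) z" "z \<in> E \<inter> H \<times> H"
      by (rule imageE)
    obtain x y where "z = (x, y)" by (cases z)
    with z have xy: "a = r x" "b = r y" "(x, y) \<in> E" "x \<in> H" "y \<in> H" by simp_all
    show ?thesis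
      unfolding xy(1,2) r_def ls'_def
      by (rule block_rank_in_less[of x ls I y, folded H_def]) (fact xy(4,5) V(4)[OF xy(3)])+
  qed
  have img: "fst ` ?E \<subseteq> r ` (fst ` E \<inter> H)" "snd ` ?E \<subseteq> r ` (snd ` E \<inter> H)"
    unfolding image_image split_beta fst_conv snd_conv by force+
  have disj: "r ` (X \<inter> H) \<inter> r ` (Y \<inter> H) = {}" if "X \<inter> Y = {}" for X Y
  proof -
    have "X \<inter> H \<inter> (Y \<inter> H) = {}" using that by blast
    then show ?thesis using inj_on_image_Int[OF inj, of "X \<inter> H" "Y \<inter> H"] by simp
  qed
  have dj: "r ` (U \<inter> H) \<inter> fst ` ?E = {}" "r ` (D \<inter> H) \<inter> snd ` ?E = {}"
    using Int_mono[OF subset_refl img(1), of "r ` (U \<inter> H)"] Int_mono[OF subset_refl img(2), of "r ` (D \<inter> H)"]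
    unfolding disj[OF V(5)] disj[OF V(6)] by (simp_all only: subset_empty)
  have ud: "r ` (U \<inter> H) \<subseteq> {1..sum_list ls'} - fst ` ?E" "r ` (D \<inter> H) \<subseteq> {1..sum_list ls'} - snd ` ?E"
  proof -
    have "r ` (X \<inter> H) \<subseteq> {1..sum_list ls'}" for X by (rule image_subsetI) (use range in blast)
    with dj show "r ` (U \<inter> H) \<subseteq> {1..sum_list ls'} - fst ` ?E" "r ` (D \<inter> H) \<subseteq> {1..sum_list ls'} - snd ` ?E"
      unfolding Diff_eq disjoint_eq_subset_Compl by (simp_all only: Int_subset_iff simp_thms)
  qed
  have e: "?E \<subseteq> {1..sum_list ls'} \<times> {1..sum_list ls'}"
  proof
    fix z assume "z \<in> ?E"
    then obtain y where "z = (\<lambda>(a, b). (r a, r b)) y" "y \<in> E \<inter> H \<times> H" by (rule imageE)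
    then show "z \<in> {1..sum_list ls'} \<times> {1..sum_list ls'}"
      using range[of "fst y"] range[of "snd y"] by (simp add: split_beta mem_Times_iff)
  qed
  have pos: "\<forall>l\<in>set ls'. 1 \<le> l"
    using V(1) set_nths_subset[of ls] unfolding ls'_def by blast
  have lt': "\<forall>(a, b)\<in>?E. block ls' a < block ls' b" using lt by fast
  show "valid_bdiag (sub_pre G I)"
    unfolding valid_bdiag_def sub_pre_def G Let_def pre_bdiag.sel
      H_def[symmetric] r_def[symmetric] ls'_def[symmetric]
    by (intro conjI) (fact pos e i1 i2 lt' ud)+
qed


subsection \<open>Permuting vertices\<close>

text \<open>The list \<open>block_word ls \<sigma>\<close> is the word of \<open>\<sigma>[\<lambda>]\<close>.\<close>

definition block_word :: "nat list \<Rightarrow> (nat \<Rightarrow> nat) \<Rightarrow> nat list" where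
  "block_word ls \<sigma> =
     concat (map (\<lambda>i. sorted_list_of_set {k \<in> {1..sum_list ls}. block ls k = \<sigma> i})
       [1..<length ls + 1])"

definition block_perm :: "nat list \<Rightarrow> (nat \<Rightarrow> nat) \<Rightarrow> nat \<Rightarrow> nat" where
  "block_perm ls \<sigma> i = block_word ls \<sigma> ! (i - 1)"

definition permute_pre :: "pre_bdiag \<Rightarrow> (nat \<Rightarrow> nat) \<Rightarrow> pre_bdiag" where
  "permute_pre G \<sigma> =
     (let ls = pre_lam G; P = {1..sum_list ls}; w = block_perm ls \<sigma> in
       Pre_bdiag (map (\<lambda>i. ls ! (\<sigma> i - 1)) [1..<length ls + 1])
         {(i, j) \<in> P \<times> P. (w i, w j) \<in> pre_edges G}
         {i \<in> P. w i \<in> pre_up G}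
         {i \<in> P. w i \<in> pre_down G})"

text \<open>This is meaningful only if \<open>permute_pre\<close> yields a B-diagram, which is not the case for all
  \<open>\<sigma>\<close>, but for the shuffles considered below; see \<open>valid_permute_shuffle\<close>.\<close>

definition permute :: "bdiag \<Rightarrow> (nat \<Rightarrow> nat) \<Rightarrow> bdiag" where
  "permute G \<sigma> = Abs_bdiag (permute_pre (Rep_bdiag G) \<sigma>)"

definition shuffles_perm :: "nat \<Rightarrow> nat \<Rightarrow> (nat \<Rightarrow> nat) set" where
  "shuffles_perm n n' =
     {\<sigma>. \<sigma> permutes {1..n + n'} \<and>
        (\<forall>i\<in>{1..n + n'}. \<forall>j\<in>{1..n + n'}. i < j \<longrightarrow>
           (\<sigma> i \<in> {1..n} \<and> \<sigma> j \<in> {1..n} \<longrightarrow> \<sigma> i < \<sigma> j) \<and>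
           (\<sigma> i \<in> {n + 1..n + n'} \<and> \<sigma> j \<in> {n + 1..n + n'} \<longrightarrow> \<sigma> i < \<sigma> j))}"

lemma nth_concat_block:
  assumes "p \<in> {1..length (concat xss)}"
  shows "concat xss ! (p - 1) \<in> set (xss ! (block (map length xss) p - 1))"
  using assms
proof (induction xss rule: rev_induct)
  case Nil
  then show ?case by simp
next
  case (snoc xs xss)
  let ?n = "length (concat xss)"
  have n: "sum_list (map length xss) = ?n" by (simp add: length_concat)
  show ?case
  proof (cases "p \<le> ?n")
    case True
    then have p: "p \<in> {1..?n}" using snoc by simp
    then have "block (map length (xss @ [xs])) p = block (map length xss) p"
      by (simp add: block_append_left n)
    moreover have "block (map length xss) p - 1 < length xss"
      using block_bounds(1,2)[of p "map length xss"] p n by simp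
    ultimately show ?thesis using snoc.IH[OF p] p by (auto simp: nth_append)
  next
    case False
    have "block (map length (xss @ [xs])) p = Suc (length xss)"
      by (rule block_eqI) (use snoc.prems False n in auto)
    then show ?thesis using snoc.prems False by (auto simp: nth_append)
  qed
qed

context
  fixes ls :: "nat list" and \<sigma> :: "nat \<Rightarrow> nat"
  assumes \<sigma>: "\<sigma> permutes {1..length ls}"
begin

lemma length_blocks_word:
  "map length (map (\<lambda>i. sorted_list_of_set {k \<in> {1..sum_list ls}. block ls k = \<sigma> i})
     [1..<length ls + 1]) = map (\<lambda>i. ls ! (\<sigma> i - 1)) [1..<length ls + 1]"
proof -
  have "card {k \<in> {1..sum_list ls}. block ls k = \<sigma> i} = ls ! (\<sigma> i - 1)" if "i \<in> {1..length ls}" for i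
  proof -
    have \<sigma>i: "\<sigma> i \<in> {1..length ls}" using permutes_in_image[OF \<sigma>] that by blast
    define m where "m = \<sigma> i - 1"
    have m: "\<sigma> i = Suc m" "m < length ls" using \<sigma>i by (auto simp: m_def)
    have "{k \<in> {1..sum_list ls}. block ls k = \<sigma> i} = {k \<in> {1..sum_list ls}. block ls k \<in> {\<sigma> i}}"
      by auto
    then have "card {k \<in> {1..sum_list ls}. block ls k = \<sigma> i} = sum_list (nths ls {j. Suc j \<in> {\<sigma> i}})"
      using card_block_in[of ls "{\<sigma> i}"] by simp
    also have "{j. Suc j \<in> {\<sigma> i}} = {m}" using m by auto
    also have "nths ls {m} = [ls ! m]"
    proof -
      have "ls = take m ls @ ls ! m # drop (Suc m) ls" using m by (simp add: id_take_nth_drop)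
      then have "nths ls {m} = nths (take m ls @ ls ! m # drop (Suc m) ls) {m}" by simp
      also have "\<dots> = [ls ! m]"
        using m by (simp add: nths_append nths_Cons) (auto simp: nths_def filter_empty_conv set_zip)
      finally show ?thesis .
    qed
    finally show ?thesis by (simp add: m_def)
  qed
  then show ?thesis by (simp del: upt_Suc)
qed

lemma sum_list_permute: "sum_list (map (\<lambda>i. ls ! (\<sigma> i - 1)) [1..<length ls + 1]) = sum_list ls"
proof -
  have "sum_list (map (\<lambda>i. ls ! (\<sigma> i - 1)) [1..<length ls + 1]) =
      (\<Sum>i\<in>{1..length ls}. (\<lambda>i. ls ! (i - 1)) (\<sigma> i))"
    by (simp add: interv_sum_list_conv_sum_set_nat atLeastLessThanSuc_atLeastAtMost del: upt_Suc)
  also have "\<dots> = (\<Sum>i\<in>{1..length ls}. ls ! (i - 1))"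
    using sum.permute[OF \<sigma>, of "\<lambda>i. ls ! (i - 1)"] by (simp add: comp_def)
  also have "\<dots> = (\<Sum>i\<in>{0..<length ls}. ls ! i)"
    by (rule sum.reindex_bij_witness[of _ Suc "\<lambda>i. i - 1"]) auto
  also have "\<dots> = sum_list ls" by (simp add: sum_list_sum_nth)
  finally show ?thesis .
qed

lemma length_block_word: "length (block_word ls \<sigma>) = sum_list ls"
  unfolding block_word_def length_concat length_blocks_word sum_list_permute ..

lemma set_block_word: "set (block_word ls \<sigma>) = {1..sum_list ls}"
proof -
  have "k \<in> set (block_word ls \<sigma>)" if k: "k \<in> {1..sum_list ls}" for k
  proof -
    have "block ls k \<in> \<sigma> ` {1..length ls}"
      using block_bounds(1,2)[OF k] permutes_image[OF \<sigma>] by simp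
    then obtain i where "i \<in> {1..length ls}" "block ls k = \<sigma> i" by blast
    then show ?thesis using k by (auto simp: block_word_def simp del: upt_Suc)
  qed
  then show ?thesis by (auto simp: block_word_def simp del: upt_Suc)
qed

lemma bij_betw_block_perm: "bij_betw (block_perm ls \<sigma>) {1..sum_list ls} {1..sum_list ls}"
proof -
  have d: "distinct (block_word ls \<sigma>)"
    by (rule card_distinct) (simp add: set_block_word length_block_word)
  have "bij_betw (\<lambda>i. i - 1) {1..sum_list ls} {..<sum_list ls}"
    by (rule bij_betw_byWitness[where f' = Suc]) auto
  moreover have "bij_betw ((!) (block_word ls \<sigma>)) {..<sum_list ls} {1..sum_list ls}"
    by (rule bij_betw_nth[OF d]) (simp_all add: length_block_word set_block_word)
  ultimately have "bij_betw ((!) (block_word ls \<sigma>) \<circ> (\<lambda>i. i - 1)) {1..sum_list ls} {1..sum_list ls}"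
    by (rule bij_betw_trans)
  then show ?thesis by (simp add: block_perm_def comp_def cong: bij_betw_cong)
qed

lemma block_block_perm:
  assumes "p \<in> {1..sum_list ls}"
  shows "block ls (block_perm ls \<sigma> p) =
    \<sigma> (block (map (\<lambda>i. ls ! (\<sigma> i - 1)) [1..<length ls + 1]) p)"
proof -
  define ls' where "ls' = map (\<lambda>i. ls ! (\<sigma> i - 1)) [1..<length ls + 1]"
  let ?xss = "map (\<lambda>i. sorted_list_of_set {k \<in> {1..sum_list ls}. block ls k = \<sigma> i}) [1..<length ls + 1]"
  have "p \<in> {1..length (concat ?xss)}"
    using assms length_block_word by (simp add: block_word_def del: upt_Suc)
  from nth_concat_block[OF this]
  have *: "block_perm ls \<sigma> p \<in> set (?xss ! (block ls' p - 1))"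
    unfolding length_blocks_word ls'_def by (simp add: block_perm_def block_word_def del: upt_Suc)
  have "block ls' p \<in> {1..length ls}"
    using block_bounds(1,2)[of p ls'] assms sum_list_permute by (simp add: ls'_def del: upt_Suc)
  then obtain m where m: "block ls' p = Suc m" "m < length ls"
    by (cases "block ls' p") auto
  have "?xss ! m = sorted_list_of_set {k \<in> {1..sum_list ls}. block ls k = \<sigma> (Suc m)}"
    using m(2) by (simp del: upt_Suc)
  then have "block_perm ls \<sigma> p \<in> {k \<in> {1..sum_list ls}. block ls k = \<sigma> (Suc m)}"
    using * m(1) by (simp del: upt_Suc)
  with m(1) show ?thesis by (simp add: ls'_def del: upt_Suc)
qed

end

lemma valid_permute_pre:
  assumes v: "valid_bdiag G"
    and \<sigma>: "\<sigma> permutes {1..length (pre_lam G)}"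
    and incr: "\<And>a b i j. \<lbrakk>(a, b) \<in> pre_edges G; i \<in> {1..length (pre_lam G)}; j \<in> {1..length (pre_lam G)};
      block (pre_lam G) a = \<sigma> i; block (pre_lam G) b = \<sigma> j\<rbrakk> \<Longrightarrow> i < j"
  shows "valid_bdiag (permute_pre G \<sigma>)"
proof -
  obtain ls E U D where G: "G = Pre_bdiag ls E U D" by (cases G)
  define P where "P = {1..sum_list ls}"
  define w where "w = block_perm ls \<sigma>"
  define ls' where "ls' = map (\<lambda>i. ls ! (\<sigma> i - 1)) [1..<length ls + 1]"
  have \<sigma>': "\<sigma> permutes {1..length ls}" using \<sigma> by (simp add: G)
  have V: "\<forall>l\<in>set ls. 1 \<le> l" "inj_on fst E" "inj_on snd E" "U \<inter> fst ` E = {}" "D \<inter> snd ` E = {}"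
    using v unfolding valid_bdiag_def G Let_def pre_bdiag.sel by blast+
  have s: "sum_list ls' = sum_list ls" unfolding ls'_def by (rule sum_list_permute[OF \<sigma>'])
  have inj: "inj_on w P" using bij_betw_block_perm[OF \<sigma>'] by (simp add: w_def P_def bij_betw_def)
  let ?E = "{(i, j) \<in> P \<times> P. (w i, w j) \<in> E}"
  have i1: "inj_on fst ?E" and i2: "inj_on snd ?E"
    using V(2,3) inj_onD[OF inj] unfolding inj_on_fst_iff inj_on_snd_iff by (simp, metis)+
  have lt: "block ls' i < block ls' j" if "(i, j) \<in> ?E" for i j
  proof -
    have ij: "i \<in> {1..sum_list ls}" "j \<in> {1..sum_list ls}" "(w i, w j) \<in> E"
      using that by (auto simp: P_def)
    have "length ls' = length ls" by (simp add: ls'_def del: upt_Suc)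
    with block_bounds(1,2)[of i ls'] block_bounds(1,2)[of j ls'] ij s
    have b: "block ls' i \<in> {1..length ls}" "block ls' j \<in> {1..length ls}" by auto
    show ?thesis
      using incr[of "w i" "w j" "block ls' i" "block ls' j"] ij b block_block_perm[OF \<sigma>']
      by (simp add: G w_def ls'_def del: upt_Suc)
  qed
  have "\<forall>l\<in>set ls'. 1 \<le> l"
  proof -
    have "\<sigma> i - 1 < length ls" if "i \<in> {1..length ls}" for i
    proof -
      have "\<sigma> i \<in> {1..length ls}" using permutes_in_image[OF \<sigma>'] that by blast
      then show ?thesis by auto
    qed
    then show ?thesis using V(1) by (auto simp: ls'_def simp del: upt_Suc)
  qed
  moreover have "{i \<in> P. w i \<in> U} \<subseteq> P - fst ` ?E"
  proof
    fix i assume "i \<in> {i \<in> P. w i \<in> U}"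
    then have "i \<in> P" "w i \<notin> fst ` E" using V(4) by auto
    then show "i \<in> P - fst ` ?E" by force
  qed
  moreover have "{i \<in> P. w i \<in> D} \<subseteq> P - snd ` ?E"
  proof
    fix i assume "i \<in> {i \<in> P. w i \<in> D}"
    then have "i \<in> P" "w i \<notin> snd ` E" using V(5) by auto
    then show "i \<in> P - snd ` ?E" by force
  qed
  moreover have "?E \<subseteq> P \<times> P" by blast
  moreover have "\<forall>(i, j)\<in>?E. block ls' i < block ls' j" using lt by fast
  ultimately show ?thesis
    unfolding valid_bdiag_def permute_pre_def G Let_def pre_bdiag.sel
      P_def[symmetric] w_def[symmetric] ls'_def[symmetric] s
    by (intro conjI i1 i2)
qed

lemma valid_permute_shuffle:
  assumes \<sigma>: "\<sigma> \<in> shuffles_perm (vertices G) (vertices G')"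
  shows "valid_bdiag (permute_pre (Rep_bdiag (juxtapose G G')) \<sigma>)"
proof -
  obtain ls E U D where G: "Rep_bdiag G = Pre_bdiag ls E U D" by (cases "Rep_bdiag G")
  obtain ls' E' U' D' where G': "Rep_bdiag G' = Pre_bdiag ls' E' U' D'" by (cases "Rep_bdiag G'")
  have v: "valid_bdiag (Pre_bdiag ls E U D)" "valid_bdiag (Pre_bdiag ls' E' U' D')"
    using Rep_bdiag[of G] Rep_bdiag[of G'] G G' by auto
  define J where "J = Rep_bdiag (juxtapose G G')"
  have J: "J = compose_pre (Rep_bdiag G) (Rep_bdiag G') [] []"
    unfolding J_def juxtapose_def
    using valid_compose_pre[of G G' "[]" "[]"] by (simp add: Abs_bdiag_inverse composable_def)
  have n: "vertices G = length ls" "vertices G' = length ls'"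
    by (simp_all add: vertices_def lam.rep_eq G G')
  have lamJ: "pre_lam J = ls @ ls'" by (simp add: J compose_pre_def G G' Let_def)
  have vJ: "valid_bdiag J" using Rep_bdiag[of "juxtapose G G'"] by (simp add: J_def)
  have same: "(block (ls @ ls') a \<le> length ls \<and> block (ls @ ls') b \<le> length ls) \<or>
      (length ls < block (ls @ ls') a \<and> length ls < block (ls @ ls') b)"
    if e: "(a, b) \<in> pre_edges J" for a b
  proof -
    consider "(a, b) \<in> E"
      | a' b' where "(a', b') \<in> E'" "a = a' + sum_list ls" "b = b' + sum_list ls"
      using e by (auto simp: J compose_pre_def G G' Let_def)
    then show ?thesis
    proof cases
      case 1
      then have "a \<in> {1..sum_list ls}" "b \<in> {1..sum_list ls}"
        using v(1) unfolding valid_bdiag_def Let_def pre_bdiag.sel by blast+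
      then show ?thesis using block_bounds(2)[of a ls] block_bounds(2)[of b ls]
        by (simp add: block_append_left)
    next
      case 2
      then have "a' \<in> {1..sum_list ls'}" "b' \<in> {1..sum_list ls'}"
        using v(2) unfolding valid_bdiag_def Let_def pre_bdiag.sel by blast+
      then show ?thesis using block_bounds(1)[of a' ls'] block_bounds(1)[of b' ls'] 2
        by (simp add: block_append_right)
    qed
  qed
  have lt: "block (ls @ ls') a < block (ls @ ls') b" if "(a, b) \<in> pre_edges J" for a b
    using vJ that unfolding valid_bdiag_def Let_def lamJ by blast
  have perm: "\<sigma> permutes {1..length ls + length ls'}"
    using \<sigma> by (simp add: shuffles_perm_def n)
  have "valid_bdiag (permute_pre J \<sigma>)"
  proof (rule valid_permute_pre[OF vJ])
    show "\<sigma> permutes {1..length (pre_lam J)}" using perm by (simp add: lamJ)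
    fix a b i j
    assume e: "(a, b) \<in> pre_edges J" and i: "i \<in> {1..length (pre_lam J)}"
      and j: "j \<in> {1..length (pre_lam J)}"
      and bl: "block (pre_lam J) a = \<sigma> i" "block (pre_lam J) b = \<sigma> j"
    have ij: "i \<in> {1..length ls + length ls'}" "j \<in> {1..length ls + length ls'}"
      using i j by (simp_all add: lamJ)
    have \<sigma>ij: "\<sigma> i \<in> {1..length ls + length ls'}" "\<sigma> j \<in> {1..length ls + length ls'}"
      using permutes_in_image[OF perm] ij by blast+
    have l: "\<sigma> i < \<sigma> j" using lt[OF e] bl by (simp add: lamJ)
    have s: "(\<sigma> i \<le> length ls \<and> \<sigma> j \<le> length ls) \<or> (length ls < \<sigma> i \<and> length ls < \<sigma> j)"
      using same[OF e] bl by (simp add: lamJ)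
    have "\<not> j < i"
    proof
      assume "j < i"
      then have "(\<sigma> j \<in> {1..length ls} \<and> \<sigma> i \<in> {1..length ls} \<longrightarrow> \<sigma> j < \<sigma> i) \<and>
        (\<sigma> j \<in> {length ls + 1..length ls + length ls'} \<and>
         \<sigma> i \<in> {length ls + 1..length ls + length ls'} \<longrightarrow> \<sigma> j < \<sigma> i)"
        using \<sigma> ij unfolding shuffles_perm_def n by blast
      then show False using s l \<sigma>ij by auto
    qed
    moreover have "i \<noteq> j" using l by auto
    ultimately show "i < j" by simp
  qed
  then show ?thesis by (simp add: J_def)
qed

section \<open>The two structures\<close>

definition star :: "(bdiag \<times> bdiag) free \<Rightarrow> bdiag free" where
  "star = lin_ext (\<lambda>(G', G''). \<Sum>G\<in>compositions G' G''. basis G)"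

definition Delta :: "bdiag free \<Rightarrow> (bdiag \<times> bdiag) free" where
  "Delta = lin_ext (\<lambda>G. \<Sum>I\<in>Iso G.
     basis (sub_bdiag G I, sub_bdiag G ({1..vertices G} - I)))"

text \<open>The dual space is presented by coordinates with respect to the basis \<open>(D\<^sub>G)\<close>: its elements are
  again of type \<open>bdiag free\<close>, where now \<open>basis G\<close> stands for \<open>D\<^sub>G\<close>. By means of the following
  pairing, such an element is a linear functional on the space with basis \<open>bdiag\<close>.\<close>

abbreviation (input) Dvec :: "bdiag \<Rightarrow> bdiag free" where "Dvec \<equiv> basis"

definition pairing :: "bdiag free \<Rightarrow> bdiag free \<Rightarrow> complex" where
  "pairing f x = (\<Sum>G\<in>Poly_Mapping.keys f. \<Sum>G'\<in>Poly_Mapping.keys x.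
     Poly_Mapping.lookup f G * Poly_Mapping.lookup x G' * (if G = G' then 1 else 0))"

definition cup :: "(bdiag \<times> bdiag) free \<Rightarrow> bdiag free" where
  "cup = lin_ext (\<lambda>(G, G').
     \<Sum>\<sigma>\<in>shuffles_perm (vertices G) (vertices G'). Dvec (permute (juxtapose G G') \<sigma>))"

definition Delta_star :: "bdiag free \<Rightarrow> (bdiag \<times> bdiag) free" where
  "Delta_star = lin_ext (\<lambda>G.
     \<Sum>(G', G'')\<in>{(G', G''). G \<in> compositions G' G''}. tensor (Dvec G') (Dvec G''))"

end

theory Submission
  imports Defs
begin

text \<open>
  For a B-diagram \<open>G\<close> and any set \<open>I\<close> of vertices let \<open>G|I\<close> be the standardised restriction of \<open>G\<close>
  to \<open>I\<close>, in which an edge leaving \<open>I\<close> is cut open and its end in \<open>I\<close> becomes a free half-edge. Then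
  \<open>\<Delta>(G)\<close> is the sum of \<open>G|I \<otimes> G|I\<^sup>c\<close> over the isolated sets \<open>I\<close>, while \<open>\<Delta>\<^sub>*(D\<^sub>G)\<close> is the same sum
  over the initial segments \<open>I\<close> of the vertices, since \<open>G\<close> is a composition of \<open>G'\<close> and \<open>G''\<close> if and only if
  \<open>G'\<close> and \<open>G''\<close> are its restrictions to an initial segment and to the rest. Coassociativity of both
  follows from \<open>(G|I)|K = G|K\<close>. The shuffles \<open>\<sigma>\<close> correspond to the sets \<open>I\<close> of the positions of the first
  letters, and \<open>(G'|G'')\<^sup>\<sigma>\<close> is the unique diagram in which \<open>I\<close> is isolated and whose restrictions to \<open>I\<close> and
  its complement are \<open>G'\<close> and \<open>G''\<close>. Hence \<open>\<Cup>\<close> is the transpose of \<open>\<Delta>\<close>, and \<open>\<star>\<close> is that of \<open>\<Delta>\<^sub>*\<close>.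
  The compatibility of \<open>\<star>\<close> with \<open>\<Delta>\<close> also comes from this unique gluing, that of \<open>\<Cup>\<close> with \<open>\<Delta>\<^sub>*\<close> is its
  transpose, and the antipodes exist because the bialgebras are graded and connected.
\<close>

section \<open>Linear maps between free vector spaces\<close>

text \<open>The law linking \<open>star\<close> and \<open>Delta\<close> has to cope with the edges
  that a composition creates between its two factors. Such an edge is lost when a diagram is cut at
  an initial segment, but if I is isolated it joins two vertices of I or two vertices outside I. So
  it is seen by one of the restrictions to I and to its complement, and these two restrictions
  determine the composition. The argument never looks inside a diagram: it uses only how
  restriction, separation and gluing behave, which is why it is carried out over an abstract
  structure that B-diagrams are then shown to instantiate. Since D_G is written as the basis vector
  of G, the pairing becomes the standard bilinear form and duality becomes transposition of
  matrices. The empty diagram is the unit of both algebras, and pairing with it is the counit of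
  both. The second antipode is the transpose of the first; the transpose exists because a graded map
  has finitely many nonzero entries in each row once every degree has finitely many basis
  vectors.\<close>

abbreviation coef :: "'a free \<Rightarrow> 'a \<Rightarrow> complex" where
  "coef \<equiv> Poly_Mapping.lookup"

abbreviation supp :: "'a free \<Rightarrow> 'a set" where
  "supp \<equiv> Poly_Mapping.keys"

abbreviation lin :: "('a free \<Rightarrow> 'b free) \<Rightarrow> bool" where
  "lin \<equiv> Vector_Spaces.linear scl scl"

abbreviation functional :: "('a free \<Rightarrow> complex) \<Rightarrow> bool" where
  "functional \<equiv> Vector_Spaces.linear scl (*)"

lemma vector_space_complex: "vector_space ((*) :: complex \<Rightarrow> complex \<Rightarrow> complex)"
  by unfold_locales (simp_all add: algebra_simps)

lemma lin_iff: "lin f \<longleftrightarrow> (\<forall>x y. f (x + y) = f x + f y) \<and> (\<forall>c x. f (scl c x) = scl c (f x))"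
  unfolding Vector_Spaces.linear_iff by (simp add: free.vector_space_axioms)

lemma functional_iff: "functional f \<longleftrightarrow> (\<forall>x y. f (x + y) = f x + f y) \<and> (\<forall>c x. f (scl c x) = c * f x)"
  unfolding Vector_Spaces.linear_iff by (simp add: free.vector_space_axioms vector_space_complex)

lemma lin_add: "lin f \<Longrightarrow> f (x + y) = f x + f y"
  and lin_scl: "lin f \<Longrightarrow> f (scl c x) = scl c (f x)"
  by (simp_all add: lin_iff)

lemma lin_0: "lin f \<Longrightarrow> f 0 = 0"
  using lin_scl[of f 0 0] by simp

lemma lin_sum: "lin f \<Longrightarrow> f (sum g A) = (\<Sum>a\<in>A. f (g a))"
  by (induction A rule: infinite_finite_induct) (simp_all add: lin_add[of f] lin_0[of f])

lemma lin_minus: "lin f \<Longrightarrow> f (x - y) = f x - f y"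
  by (metis add_diff_cancel_right' diff_add_cancel lin_add)

lemma functional_0: "functional f \<Longrightarrow> f 0 = 0"
  unfolding functional_iff using free.scale_zero_left mult_zero_left by metis

lemma functional_sum: "functional f \<Longrightarrow> f (sum g A) = (\<Sum>a\<in>A. f (g a))"
  by (induction A rule: infinite_finite_induct) (simp_all add: functional_0[of f], simp add: functional_iff)

lemma lin_id: "lin id" "lin (\<lambda>x. x)"
  by (simp_all add: lin_iff)

lemma lin_comp: "lin f \<Longrightarrow> lin g \<Longrightarrow> lin (\<lambda>x. g (f x))"
  by (simp add: lin_iff)

lemma coef_basis: "coef (basis a) b = (if a = b then 1 else 0)"
  by (simp add: basis_def lookup_single when_def)

lemma supp_basis [simp]: "supp (basis a) = {a}"
  by (simp add: basis_def)

lemma coef_minus [simp]: "coef (x - y) a = coef x a - coef y a"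
  by (simp add: lookup_minus)

lemma free_expand: "x = (\<Sum>a\<in>supp x. scl (coef x a) (basis a))"
proof (rule poly_mapping_eqI)
  fix b
  have "coef (\<Sum>a\<in>supp x. scl (coef x a) (basis a)) b = (\<Sum>a\<in>supp x. if a = b then coef x a else 0)"
    unfolding lookup_sum by (rule sum.cong) (simp_all add: coef_basis)
  also have "\<dots> = coef x b"
    by (simp add: in_keys_iff)
  finally show "coef x b = coef (\<Sum>a\<in>supp x. scl (coef x a) (basis a)) b" by simp
qed

lemma lin_expand:
  assumes "lin f"
  shows "f x = (\<Sum>a\<in>supp x. scl (coef x a) (f (basis a)))"
  using arg_cong[OF free_expand[of x], of f] by (simp add: lin_sum[OF assms] lin_scl[OF assms])

lemma lin_eqI:
  assumes "lin f" "lin g" "\<And>a. f (basis a) = g (basis a)"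
  shows "f x = g x"
  using lin_expand[OF assms(1), of x] lin_expand[OF assms(2), of x] assms(3) by simp

lemma functional_eqI:
  assumes "functional f" "functional g" "\<And>a. f (basis a) = g (basis a)"
  shows "f x = g x"
proof -
  have "h x = (\<Sum>a\<in>supp x. coef x a * h (basis a))" if "functional h" for h
    using arg_cong[OF free_expand[of x], of h] that by (simp add: functional_sum[OF that]) (simp add: functional_iff)
  from this[OF assms(1)] this[OF assms(2)] assms(3) show ?thesis by simp
qed

text \<open>Cancellation can shrink the support of a sum, so a sum over supports is not visibly
  additive; over a common finite superset it is.\<close>

lemma lin_ext_superset:
  "finite A \<Longrightarrow> supp x \<subseteq> A \<Longrightarrow> lin_ext f x = (\<Sum>a\<in>A. scl (coef x a) (f a))"
  unfolding lin_ext_def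
  by (rule sum.mono_neutral_left) (auto simp: in_keys_iff)

lemma lin_lin_ext: "lin (lin_ext f)"
  unfolding lin_iff
proof (intro conjI allI)
  fix x y :: "'a free" and c
  let ?A = "supp x \<union> supp y"
  have *: "finite ?A" "supp x \<subseteq> ?A" "supp y \<subseteq> ?A" "supp (x + y) \<subseteq> ?A"
    using keys_add[of x y] by auto
  show "lin_ext f (x + y) = lin_ext f x + lin_ext f y"
    by (simp add: lin_ext_superset[OF *(1) *(2)] lin_ext_superset[OF *(1) *(3)]
      lin_ext_superset[OF *(1) *(4)] lookup_add free.scale_left_distrib sum.distrib)
  have "supp (scl c x) \<subseteq> supp x" by (auto simp: in_keys_iff)
  then show "lin_ext f (scl c x) = scl c (lin_ext f x)"
    by (simp add: lin_ext_superset[of "supp x"] free.scale_sum_right)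
qed

lemma lin_ext_basis [simp]: "lin_ext f (basis a) = f a"
  by (simp add: lin_ext_def coef_basis)

lemma lin_lin_ext_param: "(\<And>a. lin (f a)) \<Longrightarrow> lin (\<lambda>y. lin_ext (\<lambda>a. f a y) x)"
  by (subst lin_iff, simp only: lin_ext_def lin_add lin_scl free.scale_right_distrib sum.distrib
    free.scale_sum_right free.scale_left_commute[of _ "coef x _"] simp_thms)

lemma lin_tensor_left: "lin (\<lambda>x. tensor x y)"
  unfolding tensor_def by (rule lin_lin_ext)

lemma lin_tensor_right: "lin (tensor x)"
  unfolding tensor_def by (rule lin_lin_ext_param) (rule lin_lin_ext)

lemma tensor_basis [simp]: "tensor (basis a) (basis b) = basis (a, b)"
  by (simp add: tensor_def)

lemma lin_eqI_pair:
  assumes "lin f" "lin g" "\<And>a b. f (basis (a, b)) = g (basis (a, b))"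
  shows "f x = g x"
  by (rule lin_eqI[OF assms(1,2)]) (use assms(3) in \<open>simp add: split_paired_all\<close>)

lemma lin_tensor_map: "lin (tensor_map f g)"
  unfolding tensor_map_def by (rule lin_lin_ext)

lemma tensor_map_basis [simp]: "tensor_map f g (basis (a, b)) = tensor (f (basis a)) (g (basis b))"
  by (simp add: tensor_map_def)

lemma bilin_eqI:
  assumes "\<And>y. lin (\<lambda>x. F x y)" "\<And>x. lin (F x)" "\<And>y. lin (\<lambda>x. G x y)" "\<And>x. lin (G x)"
    and "\<And>a b. F (basis a) (basis b) = G (basis a) (basis b)"
  shows "F x y = G x y"
proof -
  have "F (basis a) y = G (basis a) y" for a
    using lin_eqI[of "F (basis a)" "G (basis a)"] assms(2,4,5) by blast
  then show ?thesis
    using lin_eqI[of "\<lambda>x. F x y" "\<lambda>x. G x y"] assms(1,3) by blast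
qed

lemma tensor_map_tensor:
  assumes "lin f" "lin g"
  shows "tensor_map f g (tensor x y) = tensor (f x) (g y)"
proof (rule bilin_eqI[of "\<lambda>x y. tensor_map f g (tensor x y)" "\<lambda>x y. tensor (f x) (g y)"])
  show "lin (\<lambda>x. tensor_map f g (tensor x y))" for y
    by (rule lin_comp[OF lin_tensor_left lin_tensor_map])
  show "lin (\<lambda>y. tensor_map f g (tensor x y))" for x
    by (rule lin_comp[OF lin_tensor_right lin_tensor_map])
  show "lin (\<lambda>x. tensor (f x) (g y))" for y
    by (rule lin_comp[OF assms(1) lin_tensor_left])
  show "lin (\<lambda>y. tensor (f x) (g y))" for x
    by (rule lin_comp[OF assms(2) lin_tensor_right])
qed simp

lemma tensor_map_comp:
  assumes "lin f" "lin g"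
  shows "tensor_map f g (tensor_map f' g' z) = tensor_map (\<lambda>x. f (f' x)) (\<lambda>x. g (g' x)) z"
  by (rule lin_eqI_pair[OF lin_comp[OF lin_tensor_map lin_tensor_map] lin_tensor_map])
     (simp add: tensor_map_tensor assms)

lemma tensor_map_id [simp]: "tensor_map id id z = z"
  by (rule lin_eqI_pair[OF lin_tensor_map lin_id(2)]) simp

lemma lin_tensor_assoc: "lin tensor_assoc"
  unfolding tensor_assoc_def by (rule lin_lin_ext)

lemma tensor_assoc_basis [simp]: "tensor_assoc (basis ((a, b), c)) = basis (a, (b, c))"
  by (simp add: tensor_assoc_def)

lemma lin_tensor_swap: "lin tensor_swap"
  unfolding tensor_swap_def by (rule lin_lin_ext)

lemma tensor_swap_basis [simp]: "tensor_swap (basis ((a, b), (c, d))) = basis ((a, c), (b, d))"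
  by (simp add: tensor_swap_def)

lemma lin_contract_left: "lin (contract_left e)"
  unfolding contract_left_def by (rule lin_lin_ext)

lemma lin_contract_right: "lin (contract_right e)"
  unfolding contract_right_def by (rule lin_lin_ext)

lemma contract_left_basis [simp]: "contract_left e (basis (a, b)) = scl (e (basis a)) (basis b)"
  by (simp add: contract_left_def)

lemma contract_right_basis [simp]: "contract_right e (basis (a, b)) = scl (e (basis b)) (basis a)"
  by (simp add: contract_right_def)

lemma tensor_assoc_tensor: "tensor_assoc (tensor (tensor x y) z) = tensor x (tensor y z)"
proof -
  \<comment> \<open>The left factor is first taken arbitrary in the product space, where the other
    side has to be written by linear extension; the pure tensor \<open>tensor x y\<close> is put in
    afterwards.\<close>
  have 1: "tensor_assoc (tensor w z) = lin_ext (\<lambda>(a, b). tensor (basis a) (tensor (basis b) z)) w"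
    for w :: "('a \<times> 'b) free"
  proof (rule bilin_eqI[of "\<lambda>w z. tensor_assoc (tensor w z)"
      "\<lambda>w z. lin_ext (\<lambda>(a, b). tensor (basis a) (tensor (basis b) z)) w"])
    show "lin (\<lambda>w. tensor_assoc (tensor w z))" for z
      by (rule lin_comp[OF lin_tensor_left lin_tensor_assoc])
    show "lin (\<lambda>z. tensor_assoc (tensor w z))" for w
      by (rule lin_comp[OF lin_tensor_right lin_tensor_assoc])
    show "lin (\<lambda>z. lin_ext (\<lambda>(a, b). tensor (basis a) (tensor (basis b) z)) w)" for w
      unfolding split_beta
      by (rule lin_lin_ext_param) (rule lin_comp[OF lin_tensor_right lin_tensor_right])
  qed (simp_all add: lin_lin_ext split_paired_all)
  have "lin_ext (\<lambda>(a, b). tensor (basis a) (tensor (basis b) z)) (tensor x y) = tensor x (tensor y z)"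
  proof (rule bilin_eqI[of "\<lambda>x y. lin_ext (\<lambda>(a, b). tensor (basis a) (tensor (basis b) z)) (tensor x y)"
      "\<lambda>x y. tensor x (tensor y z)"])
    show "lin (\<lambda>x. lin_ext (\<lambda>(a, b). tensor (basis a) (tensor (basis b) z)) (tensor x y))" for y
      by (rule lin_comp[OF lin_tensor_left lin_lin_ext])
    show "lin (\<lambda>y. lin_ext (\<lambda>(a, b). tensor (basis a) (tensor (basis b) z)) (tensor x y))" for x
      by (rule lin_comp[OF lin_tensor_right lin_lin_ext])
    show "lin (\<lambda>y. tensor x (tensor y z))" for x
      by (rule lin_comp[OF lin_tensor_left lin_tensor_right])
  qed (simp_all add: lin_tensor_left)
  with 1 show ?thesis by simp
qed

lemma tensor_assoc_tensor_map:
  fixes f :: "'a free \<Rightarrow> 'b free" and g :: "'c free \<Rightarrow> 'd free"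
  shows "tensor_assoc (tensor_map (tensor_map f g) h z) = tensor_map f (tensor_map g h) (tensor_assoc z)"
proof (rule lin_eqI_pair[OF lin_comp[OF lin_tensor_map lin_tensor_assoc] lin_comp[OF lin_tensor_assoc lin_tensor_map]])
  fix ab :: "'a \<times> 'c" and c
  show "tensor_assoc (tensor_map (tensor_map f g) h (basis (ab, c))) =
    tensor_map f (tensor_map g h) (tensor_assoc (basis (ab, c)))"
    by (cases ab) (simp add: tensor_assoc_tensor)
qed


section \<open>Transposed linear maps\<close>

text \<open>Bilinear, without complex conjugation: the basis becomes its own dual basis, so this is
  the pairing of the theorem (\<open>pairing_eq\<close>).\<close>

definition dot :: "'a free \<Rightarrow> 'a free \<Rightarrow> complex" where
  "dot x y = (\<Sum>a\<in>supp x. coef x a * coef y a)"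

lemma dot_superset: "finite A \<Longrightarrow> supp x \<subseteq> A \<Longrightarrow> dot x y = (\<Sum>a\<in>A. coef x a * coef y a)"
  unfolding dot_def by (rule sum.mono_neutral_left) (auto simp: in_keys_iff)

lemma dot_commute: "dot x y = dot y x"
  by (simp add: dot_superset[of "supp x \<union> supp y"] mult.commute)

lemma functional_dot: "functional (dot x)"
  by (simp add: functional_iff dot_def lookup_add algebra_simps sum.distrib sum_distrib_left)

lemma functional_dot_left: "functional (\<lambda>x. dot x y)"
proof -
  have "(\<lambda>x. dot x y) = dot y" by (rule ext) (rule dot_commute)
  then show ?thesis using functional_dot[of y] by simp
qed

lemma dot_linear:
  "dot (x + y) z = dot x z + dot y z" "dot (scl c x) z = c * dot x z"
  "dot z (x + y) = dot z x + dot z y" "dot z (scl c x) = c * dot z x"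
  using functional_dot[of z] functional_dot_left[of z] by (simp_all add: functional_iff)

lemma dot_basis [simp]: "dot (basis a) y = coef y a" "dot y (basis a) = coef y a"
proof -
  show 1: "dot (basis a) y = coef y a" by (simp add: dot_def coef_basis)
  then show "dot y (basis a) = coef y a" by (simp add: dot_commute)
qed

lemma functional_coef: "lin f \<Longrightarrow> functional (\<lambda>x. coef (f x) b)"
  by (simp add: functional_iff lin_iff lookup_add)

lemma dot_tensor: "dot (tensor x y) (tensor x' y') = dot x x' * dot y y'"
proof -
  have coef: "coef (tensor x y) (a, b) = coef x a * coef y b" for x :: "'a free" and y :: "'b free" and a b
  proof -
    have 1: "coef (tensor (basis a') y) (a, b) = coef (basis a') a * coef y b" for a'
    proof -
      have "functional (\<lambda>y. coef (basis a') a * coef y b)"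
        by (simp add: functional_iff lookup_add algebra_simps)
      with functional_coef[OF lin_tensor_right] show ?thesis
        by (rule functional_eqI) (simp add: coef_basis)
    qed
    have "functional (\<lambda>x. coef x a * coef y b)"
      by (simp add: functional_iff lookup_add algebra_simps)
    with functional_coef[OF lin_tensor_left] show ?thesis
      by (rule functional_eqI) (simp add: 1)
  qed
  have "supp (tensor x y) \<subseteq> supp x \<times> supp y"
    by (auto simp: in_keys_iff coef)
  then have "dot (tensor x y) (tensor x' y') =
      (\<Sum>(a, b)\<in>supp x \<times> supp y. coef (tensor x y) (a, b) * coef (tensor x' y') (a, b))"
    by (subst dot_superset) (simp_all add: split_beta)
  then show ?thesis
    by (simp add: coef sum.cartesian_product[symmetric] dot_def sum_product mult_ac)
qed

lemma coef_tensor: "coef (tensor x y) (a, b) = coef x a * coef y b"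
  using dot_tensor[of x y "basis a" "basis b"] by simp

text \<open>A relation, not an operation: on finitely supported vectors a linear map may fail to
  have a transpose (see \<open>transpose_exists\<close>).\<close>

definition transposed :: "('a free \<Rightarrow> 'b free) \<Rightarrow> ('b free \<Rightarrow> 'a free) \<Rightarrow> bool" where
  "transposed f g \<longleftrightarrow> (\<forall>x y. dot (f x) y = dot x (g y))"

lemma transposedD: "transposed f g \<Longrightarrow> dot (f x) y = dot x (g y)"
  by (simp add: transposed_def)

lemma transposed_sym: "transposed f g \<Longrightarrow> transposed g f"
  by (metis dot_commute transposed_def)

lemma transposed_coef: "transposed f g \<Longrightarrow> coef (f x) b = dot x (g (basis b))"
  by (metis dot_basis(2) transposed_def)

text \<open>Every coefficient of \<open>f x\<close> is \<open>dot\<close> of x with a fixed vector,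
  so linearity is automatic.\<close>

lemma transposed_lin: "transposed f g \<Longrightarrow> lin f"
  by (auto simp: lin_iff transposed_coef lookup_add dot_linear intro!: poly_mapping_eqI)

lemma transposed_basisI:
  assumes "lin f" "lin g" "\<And>a b. coef (f (basis a)) b = coef (g (basis b)) a"
  shows "transposed f g"
  unfolding transposed_def
proof (intro allI)
  fix x y
  have fd: "functional (\<lambda>x. dot (f x) y)" "functional (\<lambda>y. dot x (g y))" for x y
    using assms(1,2) by (simp_all add: functional_iff lin_iff dot_linear)
  have 1: "dot (f (basis a)) y = dot (basis a) (g y)" for a
    by (rule functional_eqI[OF functional_dot fd(2)]) (simp add: assms(3))
  show "dot (f x) y = dot x (g y)"
    by (rule functional_eqI[OF fd(1) functional_dot_left]) (rule 1)
qed

text \<open>Nondegeneracy of \<open>dot\<close>. Most laws of a dual structure are obtained through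
  it, by showing that both of their sides have the same transpose.\<close>

lemma transposed_unique: "transposed f g \<Longrightarrow> transposed f' g \<Longrightarrow> f x = f' x"
  by (auto simp: transposed_coef intro!: poly_mapping_eqI)

lemma transposed_comp: "transposed f g \<Longrightarrow> transposed f' g' \<Longrightarrow> transposed (\<lambda>x. f' (f x)) (\<lambda>y. g (g' y))"
  by (simp add: transposed_def)

lemma transposed_id: "transposed id id"
  by (simp add: transposed_def)

lemma transposed_tensor_map:
  assumes "transposed f g" "transposed f' g'"
  shows "transposed (tensor_map f f') (tensor_map g g')"
proof (rule transposed_basisI)
  fix a :: "'a \<times> 'c" and b :: "'b \<times> 'd"
  show "coef (tensor_map f f' (basis a)) b = coef (tensor_map g g' (basis b)) a"
    by (cases a; cases b) (simp add: coef_tensor transposed_coef[OF assms(1)] transposed_coef[OF assms(2)])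
qed (rule lin_tensor_map)+

text \<open>The associator maps basis vectors bijectively to basis vectors, so its inverse is also
  its transpose.\<close>

definition tensor_unassoc :: "('a \<times> ('b \<times> 'c)) free \<Rightarrow> (('a \<times> 'b) \<times> 'c) free" where
  "tensor_unassoc = lin_ext (\<lambda>(a, (b, c)). basis ((a, b), c))"

lemma transposed_tensor_assoc: "transposed tensor_assoc tensor_unassoc"
  by (rule transposed_basisI)
     (auto simp: lin_lin_ext tensor_unassoc_def tensor_assoc_def coef_basis)

lemma tensor_unassoc_assoc: "tensor_unassoc (tensor_assoc z) = z"
proof (rule lin_eqI_pair[OF lin_comp[OF lin_tensor_assoc] lin_id(2)])
  show "lin tensor_unassoc"
    unfolding tensor_unassoc_def by (rule lin_lin_ext)
  fix ab :: "'a \<times> 'b" and c :: 'c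
  show "tensor_unassoc (tensor_assoc (basis (ab, c))) = basis (ab, c)"
    by (cases ab) (simp add: tensor_unassoc_def)
qed

text \<open>The interchange is a bijection of basis vectors whose inverse is again an interchange;
  this makes the bialgebra law self-dual.\<close>

lemma transposed_tensor_swap: "transposed tensor_swap tensor_swap"
  by (rule transposed_basisI) (auto simp: lin_lin_ext tensor_swap_def coef_basis)

text \<open>Contracting with \<open>dot u\<close> is exchanged with tensoring by u, which turns
  counit laws into unit laws.\<close>

lemma transposed_contract_left: "transposed (contract_left (dot u)) (tensor u)"
  by (rule transposed_basisI) (auto simp: lin_lin_ext lin_tensor_right contract_left_def coef_tensor coef_basis)

lemma transposed_contract_right: "transposed (contract_right (dot u)) (\<lambda>x. tensor x u)"
  by (rule transposed_basisI) (auto simp: lin_lin_ext lin_tensor_left contract_right_def coef_tensor coef_basis)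

text \<open>The transpose takes b to the b-th row of the matrix of f, which is a vector of the free
  space only if it has finitely many nonzero entries.\<close>

lemma transpose_exists:
  assumes "lin f" "\<And>b. finite {a. coef (f (basis a)) b \<noteq> 0}"
  obtains g where "transposed f g"
proof
  let ?g = "lin_ext (\<lambda>b. Abs_poly_mapping (\<lambda>a. coef (f (basis a)) b))"
  show "transposed f ?g"
    by (rule transposed_basisI) (simp_all add: assms lin_lin_ext)
qed

section \<open>Gradings\<close>

definition graded :: "('a \<Rightarrow> nat) \<Rightarrow> ('b \<Rightarrow> nat) \<Rightarrow> ('a free \<Rightarrow> 'b free) \<Rightarrow> bool" where
  "graded deg deg' f \<longleftrightarrow> lin f \<and> (\<forall>a. \<forall>b\<in>supp (f (basis a)). deg' b = deg a)"

lemma component_iff: "x \<in> component deg k \<longleftrightarrow> (\<forall>a\<in>supp x. deg a = k)"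
proof
  assume "x \<in> component deg k"
  then show "\<forall>a\<in>supp x. deg a = k"
    unfolding component_def
  proof (induction rule: free.span_induct_alt)
    case (step c y z)
    then show ?case
      using keys_add[of "scl c y" z] by (auto simp: in_keys_iff coef_basis split: if_splits)
  qed simp
next
  assume x: "\<forall>a\<in>supp x. deg a = k"
  have "(\<Sum>a\<in>supp x. scl (coef x a) (basis a)) \<in> component deg k"
    unfolding component_def
    by (intro free.span_sum free.span_scale free.span_base) (use x in auto)
  then show "x \<in> component deg k"
    using free_expand[of x] by simp
qed

lemma graded_component:
  assumes "graded deg deg' f"
  shows "f ` component deg k \<subseteq> component deg' k"
proof
  fix y assume "y \<in> f ` component deg k"
  then obtain x where x: "y = f x" "\<forall>a\<in>supp x. deg a = k" by (auto simp: component_iff)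
  have "coef y b = 0" if "deg' b \<noteq> k" for b
  proof -
    have "coef (f (basis a)) b = 0" if "a \<in> supp x" for a
      using assms x(2) that \<open>deg' b \<noteq> k\<close> unfolding graded_def by (metis in_keys_iff)
    then show ?thesis
      using assms lin_expand[of f x] by (simp add: x(1) graded_def lookup_sum)
  qed
  then show "y \<in> component deg' k" by (auto simp: component_iff in_keys_iff)
qed

lemma gradedI:
  "lin f \<Longrightarrow> (\<And>a. f (basis a) \<in> component deg' (deg a)) \<Longrightarrow> graded deg deg' f"
  by (auto simp: graded_def component_iff)

lemma graded_basis: "graded deg deg' f \<Longrightarrow> f (basis a) \<in> component deg' (deg a)"
  by (auto simp: graded_def component_iff)

lemma graded_lin: "graded deg deg' f \<Longrightarrow> lin f"
  by (simp add: graded_def)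

lemma graded_comp: "graded deg deg' f \<Longrightarrow> graded deg' deg'' g \<Longrightarrow> graded deg deg'' (\<lambda>x. g (f x))"
  by (rule gradedI) (auto intro: lin_comp graded_lin dest: graded_basis graded_component[of deg' deg'' g])

lemma graded_tensor_map:
  assumes "graded deg deg' f" "graded deg deg' g"
  shows "graded (tensor_deg deg) (tensor_deg deg') (tensor_map f g)"
proof (rule gradedI)
  fix ab :: "'a \<times> 'a"
  show "tensor_map f g (basis ab) \<in> component (tensor_deg deg') (tensor_deg deg ab)"
    using assms by (cases ab) (auto simp: component_iff graded_def in_keys_iff coef_tensor)
qed (rule lin_tensor_map)

text \<open>Being graded says that matrix entries between different degrees vanish, a condition
  symmetric in rows and columns.\<close>

lemma graded_transposed: "transposed f g \<Longrightarrow> graded deg deg' f \<Longrightarrow> graded deg' deg g"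
  unfolding graded_def
  by (metis dot_basis(1) in_keys_iff transposed_coef transposed_lin transposed_sym)


section \<open>Dual structures\<close>

lemma algebra_transposed:
  assumes C: "coalgebra_axms C (dot (basis e))" and t: "transposed m C"
  shows "algebra_axms m (basis e)"
proof -
  interpret C: coalgebra_axms C "dot (basis e)" by (fact C)
  show ?thesis
  proof (rule algebra_axms.intro)
    show "lin m" by (rule transposed_lin[OF t])
    have 1: "transposed (\<lambda>z. m (tensor_map m id z)) (\<lambda>x. tensor_map C id (C x))"
      by (rule transposed_comp[OF transposed_tensor_map[OF t transposed_id] t])
    have "transposed (\<lambda>z. m (tensor_map id m (tensor_assoc z)))
        (\<lambda>x. tensor_unassoc (tensor_map id C (C x)))"
      by (rule transposed_comp[OF transposed_comp[OF transposed_tensor_assoc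
        transposed_tensor_map[OF transposed_id t]] t])
    \<comment> \<open>Coassociativity of C carries an associator, which
      \<open>tensor_unassoc\<close> cancels; both threefold products then have the same
      transpose.\<close>
    then have 2: "transposed (\<lambda>z. m (tensor_map id m (tensor_assoc z))) (\<lambda>x. tensor_map C id (C x))"
      by (simp add: C.comult_coassoc[symmetric] tensor_unassoc_assoc)
    show "m (tensor_map m id z) = m (tensor_map id m (tensor_assoc z))" for z
      by (rule transposed_unique[OF 1 2])
    have "transposed (\<lambda>x. m (tensor (basis e) x)) (\<lambda>x. contract_left (dot (basis e)) (C x))"
      by (rule transposed_comp[OF transposed_sym[OF transposed_contract_left] t])
    then have "transposed (\<lambda>x. m (tensor (basis e) x)) id"
      by (simp add: C.counit_left id_def)
    from transposed_unique[OF this transposed_id] show "m (tensor (basis e) x) = x" for x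
      by simp
    have "transposed (\<lambda>x. m (tensor x (basis e))) (\<lambda>x. contract_right (dot (basis e)) (C x))"
      by (rule transposed_comp[OF transposed_sym[OF transposed_contract_right] t])
    then have "transposed (\<lambda>x. m (tensor x (basis e))) id"
      by (simp add: C.counit_right id_def)
    from transposed_unique[OF this transposed_id] show "m (tensor x (basis e)) = x" for x
      by simp
  qed
qed

text \<open>The compatibility law transposes into itself with product and coproduct exchanged. The
  unit and counit conditions trade places: multiplicativity of one counit says that the other
  coproduct sends the unit to its tensor square, and conversely.\<close>

lemma bialgebra_transposed:
  assumes B: "bialgebra m (basis e) c (dot (basis e))" and C: "coalgebra_axms C (dot (basis e))"
    and mC: "transposed m C" and Mc: "transposed M c"
  shows "bialgebra M (basis e) C (dot (basis e))"
proof -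
  interpret B: bialgebra m "basis e" c "dot (basis e)" by (fact B)
  interpret C: coalgebra_axms C "dot (basis e)" by (fact C)
  interpret A: algebra_axms M "basis e"
    by (rule algebra_transposed[OF B.coalgebra_axms_axioms Mc])
  show ?thesis
  proof unfold_locales
    have "transposed (\<lambda>z. C (M z)) (\<lambda>x. c (m x))"
      by (rule transposed_comp[OF Mc transposed_sym[OF mC]])
    moreover have "transposed (\<lambda>z. tensor_map M M (tensor_swap (tensor_map C C z)))
        (\<lambda>x. tensor_map m m (tensor_swap (tensor_map c c x)))"
      by (intro transposed_comp[OF transposed_comp[OF transposed_tensor_map transposed_tensor_swap]
        transposed_tensor_map] transposed_sym[OF mC] Mc)
    ultimately show "C (M z) = tensor_map M M (tensor_swap (tensor_map C C z))" for z
      unfolding B.comult_mult by (rule transposed_unique)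
    show "C (basis e) = tensor (basis e) (basis e)"
    proof (rule poly_mapping_eqI)
      fix ab :: "'a \<times> 'a"
      obtain a b where ab: "ab = (a, b)" by (cases ab)
      have "coef (C (basis e)) ab = dot (basis e) (m (tensor (basis a) (basis b)))"
        using transposedD[OF transposed_sym[OF mC], of "basis e" "basis ab"] by (simp add: ab)
      also have "\<dots> = dot (basis e) (basis a) * dot (basis e) (basis b)" by (rule B.counit_mult)
      finally show "coef (C (basis e)) ab = coef (tensor (basis e) (basis e)) ab"
        by (auto simp: ab coef_basis)
    qed
    show "dot (basis e) (M (tensor x y)) = dot (basis e) x * dot (basis e) y" for x y
      using transposedD[OF transposed_sym[OF Mc], of "basis e" "tensor x y"]
      by (simp only: B.comult_unit dot_tensor)
    show "dot (basis e) (basis e) = 1" by (simp add: coef_basis)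
  qed
qed

lemma hopf_algebra_transposed:
  assumes H: "hopf_algebra m (basis e) c (dot (basis e)) S" and C: "coalgebra_axms C (dot (basis e))"
    and mC: "transposed m C" and Mc: "transposed M c" and S: "transposed S S'"
  shows "hopf_algebra M (basis e) C (dot (basis e)) S'"
proof -
  interpret H: hopf_algebra m "basis e" c "dot (basis e)" S by (fact H)
  interpret B: bialgebra M "basis e" C "dot (basis e)"
    by (rule bialgebra_transposed[OF H.bialgebra_axioms C mC Mc])
  \<comment> \<open>Counit followed by unit is its own transpose, as both come from
    \<open>basis e\<close>; hence each antipode law transposes into the same law for the
    dual.\<close>
  have u: "transposed (\<lambda>x. scl (dot (basis e) x) (basis e)) (\<lambda>x. scl (dot (basis e) x) (basis e))"
    by (simp add: transposed_def dot_linear)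
  show ?thesis
  proof (intro hopf_algebra.intro hopf_algebra_axioms.intro)
    show "bialgebra M (basis e) C (dot (basis e))" by (fact B.bialgebra_axioms)
    show "lin S'" by (rule transposed_lin[OF transposed_sym[OF S]])
    have "transposed (\<lambda>x. M (tensor_map S' id (C x))) (\<lambda>x. m (tensor_map S id (c x)))"
      by (intro transposed_comp[OF transposed_comp[OF _ transposed_tensor_map]]
        transposed_sym[OF mC] Mc transposed_sym[OF S] transposed_id)
    with u show "M (tensor_map S' id (C x)) = scl (dot (basis e) x) (basis e)" for x
      unfolding H.antipode_left by (rule transposed_unique[rotated])
    have "transposed (\<lambda>x. M (tensor_map id S' (C x))) (\<lambda>x. m (tensor_map id S (c x)))"
      by (intro transposed_comp[OF transposed_comp[OF _ transposed_tensor_map]]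
        transposed_sym[OF mC] Mc transposed_sym[OF S] transposed_id)
    with u show "M (tensor_map id S' (C x)) = scl (dot (basis e) x) (basis e)" for x
      unfolding H.antipode_right by (rule transposed_unique[rotated])
  qed
qed


section \<open>The antipode of a connected graded bialgebra\<close>

lemma tensor_map_add_left: "tensor_map (\<lambda>x. f x + g x) h z = tensor_map f h z + tensor_map g h z"
  by (simp add: tensor_map_def lin_ext_def split_beta lin_add[OF lin_tensor_left]
    free.scale_right_distrib sum.distrib)

lemma tensor_map_add_right: "tensor_map h (\<lambda>x. f x + g x) z = tensor_map h f z + tensor_map h g z"
  by (simp add: tensor_map_def lin_ext_def split_beta lin_add[OF lin_tensor_right]
    free.scale_right_distrib sum.distrib)

lemma tensor_map_diff_left: "tensor_map (\<lambda>x. f x - g x) h z = tensor_map f h z - tensor_map g h z"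
  by (simp add: tensor_map_def lin_ext_def split_beta lin_minus[OF lin_tensor_left]
    free.scale_right_diff_distrib sum_subtractf)

lemma tensor_map_diff_right: "tensor_map h (\<lambda>x. f x - g x) z = tensor_map h f z - tensor_map h g z"
  by (simp add: tensor_map_def lin_ext_def split_beta lin_minus[OF lin_tensor_right]
    free.scale_right_diff_distrib sum_subtractf)

lemma tensor_map_cong:
  assumes "\<And>a b. (a, b) \<in> supp z \<Longrightarrow>
    tensor (f (basis a)) (g (basis b)) = tensor (f' (basis a)) (g' (basis b))"
  shows "tensor_map f g z = tensor_map f' g' z"
  unfolding tensor_map_def lin_ext_def by (rule sum.cong) (use assms in auto)

section \<open>Convolution of linear endomorphisms\<close>

context bialgebra
begin

definition conv :: "('a free \<Rightarrow> 'a free) \<Rightarrow> ('a free \<Rightarrow> 'a free) \<Rightarrow> 'a free \<Rightarrow> 'a free" where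
  "conv f g x = mult (tensor_map f g (comult x))"

definition eta_eps :: "'a free \<Rightarrow> 'a free" where
  "eta_eps x = scl (counit x) unit"

definition nil_part :: "'a free \<Rightarrow> 'a free" where
  "nil_part x = eta_eps x - x"

text \<open>The partial sums of the geometric series for the convolution inverse of the identity
  \<open>eta_eps - nil_part\<close>.\<close>

primrec geom :: "nat \<Rightarrow> 'a free \<Rightarrow> 'a free" where
  "geom 0 = (\<lambda>x. 0)"
| "geom (Suc k) = (\<lambda>x. eta_eps x + conv nil_part (geom k) x)"

lemma lin_conv: "lin (conv f g)"
  unfolding conv_def by (rule lin_comp[OF lin_comp[OF comult_linear lin_tensor_map] mult_linear])

lemma lin_eta_eps: "lin eta_eps"
  using counit_linear by (simp add: lin_iff functional_iff eta_eps_def free.scale_left_distrib)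

lemma lin_nil_part: "lin nil_part"
  using lin_eta_eps by (simp add: lin_iff nil_part_def free.scale_right_diff_distrib)

lemma lin_geom: "lin (geom k)"
proof (cases k)
  case (Suc j)
  then show ?thesis
    using lin_eta_eps lin_conv[of nil_part "geom j"] by (simp add: lin_iff free.scale_right_distrib)
qed (simp add: lin_iff)

text \<open>Once f, g and h are moved between the twofold coproduct and the twofold product, only
  coassociativity and associativity remain.\<close>

lemma conv_assoc:
  assumes "lin f" "lin g" "lin h"
  shows "conv f (conv g h) x = conv (conv f g) h x"
proof -
  have "conv f (conv g h) x =
      mult (tensor_map id mult (tensor_map f (tensor_map g h) (tensor_map id comult (comult x))))"
    by (simp add: conv_def[abs_def] tensor_map_comp lin_id mult_linear assms lin_tensor_map)
  also have "\<dots> = mult (tensor_map id mult (tensor_assoc (tensor_map (tensor_map f g) h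
      (tensor_map comult id (comult x)))))"
    by (simp only: comult_coassoc[symmetric] tensor_assoc_tensor_map)
  also have "\<dots> = mult (tensor_map mult id (tensor_map (tensor_map f g) h
      (tensor_map comult id (comult x))))"
    by (simp only: mult_assoc)
  also have "\<dots> = conv (conv f g) h x"
    by (simp add: conv_def[abs_def] tensor_map_comp lin_id mult_linear assms lin_tensor_map)
  finally show ?thesis .
qed

lemma conv_eta_eps_left:
  assumes "lin f"
  shows "conv eta_eps f x = f x"
proof -
  have "tensor_map eta_eps f z = tensor unit (f (contract_left counit z))" for z
    by (rule lin_eqI_pair[OF lin_tensor_map lin_comp[OF lin_comp[OF lin_contract_left assms] lin_tensor_right]])
       (simp add: eta_eps_def lin_scl[OF lin_tensor_left] lin_scl[OF assms] lin_scl[OF lin_tensor_right])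
  then show ?thesis by (simp add: conv_def counit_left unit_left)
qed

lemma conv_eta_eps_right:
  assumes "lin f"
  shows "conv f eta_eps x = f x"
proof -
  have "tensor_map f eta_eps z = tensor (f (contract_right counit z)) unit" for z
    by (rule lin_eqI_pair[OF lin_tensor_map lin_comp[OF lin_comp[OF lin_contract_right assms] lin_tensor_left]])
       (simp add: eta_eps_def lin_scl[OF lin_tensor_left] lin_scl[OF assms] lin_scl[OF lin_tensor_right])
  then show ?thesis by (simp add: conv_def counit_right unit_right)
qed

lemma conv_add:
  "conv (\<lambda>x. f x + g x) h x = conv f h x + conv g h x"
  "conv h (\<lambda>x. f x + g x) x = conv h f x + conv h g x"
  by (simp_all add: conv_def tensor_map_add_left tensor_map_add_right lin_add[OF mult_linear])

lemma conv_diff: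
  "conv (\<lambda>x. f x - g x) h x = conv f h x - conv g h x"
  "conv h (\<lambda>x. f x - g x) x = conv h f x - conv h g x"
  by (simp_all add: conv_def tensor_map_diff_left tensor_map_diff_right lin_minus[OF mult_linear])

text \<open>Restricts attention to the pairs occurring in the coproduct, which is how bounds on
  degrees enter.\<close>

lemma conv_cong:
  assumes "\<And>a b. (a, b) \<in> supp (comult x) \<Longrightarrow>
    tensor (f (basis a)) (g (basis b)) = tensor (f' (basis a)) (g' (basis b))"
  shows "conv f g x = conv f' g' x"
  unfolding conv_def using tensor_map_cong[of "comult x" f g f' g'] assms by simp

lemma conv_0: "conv (\<lambda>x. 0) f x = 0" "conv f (\<lambda>x. 0) x = 0"
  using conv_diff(1)[of "\<lambda>x. 0" "\<lambda>x. 0" f x] conv_diff(2)[of f "\<lambda>x. 0" "\<lambda>x. 0" x] by simp_all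

text \<open>The recursion puts \<open>nil_part\<close> on the left; having it on the right as well
  makes the limit an inverse from both sides.\<close>

lemma geom_Suc: "geom (Suc k) x = eta_eps x + conv (geom k) nil_part x"
proof (induction k arbitrary: x)
  case 0
  show ?case by (simp add: conv_0)
next
  case (Suc k)
  have IH: "geom (Suc k) = (\<lambda>x. eta_eps x + conv (geom k) nil_part x)"
    using Suc by blast
  have "geom (Suc (Suc k)) x = eta_eps x + conv nil_part (geom (Suc k)) x"
    by simp
  also have "\<dots> = eta_eps x + (nil_part x + conv (conv nil_part (geom k)) nil_part x)"
    by (simp only: IH conv_add conv_eta_eps_right[OF lin_nil_part]
      conv_assoc[OF lin_nil_part lin_geom lin_nil_part])
  also have "\<dots> = eta_eps x + conv (geom (Suc k)) nil_part x"
    by (simp add: conv_add conv_eta_eps_left[OF lin_nil_part])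
  finally show ?case .
qed

end

text \<open>\<open>nil_part\<close> kills the only basis vector of degree 0, so convolving with it
  passes a strictly smaller degree to the other factor. On a fixed basis vector the geometric series
  is therefore eventually constant, and its limit is the convolution inverse of the
  identity.\<close>

lemma (in bialgebra) antipode_exists:
  assumes unit: "unit = basis e" and conn: "\<And>a. deg a = 0 \<longleftrightarrow> a = e"
    and gm: "graded (tensor_deg deg) deg mult" and gc: "graded deg (tensor_deg deg) comult"
    and counit: "\<And>a. counit (basis a) = (if a = e then 1 else 0)"
  obtains S where "hopf_algebra mult unit comult counit S" "graded deg deg S"
proof
  have N: "nil_part (basis e) = 0"
    unfolding nil_part_def eta_eps_def by (simp add: counit unit)
  have sum: "deg p + deg q = deg a" if "(p, q) \<in> supp (comult (basis a))" for a p q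
    using gc that by (auto simp: graded_def)
  \<comment> \<open>On \<open>basis a\<close> the series has settled at index deg a + 1: one
    recursion step involves only vectors q of degree below deg a, where a smaller index is enough by
    induction.\<close>
  have stable: "geom k (basis a) = geom (Suc (deg a)) (basis a)" if "deg a < k" for k a
    using that
  proof (induction "deg a" arbitrary: a k rule: less_induct)
    case less
    then obtain j where j: "k = Suc j" "deg a \<le> j" by (cases k) auto
    have "conv nil_part (geom j) (basis a) = conv nil_part (geom (deg a)) (basis a)"
    proof (rule conv_cong)
      fix p q assume pq: "(p, q) \<in> supp (comult (basis a))"
      show "tensor (nil_part (basis p)) (geom j (basis q)) =
        tensor (nil_part (basis p)) (geom (deg a) (basis q))"
      proof (cases "p = e")
        case True
        then show ?thesis by (simp add: N lin_0[OF lin_tensor_left])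
      next
        case False
        then have "deg q < deg a" using sum[OF pq] conn[of p] by simp
        then show ?thesis using less.hyps[of q j] less.hyps[of q "deg a"] j by simp
      qed
    qed
    then show ?case by (simp add: j)
  qed
  define S where "S = lin_ext (\<lambda>a. geom (Suc (deg a)) (basis a))"
  have S: "S (basis a) = geom k (basis a)" if "deg a < k" for a k
    using stable[OF that] by (simp add: S_def)
  \<comment> \<open>Both factors occurring in the coproduct have degree at most deg a, so one
    partial sum computes S on all of them.\<close>
  have S_le: "S (basis p) = geom (Suc (deg a)) (basis p)" "S (basis q) = geom (Suc (deg a)) (basis q)"
    if "(p, q) \<in> supp (comult (basis a))" for a p q
    using S[of p "Suc (deg a)"] S[of q "Suc (deg a)"] sum[OF that] by (simp_all del: geom.simps)
  have lS: "lin S" by (simp add: S_def lin_lin_ext)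
  have lid: "lin id" by (rule lin_id)
  have left: "S x = eta_eps x + conv S nil_part x" for x
  proof (rule lin_eqI[OF lS])
    show "lin (\<lambda>x. eta_eps x + conv S nil_part x)"
      using lin_eta_eps lin_conv[of S nil_part] by (simp add: lin_iff free.scale_right_distrib)
    fix a
    have "conv S nil_part (basis a) = conv (geom (Suc (deg a))) nil_part (basis a)"
      by (rule conv_cong) (simp only: S_le)
    then show "S (basis a) = eta_eps (basis a) + conv S nil_part (basis a)"
      \<comment> \<open>One index more, so that unfolding the recursion once leaves the index deg a
        + 1 of the partial sum above.\<close>
      using S[of a "Suc (Suc (deg a))"] geom_Suc[of "Suc (deg a)" "basis a"] by simp
  qed
  have right: "S x = eta_eps x + conv nil_part S x" for x
  proof (rule lin_eqI[OF lS])
    show "lin (\<lambda>x. eta_eps x + conv nil_part S x)"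
      using lin_eta_eps lin_conv[of nil_part S] by (simp add: lin_iff free.scale_right_distrib)
    fix a
    have "conv nil_part S (basis a) = conv nil_part (geom (Suc (deg a))) (basis a)"
      by (rule conv_cong) (simp only: S_le)
    then show "S (basis a) = eta_eps (basis a) + conv nil_part S (basis a)"
      using S[of a "Suc (Suc (deg a))"] by simp
  qed
  \<comment> \<open>With the identity in this form, \<open>left\<close> and \<open>right\<close>
    become the two antipode laws.\<close>
  have id: "id = (\<lambda>x. eta_eps x - nil_part x)" by (auto simp: nil_part_def)
  have "conv S id x = eta_eps x" "conv id S x = eta_eps x" for x
    using left[of x] right[of x]
    by (simp_all add: id conv_diff conv_eta_eps_left[OF lS] conv_eta_eps_right[OF lS])
  then show "hopf_algebra mult unit comult counit S"
    by (intro hopf_algebra.intro hopf_algebra_axioms.intro bialgebra_axioms lS)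
      (simp_all add: conv_def eta_eps_def)
  have g_eta: "graded deg deg eta_eps"
    by (rule gradedI[OF lin_eta_eps], unfold eta_eps_def) (use conn in \<open>simp add: counit unit component_iff\<close>)
  have g_N: "graded deg deg nil_part"
  proof (rule gradedI[OF lin_nil_part])
    fix a
    show "nil_part (basis a) \<in> component deg (deg a)"
      unfolding nil_part_def component_def
      by (rule free.span_diff)
        (use graded_basis[OF g_eta, of a] in \<open>auto simp: component_def intro: free.span_base\<close>)
  qed
  have g_geom: "graded deg deg (geom k)" for k
  proof (induction k)
    case (Suc k)
    have "graded deg deg (conv nil_part (geom k))"
      unfolding conv_def by (rule graded_comp[OF graded_comp[OF gc graded_tensor_map[OF g_N Suc]] gm])
    from graded_basis[OF this] graded_basis[OF g_eta] show ?case
      by (intro gradedI[OF lin_geom]) (simp add: component_def free.span_add)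
  qed (simp add: graded_def lin_iff)
  show "graded deg deg S"
    by (rule gradedI[OF lS]) (simp only: S_def lin_ext_basis graded_basis[OF g_geom])
qed


section \<open>The graded dual of a connected graded bialgebra\<close>

lemma tensor_pairing_dot: "tensor_pairing dot z w = dot z w"
proof -
  have "(\<Sum>(a, a')\<in>supp w. coef z (b, b') * coef w (a, a') *
      (dot (basis b) (basis a) * dot (basis b') (basis a'))) = coef z (b, b') * coef w (b, b')" for b b'
  proof -
    have "(\<Sum>(a, a')\<in>supp w. coef z (b, b') * coef w (a, a') *
        (dot (basis b) (basis a) * dot (basis b') (basis a'))) =
        (\<Sum>a\<in>supp w. if (b, b') = a then coef z (b, b') * coef w (b, b') else 0)"
      by (rule sum.cong) (auto simp: coef_basis split: if_splits)
    then show ?thesis by (simp add: in_keys_iff)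
  qed
  then show ?thesis by (simp add: tensor_pairing_def dot_def split_beta)
qed

text \<open>A functional that vanishes on almost all components is nonzero on finitely many basis
  vectors only, since each degree has finitely many; its values there are the coefficients of the
  vector representing it.\<close>

lemma bij_betw_dot_graded_dual:
  fixes deg :: "'a \<Rightarrow> nat"
  assumes "\<And>k. finite {a. deg a = k}"
  shows "bij_betw dot UNIV (graded_dual deg)"
  unfolding bij_betw_def
proof
  show "inj dot"
    by (rule injI) (metis dot_basis(2) poly_mapping_eqI)
  show "range dot = graded_dual deg"
  proof (intro equalityI subsetI)
    fix f :: "'a free \<Rightarrow> complex" assume "f \<in> range dot"
    then obtain x where f: "f = dot x" by blast
    have "{k. \<exists>y\<in>component deg k. dot x y \<noteq> 0} \<subseteq> deg ` supp x"
    proof clarify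
      fix k y assume y: "y \<in> component deg k" "dot x y \<noteq> 0"
      then obtain a where "a \<in> supp x" "coef x a * coef y a \<noteq> 0"
        unfolding dot_def by (meson sum.not_neutral_contains_not_neutral)
      then have "a \<in> supp x" "a \<in> supp y" by (auto simp: in_keys_iff)
      then show "k \<in> deg ` supp x" using y(1) by (auto simp: component_iff)
    qed
    then have "finite {k. \<exists>y\<in>component deg k. dot x y \<noteq> 0}"
      by (rule finite_subset) simp
    then show "f \<in> graded_dual deg"
      by (simp add: graded_dual_def f functional_dot)
  next
    fix f :: "'a free \<Rightarrow> complex" assume f: "f \<in> graded_dual deg"
    then have lf: "functional f" and fin: "finite {k. \<exists>x\<in>component deg k. f x \<noteq> 0}"
      by (auto simp: graded_dual_def)
    have "{a. f (basis a) \<noteq> 0} \<subseteq> (\<Union>k\<in>{k. \<exists>x\<in>component deg k. f x \<noteq> 0}. {a. deg a = k})"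
      by (auto simp: component_iff intro!: bexI[of _ "basis _"])
    then have "finite {a. f (basis a) \<noteq> 0}"
      by (rule finite_subset) (use fin assms in blast)
    then have "dot (Abs_poly_mapping (\<lambda>a. f (basis a))) (basis a) = f (basis a)" for a
      by simp
    then have "dot (Abs_poly_mapping (\<lambda>a. f (basis a))) x = f x" for x
      by (rule functional_eqI[OF functional_dot lf])
    then have "f = dot (Abs_poly_mapping (\<lambda>a. f (basis a)))"
      by (intro ext) simp
    then show "f \<in> range dot" by blast
  qed
qed

lemma dot_component:
  assumes fin: "\<And>k. finite {a. deg a = k}"
  shows "dot ` component deg k = dual_component deg k"
proof (intro equalityI subsetI)
  fix f assume "f \<in> dot ` component deg k"
  then obtain x where f: "f = dot x" and x: "\<forall>a\<in>supp x. deg a = k"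
    by (auto simp: component_iff)
  have "dot x y = 0" if "j \<noteq> k" "y \<in> component deg j" for j y
    unfolding dot_def by (rule sum.neutral) (use x that in \<open>auto simp: component_iff in_keys_iff\<close>)
  then show "f \<in> dual_component deg k"
    by (auto simp: dual_component_def f functional_dot)
next
  fix f assume f: "f \<in> dual_component deg k"
  then have "{j. \<exists>x\<in>component deg j. f x \<noteq> 0} \<subseteq> {k}"
    by (auto simp: dual_component_def)
  then have "f \<in> graded_dual deg"
    using f finite_subset by (fastforce simp: dual_component_def graded_dual_def)
  then obtain x where x: "f = dot x"
    using bij_betw_dot_graded_dual[OF fin] by (auto simp: bij_betw_def)
  have "deg a = k" if "a \<in> supp x" for a
  proof (rule ccontr)
    assume "deg a \<noteq> k"
    moreover have "basis a \<in> component deg (deg a)" by (simp add: component_iff)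
    ultimately have "f (basis a) = 0" using f unfolding dual_component_def by blast
    then show False using that by (simp add: x in_keys_iff)
  qed
  then show "f \<in> dot ` component deg k" by (auto simp: x component_iff)
qed

text \<open>Reduces the theorem to one bialgebra m, c and a coalgebra C transposed to m: the laws of
  M follow by transposition, and the antipode is constructed once and transposed.\<close>

lemma graded_dual_exists:
  assumes B: "bialgebra m (basis e) c (dot (basis e))" and C: "coalgebra_axms C (dot (basis e))"
    and mC: "transposed m C" and Mc: "transposed M c"
    and fin: "\<And>k. finite {a. deg a = k}" and conn: "\<And>a. deg a = 0 \<longleftrightarrow> a = e"
    and gc: "graded deg (tensor_deg deg) c" and gC: "graded deg (tensor_deg deg) C"
  shows "\<exists>counit S unit' counit' S'. graded_dual_hopf_algebra
      deg m (basis e) c counit S deg M unit' C counit' S' dot"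
proof -
  have gm: "graded (tensor_deg deg) deg m" and gM: "graded (tensor_deg deg) deg M"
    using graded_transposed[OF transposed_sym[OF mC] gC] graded_transposed[OF transposed_sym[OF Mc] gc]
    by auto
  obtain S where S: "hopf_algebra m (basis e) c (dot (basis e)) S" and gS: "graded deg deg S"
    by (rule bialgebra.antipode_exists[OF B refl conn gm gc]) (auto simp: coef_basis)
  \<comment> \<open>A nonzero entry in row b forces deg a = deg b, which leaves finitely many
    a.\<close>
  have "finite {a. coef (S (basis a)) b \<noteq> 0}" for b
    by (rule finite_subset[OF _ fin[of "deg b"]]) (use gS in \<open>auto simp: graded_def in_keys_iff\<close>)
  then obtain S' where S': "transposed S S'"
    using transpose_exists[OF graded_lin[OF gS]] by blast
  have H': "hopf_algebra M (basis e) C (dot (basis e)) S'"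
    by (rule hopf_algebra_transposed[OF S C mC Mc S'])
  have gS': "graded deg deg S'" by (rule graded_transposed[OF S' gS])
  have fd: "\<exists>B. finite B \<and> component deg k = free.span B" for k
  proof (intro exI conjI)
    show "component deg k = free.span (basis ` {a. deg a = k})"
      unfolding component_def by (rule arg_cong[where f = free.span]) auto
  qed (simp add: fin)
  have counit: "dot (basis e) ` component deg k \<subseteq> {0}" if "k \<noteq> 0" for k
    using that conn by (force simp: component_iff in_keys_iff)
  have unit: "basis e \<in> component deg 0" using conn[of e] by (simp add: component_iff)
  have G: "graded_hopf_algebra deg m (basis e) c (dot (basis e)) S"
    by (intro graded_hopf_algebra.intro graded_hopf_algebra_axioms.intro S fd counit unit
      graded_component[OF gm] graded_component[OF gc] graded_component[OF gS])
  have G': "graded_hopf_algebra deg M (basis e) C (dot (basis e)) S'"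
    by (intro graded_hopf_algebra.intro graded_hopf_algebra_axioms.intro H' fd counit unit
      graded_component[OF gM] graded_component[OF gC] graded_component[OF gS'])
  have "graded_dual_hopf_algebra deg m (basis e) c (dot (basis e)) S
      deg M (basis e) C (dot (basis e)) S' dot"
  proof (intro graded_dual_hopf_algebra.intro graded_dual_hopf_algebra_axioms.intro G G'
      functional_dot functional_dot_left bij_betw_dot_graded_dual dot_component fin)
    show "dot (M z) x = tensor_pairing dot z (c x)" for z x
      by (simp add: tensor_pairing_dot transposedD[OF Mc])
    show "tensor_pairing dot (C f) w = dot f (m w)" for f w
      by (simp add: tensor_pairing_dot transposedD[OF transposed_sym[OF mC]])
    show "dot (S' f) x = dot f (S x)" for f x
      by (rule transposedD[OF transposed_sym[OF S']])
  qed (simp_all add: dot_commute)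
  then show ?thesis by blast
qed

section \<open>Ranks\<close>

lemma bij_betw_rank_in: "finite I \<Longrightarrow> bij_betw (rank_in I) I {1..card I}"
proof -
  assume fin: "finite I"
  have "rank_in I ` I \<subseteq> {1..card I}"
    using fin by (auto simp: rank_in_def card_gt_0_iff Suc_le_eq intro!: card_mono)
  moreover have "card (rank_in I ` I) = card I"
    by (rule card_image[OF inj_on_rank_in[OF fin]])
  ultimately have "rank_in I ` I = {1..card I}"
    by (intro card_subset_eq) auto
  then show ?thesis
    using inj_on_rank_in[OF fin] by (simp add: bij_betw_def)
qed

lemma rank_in_image: "finite I \<Longrightarrow> rank_in I ` I = {1..card I}"
  using bij_betw_rank_in by (auto simp: bij_betw_def)

lemma rank_in_less_iff:
  "finite I \<Longrightarrow> i \<in> I \<Longrightarrow> j \<in> I \<Longrightarrow> rank_in I i < rank_in I j \<longleftrightarrow> i < j"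
  by (metis linorder_neqE_nat not_less_iff_gr_or_eq rank_in_less)

text \<open>An increasing f onto an initial interval maps the elements of I up to i onto
  \<open>{1..f i}\<close>. It lets a rank be computed by exhibiting such an f.\<close>

lemma rank_in_eqI:
  assumes "finite I" "\<And>i j. i \<in> I \<Longrightarrow> j \<in> I \<Longrightarrow> i < j \<Longrightarrow> f i < f j" "f ` I = {1..m}" "i \<in> I"
  shows "rank_in I i = f i"
proof -
  have le: "h \<le> i \<longleftrightarrow> f h \<le> f i" if "h \<in> I" for h
    using assms(2)[OF that assms(4)] assms(2)[OF assms(4) that]
    by (metis le_less linorder_not_less)
  have "f ` {h \<in> I. h \<le> i} = {1..f i}"
  proof
    show "f ` {h \<in> I. h \<le> i} \<subseteq> {1..f i}" using le assms(3) by auto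
    show "{1..f i} \<subseteq> f ` {h \<in> I. h \<le> i}"
    proof
      fix x assume x: "x \<in> {1..f i}"
      have "f i \<in> {1..m}" using assms(3,4) by blast
      with x have "x \<in> f ` I" by (simp add: assms(3))
      then show "x \<in> f ` {h \<in> I. h \<le> i}" using le x by auto
    qed
  qed
  moreover have "inj_on f {h \<in> I. h \<le> i}"
    by (rule linorder_inj_onI') (use assms(2) in fastforce)
  ultimately have "card {h \<in> I. h \<le> i} = card {1..f i}"
    using card_image by metis
  then show ?thesis by (simp add: rank_in_def)
qed

lemma rank_in_interval: "i \<in> {a + 1..a + b} \<Longrightarrow> rank_in {a + 1..a + b} i = i - a"
proof (rule rank_in_eqI[where m = b])
  show "(\<lambda>i. i - a) ` {a + 1..a + b} = {1..b}"
    by (auto simp: image_iff intro!: bexI[of _ "_ + a"])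
qed auto

lemma rank_in_initial: "i \<in> {1..n} \<Longrightarrow> rank_in {1..n} i = i"
  using rank_in_interval[of i 0 n] by simp

text \<open>Relabelling by rank keeps the order, hence also the number of elements of K up to k.
  This is what makes restricting twice agree with restricting once.\<close>

lemma rank_in_rank_in:
  assumes "finite I" "K \<subseteq> I" "k \<in> K"
  shows "rank_in (rank_in I ` K) (rank_in I k) = rank_in K k"
proof -
  have "{h \<in> rank_in I ` K. h \<le> rank_in I k} = rank_in I ` {h \<in> K. h \<le> k}"
    using assms rank_in_less_iff[OF assms(1)] by (auto simp: linorder_not_less[symmetric] subset_iff)
  moreover have "inj_on (rank_in I) {h \<in> K. h \<le> k}"
    by (rule inj_on_subset[OF inj_on_rank_in[OF assms(1)]]) (use assms in auto)
  ultimately show ?thesis by (simp add: rank_in_def[of "_ ` _"] rank_in_def[of K] card_image)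
qed

text \<open>Serves to read a cut of the whole vertex set inside the restriction to I, where it again
  becomes a cut into an initial and a final segment.\<close>

lemma rank_in_initial_segment:
  assumes "finite I" "X \<union> Y = I" "\<And>x y. x \<in> X \<Longrightarrow> y \<in> Y \<Longrightarrow> x < y"
  shows "rank_in I ` X = {1..card X}" "rank_in I ` Y = {card X + 1..card X + card Y}"
proof -
  have fin: "finite X" "finite Y" using assms(1,2) by auto
  have disj: "X \<inter> Y = {}" using assms(3) by blast
  have "rank_in I x = rank_in X x" if "x \<in> X" for x
  proof -
    have "{h \<in> I. h \<le> x} = {h \<in> X. h \<le> x}"
      using assms(2) assms(3)[OF that] by (auto simp: linorder_not_less[symmetric])
    then show ?thesis by (simp add: rank_in_def)
  qed
  then have "rank_in I ` X = rank_in X ` X" by (rule image_cong[OF refl])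
  then show X: "rank_in I ` X = {1..card X}" by (simp add: rank_in_image fin)
  have "rank_in I ` Y = rank_in I ` I - rank_in I ` X"
  proof -
    have "Y = I - X" using assms(2) disj by blast
    then show ?thesis
      using inj_on_image_set_diff[OF inj_on_rank_in[OF assms(1)], of I X] assms(2) by auto
  qed
  also have "\<dots> = {card X + 1..card X + card Y}"
    using card_Un_disjoint[OF fin disj] by (auto simp: X rank_in_image assms(1,2))
  finally show "rank_in I ` Y = {card X + 1..card X + card Y}" .
qed


section \<open>Coproducts from restriction\<close>

text \<open>Typed like \<open>sep\<close>, so that either can be given to \<open>coprod\<close>. For
  a set and its complement it singles out the initial segments (\<open>cuts_below\<close>).\<close>

definition below :: "'a \<Rightarrow> nat set \<Rightarrow> nat set \<Rightarrow> bool" where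
  "below G X Y \<longleftrightarrow> (\<forall>x\<in>X. \<forall>y\<in>Y. x < y)"

definition cuts :: "('a \<Rightarrow> nat set \<Rightarrow> nat set \<Rightarrow> bool) \<Rightarrow> 'a \<Rightarrow> nat set \<Rightarrow> nat set set" where
  "cuts R G I = {K. K \<subseteq> I \<and> R G K (I - K)}"

text \<open>Both coproducts of the theorem send a structure to the sum of its restrictions to a set of
  vertices and to the complement of that set. They differ in the relation \<open>R\<close> required of the two
  complementary sets: \<open>sep\<close> (no edges in between) for the one, \<open>below\<close> for the other.\<close>

locale restriction_structure =
  fixes size :: "'a \<Rightarrow> nat" and restr :: "'a \<Rightarrow> nat set \<Rightarrow> 'a"
    and sep :: "'a \<Rightarrow> nat set \<Rightarrow> nat set \<Rightarrow> bool" and e :: 'a and deg :: "'a \<Rightarrow> nat"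
  assumes size_restr: "I \<subseteq> {1..size G} \<Longrightarrow> size (restr G I) = card I"
    and restr_all: "restr G {1..size G} = G"
    and restr_restr: "K \<subseteq> I \<Longrightarrow> I \<subseteq> {1..size G} \<Longrightarrow> restr (restr G I) (rank_in I ` K) = restr G K"
    and sep_restr: "X \<subseteq> I \<Longrightarrow> Y \<subseteq> I \<Longrightarrow> I \<subseteq> {1..size G} \<Longrightarrow>
      sep (restr G I) (rank_in I ` X) (rank_in I ` Y) \<longleftrightarrow> sep G X Y"
    and sep_Un_left: "sep G (X \<union> Y) Z \<longleftrightarrow> sep G X Z \<and> sep G Y Z"
    and sep_Un_right: "sep G X (Y \<union> Z) \<longleftrightarrow> sep G X Y \<and> sep G X Z"
    and sep_empty: "sep G {} X" "sep G X {}"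
    and glue_unique: "size G = size G' \<Longrightarrow> I \<subseteq> {1..size G} \<Longrightarrow>
      sep G I ({1..size G} - I) \<Longrightarrow> sep G' I ({1..size G} - I) \<Longrightarrow>
      restr G I = restr G' I \<Longrightarrow> restr G ({1..size G} - I) = restr G' ({1..size G} - I) \<Longrightarrow> G = G'"
    and glue_exists: "I \<subseteq> {1..size C + size D} \<Longrightarrow> card I = size C \<Longrightarrow>
      \<exists>G. size G = size C + size D \<and> sep G I ({1..size G} - I) \<and>
        restr G I = C \<and> restr G ({1..size G} - I) = D"
    and size_eq_0: "size G = 0 \<longleftrightarrow> G = e"
    and deg_eq_0: "deg G = 0 \<longleftrightarrow> G = e"
    and deg_restr: "I \<subseteq> {1..size G} \<Longrightarrow> deg (restr G I) + deg (restr G ({1..size G} - I)) = deg G"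
    and finite_deg: "finite {G. deg G = k}"
begin

text \<open>What \<open>sep\<close> and \<open>below\<close> share: invariance under renumbering and
  additivity in both arguments. Coassociativity and the counit laws follow from this, so both
  coproducts are treated at once.\<close>

definition admissible :: "('a \<Rightarrow> nat set \<Rightarrow> nat set \<Rightarrow> bool) \<Rightarrow> bool" where
  "admissible R \<longleftrightarrow>
     (\<forall>G I X Y. X \<subseteq> I \<longrightarrow> Y \<subseteq> I \<longrightarrow> I \<subseteq> {1..size G} \<longrightarrow>
        R (restr G I) (rank_in I ` X) (rank_in I ` Y) = R G X Y) \<and>
     (\<forall>G X Y Z. R G (X \<union> Y) Z = (R G X Z \<and> R G Y Z)) \<and>
     (\<forall>G X Y Z. R G X (Y \<union> Z) = (R G X Y \<and> R G X Z)) \<and>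
     (\<forall>G X. R G {} X \<and> R G X {})"

lemma admissible_sep: "admissible sep"
  by (simp add: admissible_def sep_restr sep_Un_left sep_Un_right sep_empty)

lemma admissible_below: "admissible below"
proof -
  have "below (restr G I) (rank_in I ` X) (rank_in I ` Y) = below G X Y"
    if "X \<subseteq> I" "Y \<subseteq> I" "I \<subseteq> {1..size G}" for G I X Y
    using that rank_in_less_iff[OF finite_subset[OF that(3)]] by (auto simp: below_def subset_iff)
  then show ?thesis by (auto simp: admissible_def below_def)
qed

definition coprod :: "('a \<Rightarrow> nat set \<Rightarrow> nat set \<Rightarrow> bool) \<Rightarrow> 'a free \<Rightarrow> ('a \<times> 'a) free" where
  "coprod R = lin_ext (\<lambda>G. \<Sum>K\<in>cuts R G {1..size G}. basis (restr G K, restr G ({1..size G} - K)))"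

lemma finite_cuts: "finite I \<Longrightarrow> finite (cuts R G I)"
  by (rule finite_subset[of _ "Pow I"]) (auto simp: cuts_def)

lemma lin_coprod: "lin (coprod R)"
  unfolding coprod_def by (rule lin_lin_ext)

lemma coprod_basis:
  "coprod R (basis G) = (\<Sum>K\<in>cuts R G {1..size G}. basis (restr G K, restr G ({1..size G} - K)))"
  by (simp add: coprod_def)

text \<open>Ranks carry the cuts of I in G to the cuts of the restriction. Iterated coproducts can
  thus be indexed by subsets of the vertices of the original G, with no renumbering left.\<close>

lemma coprod_restr:
  assumes R: "admissible R" and I: "I \<subseteq> {1..size G}"
  shows "coprod R (basis (restr G I)) = (\<Sum>K\<in>cuts R G I. basis (restr G K, restr G (I - K)))"
proof -
  have fin: "finite I" using I finite_subset by blast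
  have inj: "inj_on (rank_in I) I" by (rule inj_on_rank_in[OF fin])
  have diff: "{1..card I} - rank_in I ` K = rank_in I ` (I - K)" if "K \<subseteq> I" for K
    using inj_on_image_set_diff[OF inj, of I K] that by (simp add: rank_in_image[OF fin])
  have R': "R (restr G I) (rank_in I ` K) (rank_in I ` (I - K)) = R G K (I - K)" if "K \<subseteq> I" for K
    using R I that by (simp add: admissible_def)
  have "bij_betw ((`) (rank_in I)) (cuts R G I) (cuts R (restr G I) {1..card I})"
  proof (rule bij_betw_imageI)
    show "inj_on ((`) (rank_in I)) (cuts R G I)"
      by (rule inj_on_subset[OF inj_on_image_Pow[OF inj]]) (auto simp: cuts_def)
    show "(`) (rank_in I) ` cuts R G I = cuts R (restr G I) {1..card I}"
    proof (intro equalityI subsetI)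
      fix K' assume "K' \<in> (`) (rank_in I) ` cuts R G I"
      then obtain K where "K' = rank_in I ` K" "K \<subseteq> I" "R G K (I - K)" by (auto simp: cuts_def)
      then show "K' \<in> cuts R (restr G I) {1..card I}"
        using R'[of K] diff[of K] image_mono[of K I "rank_in I"] by (simp add: cuts_def rank_in_image[OF fin])
    next
      fix K' assume K': "K' \<in> cuts R (restr G I) {1..card I}"
      then have "K' \<subseteq> rank_in I ` I" by (simp add: cuts_def rank_in_image[OF fin])
      then obtain K where "K \<subseteq> I" "K' = rank_in I ` K" by (auto simp: subset_image_iff)
      then show "K' \<in> (`) (rank_in I) ` cuts R G I"
        using R'[of K] diff[of K] K' by (auto simp: cuts_def)
    qed
  qed
  from sum.reindex_bij_betw[OF this, of
      "\<lambda>K. basis (restr (restr G I) K, restr (restr G I) ({1..card I} - K))"]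
  have "coprod R (basis (restr G I)) = (\<Sum>K\<in>cuts R G I. basis (restr (restr G I) (rank_in I ` K),
      restr (restr G I) ({1..card I} - rank_in I ` K)))"
    by (simp add: coprod_basis size_restr[OF I])
  also have "\<dots> = (\<Sum>K\<in>cuts R G I. basis (restr G K, restr G (I - K)))"
    by (rule sum.cong) (auto simp: cuts_def diff restr_restr I simp del: One_nat_def)
  finally show ?thesis .
qed

lemma restr_eq_empty: "K \<subseteq> {1..size G} \<Longrightarrow> restr G K = e \<longleftrightarrow> K = {}"
  using size_restr[of K G] finite_subset[of K "{1..size G}"] by (auto simp flip: size_eq_0)

text \<open>Both sides run over the ordered partitions of the vertices into three sets, each related
  by R to the later ones; additivity of R lets the two binary cuts be made in either order.\<close>

lemma coassoc_coprod:
  assumes R: "admissible R"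
  shows "tensor_assoc (tensor_map (coprod R) id (coprod R x)) = tensor_map id (coprod R) (coprod R x)"
proof (rule lin_eqI[OF lin_comp[OF lin_comp[OF lin_coprod lin_tensor_map] lin_tensor_assoc]
    lin_comp[OF lin_coprod lin_tensor_map]])
  fix G
  let ?V = "{1..size G}"
  let ?r = "restr G"
  have Un: "R G (X \<union> Y) Z = (R G X Z \<and> R G Y Z)" "R G X (Y \<union> Z) = (R G X Y \<and> R G X Z)" for X Y Z
    using R by (simp_all add: admissible_def)
  have "tensor_assoc (tensor_map (coprod R) id (coprod R (basis G))) =
      (\<Sum>I\<in>cuts R G ?V. \<Sum>K\<in>cuts R G I. basis (?r K, (?r (I - K), ?r (?V - I))))"
    unfolding coprod_basis lin_sum[OF lin_tensor_map] lin_sum[OF lin_tensor_assoc]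
    by (rule sum.cong) (simp_all add: cuts_def coprod_restr[OF R, unfolded cuts_def]
      lin_sum[OF lin_tensor_left] lin_sum[OF lin_tensor_assoc])
  also have "\<dots> = (\<Sum>(I, K)\<in>Sigma (cuts R G ?V) (cuts R G). basis (?r K, (?r (I - K), ?r (?V - I))))"
  proof (rule sum.Sigma)
    have "finite I" if "I \<in> cuts R G ?V" for I
      using that finite_subset[of I ?V] by (simp add: cuts_def)
    then show "\<forall>I\<in>cuts R G ?V. finite (cuts R G I)" by (simp add: finite_cuts)
  qed (simp add: finite_cuts)
  also have "\<dots> = (\<Sum>(J, L)\<in>Sigma (cuts R G ?V) (\<lambda>J. cuts R G (?V - J)).
      basis (?r J, (?r L, ?r (?V - J - L))))"
  \<comment> \<open>The pair (I, K) encodes the partition into K, I - K and the rest by its partial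
    unions, the pair (J, L) by its first two sets.\<close>
  proof (rule sum.reindex_bij_witness[of _ "\<lambda>(J, L). (J \<union> L, J)" "\<lambda>(I, K). (K, I - K)"])
    fix x assume "x \<in> Sigma (cuts R G ?V) (cuts R G)"
    then obtain I K where x: "x = (I, K)" "I \<subseteq> ?V" "R G I (?V - I)" "K \<subseteq> I" "R G K (I - K)"
      by (auto simp: cuts_def)
    show "(case case x of (I, K) \<Rightarrow> (K, I - K) of (J, L) \<Rightarrow> (J \<union> L, J)) = x"
      using x by auto
    have s: "K \<union> (I - K) = I" "(I - K) \<union> (?V - I) = ?V - K" "?V - K - (I - K) = ?V - I"
      using x by auto
    have "R G K (?V - K)" "R G (I - K) (?V - I)"
      using x Un(1)[of K "I - K" "?V - I", unfolded s(1)] Un(2)[of K "I - K" "?V - I", unfolded s(2)]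
      by blast+
    then have "K \<in> cuts R G ?V" "I - K \<in> cuts R G (?V - K)"
      unfolding cuts_def mem_Collect_eq s(3) using x by blast+
    then show "(case x of (I, K) \<Rightarrow> (K, I - K)) \<in> Sigma (cuts R G ?V) (\<lambda>J. cuts R G (?V - J))"
      using x(1) by simp
    show "(case case x of (I, K) \<Rightarrow> (K, I - K) of (J, L) \<Rightarrow> basis (?r J, (?r L, ?r (?V - J - L)))) =
      (case x of (I, K) \<Rightarrow> basis (?r K, (?r (I - K), ?r (?V - I))))"
      using x s by simp
  next
    fix x assume "x \<in> Sigma (cuts R G ?V) (\<lambda>J. cuts R G (?V - J))"
    then obtain J L where x: "x = (J, L)" "J \<subseteq> ?V" "R G J (?V - J)" "L \<subseteq> ?V - J"
      "R G L (?V - J - L)"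
      by (auto simp: cuts_def)
    show "(case case x of (J, L) \<Rightarrow> (J \<union> L, J) of (I, K) \<Rightarrow> (K, I - K)) = x"
      using x by auto
    have s: "J \<union> L - J = L" "L \<union> (?V - J - L) = ?V - J" "?V - (J \<union> L) = ?V - J - L"
      using x by auto
    have "R G (J \<union> L) (?V - J - L)" "R G J L"
      using x Un(1)[of J L "?V - J - L"] Un(2)[of J L "?V - J - L", unfolded s(2)] by blast+
    then have "J \<union> L \<in> cuts R G ?V" "J \<in> cuts R G (J \<union> L)"
      unfolding cuts_def mem_Collect_eq s(1,3) using x by blast+
    then show "(case x of (J, L) \<Rightarrow> (J \<union> L, J)) \<in> Sigma (cuts R G ?V) (cuts R G)"
      using x(1) by simp
  qed
  also have "\<dots> = (\<Sum>J\<in>cuts R G ?V. \<Sum>L\<in>cuts R G (?V - J). basis (?r J, (?r L, ?r (?V - J - L))))"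
    by (rule sum.Sigma[symmetric]) (auto intro: finite_cuts)
  also have "\<dots> = tensor_map id (coprod R) (coprod R (basis G))"
    unfolding coprod_basis lin_sum[OF lin_tensor_map]
    by (rule sum.cong) (simp_all add: coprod_restr[OF R] lin_sum[OF lin_tensor_right])
  finally show "tensor_assoc (tensor_map (coprod R) id (coprod R (basis G))) =
      tensor_map id (coprod R) (coprod R (basis G))" .
qed

text \<open>Only the empty set restricts to the empty structure, so the counit keeps a single cut,
  whose other part is all of G.\<close>

lemma coalgebra_coprod:
  assumes R: "admissible R"
  shows "coalgebra_axms (coprod R) (dot (basis e))"
proof (rule coalgebra_axms.intro)
  show "contract_left (dot (basis e)) (coprod R x) = x" for x
  proof (rule lin_eqI[OF lin_comp[OF lin_coprod lin_contract_left] lin_id(2)])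
    fix G
    let ?V = "{1..size G}"
    have "contract_left (dot (basis e)) (coprod R (basis G)) =
        (\<Sum>K\<in>cuts R G ?V. scl (coef (basis e) (restr G K)) (basis (restr G (?V - K))))"
      by (simp add: coprod_basis lin_sum[OF lin_contract_left])
    also have "\<dots> = (\<Sum>K\<in>cuts R G ?V. if {} = K then basis (restr G ?V) else 0)"
    proof (rule sum.cong[OF refl])
      fix K assume "K \<in> cuts R G ?V"
      then have "K \<subseteq> ?V" by (simp add: cuts_def)
      from restr_eq_empty[OF this]
      show "scl (coef (basis e) (restr G K)) (basis (restr G (?V - K))) =
          (if {} = K then basis (restr G ?V) else 0)"
        by (auto simp: coef_basis)
    qed
    also have "\<dots> = basis G"
    proof -
      have "{} \<in> cuts R G ?V" using R by (simp add: cuts_def admissible_def)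
      then show ?thesis by (simp add: finite_cuts restr_all del: One_nat_def)
    qed
    finally show "contract_left (dot (basis e)) (coprod R (basis G)) = basis G" .
  qed
  show "contract_right (dot (basis e)) (coprod R x) = x" for x
  proof (rule lin_eqI[OF lin_comp[OF lin_coprod lin_contract_right] lin_id(2)])
    fix G
    let ?V = "{1..size G}"
    have "contract_right (dot (basis e)) (coprod R (basis G)) =
        (\<Sum>K\<in>cuts R G ?V. scl (coef (basis e) (restr G (?V - K))) (basis (restr G K)))"
      by (simp add: coprod_basis lin_sum[OF lin_contract_right])
    also have "\<dots> = (\<Sum>K\<in>cuts R G ?V. if ?V = K then basis (restr G ?V) else 0)"
    proof (rule sum.cong[OF refl])
      fix K assume "K \<in> cuts R G ?V"
      then have "K \<subseteq> ?V" by (simp add: cuts_def)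
      then have "?V - K = {} \<longleftrightarrow> ?V = K" by blast
      then have "e = restr G (?V - K) \<longleftrightarrow> ?V = K"
        using restr_eq_empty[of "?V - K" G] by blast
      then show "scl (coef (basis e) (restr G (?V - K))) (basis (restr G K)) =
          (if ?V = K then basis (restr G ?V) else 0)"
        by (simp add: coef_basis del: One_nat_def)
    qed
    also have "\<dots> = basis G"
    proof -
      have "?V \<in> cuts R G ?V" using R by (simp add: cuts_def admissible_def)
      then show ?thesis by (simp add: finite_cuts restr_all del: One_nat_def)
    qed
    finally show "contract_right (dot (basis e)) (coprod R (basis G)) = basis G" .
  qed
qed (simp_all add: lin_coprod functional_dot coassoc_coprod[OF R])

lemma graded_coprod: "graded deg (tensor_deg deg) (coprod R)"
proof (rule gradedI[OF lin_coprod])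
  fix G
  show "coprod R (basis G) \<in> component (tensor_deg deg) (deg G)"
    unfolding coprod_basis component_def
    by (intro free.span_sum free.span_base) (auto simp: cuts_def simp del: One_nat_def intro!: exI deg_restr)
qed

subsection \<open>The product dual to cutting into an initial and a final segment\<close>

text \<open>Compositions expressed through restriction alone; that these are the compositions of
  B-diagrams is \<open>compositions_eq\<close>.\<close>

definition comps :: "'a \<Rightarrow> 'a \<Rightarrow> 'a set" where
  "comps A B = {G. size G = size A + size B \<and> restr G {1..size A} = A \<and>
     restr G {size A + 1..size A + size B} = B}"

definition seg_prod :: "('a \<times> 'a) free \<Rightarrow> 'a free" where
  "seg_prod = lin_ext (\<lambda>(A, B). \<Sum>G\<in>comps A B. basis G)"

text \<open>The degrees of complementary restrictions add up, so a composition has degree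
  \<open>deg A + deg B\<close>, which finitely many structures share.\<close>

lemma finite_comps: "finite (comps A B)"
proof (rule finite_subset[OF _ finite_deg[of "deg A + deg B"]])
  show "comps A B \<subseteq> {G. deg G = deg A + deg B}"
  proof
    fix G assume G: "G \<in> comps A B"
    then have "{1..size G} - {1..size A} = {size A + 1..size A + size B}"
      by (auto simp: comps_def)
    then show "G \<in> {G. deg G = deg A + deg B}"
      using G deg_restr[of "{1..size A}" G] by (auto simp: comps_def simp del: One_nat_def)
  qed
qed

lemma lin_seg_prod: "lin seg_prod"
  unfolding seg_prod_def by (rule lin_lin_ext)

lemma seg_prod_basis: "seg_prod (basis (A, B)) = (\<Sum>G\<in>comps A B. basis G)"
  by (simp add: seg_prod_def)

lemma coef_sum_basis: "finite S \<Longrightarrow> coef (\<Sum>s\<in>S. basis (f s)) b = of_nat (card {s \<in> S. f s = b})"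
  by (simp add: lookup_sum coef_basis sum.If_cases Int_def)

lemma cuts_below: "cuts below G {1..n} = (\<lambda>r. {1..r}) ` {..n}"
proof (intro equalityI subsetI)
  fix K assume "K \<in> cuts below G {1..n}"
  then have K: "K \<subseteq> {1..n}" "\<And>x y. x \<in> K \<Longrightarrow> y \<in> {1..n} - K \<Longrightarrow> x < y"
    by (auto simp: cuts_def below_def)
  have fin: "finite K" using K(1) finite_subset by blast
  show "K \<in> (\<lambda>r. {1..r}) ` {..n}"
  proof (cases "K = {}")
    case True
    then show ?thesis by (auto intro!: image_eqI[of _ _ 0])
  next
    case False
    have "Max K \<in> K" by (rule Max_in[OF fin False])
    have "K = {1..Max K}"
    proof (intro equalityI subsetI)
      fix x assume "x \<in> K" then show "x \<in> {1..Max K}" using K(1) fin by auto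
    next
      fix x assume x: "x \<in> {1..Max K}"
      \<comment> \<open>Otherwise x would lie in the complement and would have to exceed
        \<open>Max K\<close>.\<close>
      show "x \<in> K"
        using K(2)[OF \<open>Max K \<in> K\<close>, of x] x K(1) \<open>Max K \<in> K\<close> by force
    qed
    then show ?thesis using K(1) \<open>Max K \<in> K\<close> by auto
  qed
qed (auto simp: cuts_def below_def)

text \<open>The pair (A, B) forces G to be cut at \<open>size A\<close>, so both matrix entries are
  1 or 0 according to whether that cut yields A and B.\<close>

lemma transposed_seg_prod_coprod: "transposed seg_prod (coprod below)"
proof (rule transposed_basisI[OF lin_seg_prod lin_coprod])
  fix AB :: "'a \<times> 'a" and G
  obtain A B where AB: "AB = (A, B)" by (cases AB)
  let ?V = "{1..size G}"
  have seg: "{1..size G} - {1..r} = {r + 1..size G}" for r by auto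
  have card: "r = size A" if "r \<le> size G" "restr G {1..r} = A" for r
    using size_restr[of "{1..r}" G] that by auto
  have eq: "{K \<in> cuts below G ?V. (restr G K, restr G (?V - K)) = (A, B)} =
      (if G \<in> comps A B then {{1..size A}} else {})"
  proof (cases "G \<in> comps A B")
    case True
    then have "size A \<le> size G" by (simp add: comps_def)
    then have "{1..size A} \<in> cuts below G ?V" unfolding cuts_below by blast
    then have "{1..size A} \<in> {K \<in> cuts below G ?V. (restr G K, restr G (?V - K)) = (A, B)}"
      using True unfolding mem_Collect_eq seg by (simp add: comps_def del: One_nat_def)
    moreover have "K = {1..size A}"
      if "K \<in> {K \<in> cuts below G ?V. (restr G K, restr G (?V - K)) = (A, B)}" for K
      using that card unfolding cuts_below by (auto simp del: One_nat_def)
    ultimately show ?thesis unfolding if_P[OF True] by blast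
  next
    case False
    have "G \<in> comps A B" if "r \<le> size G" "restr G {1..r} = A" "restr G {r + 1..size G} = B" for r
    proof -
      have "size B = size G - r" using size_restr[of "{r + 1..size G}" G] that by auto
      then show ?thesis using card[OF that(1,2)] that by (simp add: comps_def del: One_nat_def)
    qed
    then have "(restr G {1..r}, restr G (?V - {1..r})) \<noteq> (A, B)" if "r \<le> size G" for r
      using that False unfolding seg by blast
    then show ?thesis
      using False unfolding cuts_below by (auto simp del: One_nat_def)
  qed
  have "{G' \<in> comps A B. G' = G} = (if G \<in> comps A B then {G} else {})" by auto
  then show "coef (seg_prod (basis AB)) G = coef (coprod below (basis G)) AB"
    unfolding AB seg_prod_basis coprod_basis coef_sum_basis[OF finite_comps]
      coef_sum_basis[OF finite_cuts[OF finite_atLeastAtMost]] eq by simp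
qed

subsection \<open>Compatibility of the product with the coproduct\<close>

context
  fixes A B :: 'a
begin

definition left_part :: "nat set \<Rightarrow> nat set" where
  "left_part I = I \<inter> {1..size A}"

text \<open>Taking ranks in this interval subtracts \<open>size A\<close>, which gives the numbering
  of the vertices of B.\<close>

definition right_part :: "nat set \<Rightarrow> nat set" where
  "right_part I = rank_in {size A + 1..size A + size B} ` (I - {1..size A})"

text \<open>The candidates for the restriction to I of a composition of A and B.\<close>

definition part_comps :: "nat set \<Rightarrow> 'a set" where
  "part_comps I = comps (restr A (left_part I)) (restr B (right_part I))"

lemma part_bounds:
  assumes "I \<subseteq> {1..size A + size B}"
  shows "left_part I \<subseteq> {1..size A}" "right_part I \<subseteq> {1..size B}"
    "left_part ({1..size A + size B} - I) = {1..size A} - left_part I"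
    "right_part ({1..size A + size B} - I) = {1..size B} - right_part I"
proof -
  let ?R = "{size A + 1..size A + size B}"
  have sub: "I - {1..size A} \<subseteq> ?R" using assms by auto
  show "left_part I \<subseteq> {1..size A}" by (auto simp: left_part_def)
  show "left_part ({1..size A + size B} - I) = {1..size A} - left_part I"
    by (auto simp: left_part_def)
  have im: "rank_in ?R ` ?R = {1..size B}" by (simp add: rank_in_image)
  show "right_part I \<subseteq> {1..size B}"
    using image_mono[OF sub, of "rank_in ?R"] unfolding right_part_def im .
  have "{1..size A + size B} - I - {1..size A} = ?R - (I - {1..size A})" by auto
  then show "right_part ({1..size A + size B} - I) = {1..size B} - right_part I"
    using inj_on_image_set_diff[OF inj_on_rank_in[of ?R], of ?R "I - {1..size A}"] sub
    unfolding right_part_def im[symmetric] by auto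
qed

text \<open>Vertices of a composition are chosen independently in A and in B. This turns a sum over
  I into the double sum coming from the two coproducts.\<close>

lemma bij_betw_parts:
  "bij_betw (\<lambda>I. (left_part I, right_part I)) (Pow {1..size A + size B}) (Pow {1..size A} \<times> Pow {1..size B})"
proof (rule bij_betw_imageI)
  let ?R = "{size A + 1..size A + size B}"
  have inj: "inj_on (rank_in ?R) ?R" by (rule inj_on_rank_in) simp
  have im: "rank_in ?R ` ?R = {1..size B}" by (simp add: rank_in_image)
  show "inj_on (\<lambda>I. (left_part I, right_part I)) (Pow {1..size A + size B})"
  proof (rule inj_onI)
    fix I J assume IJ: "I \<in> Pow {1..size A + size B}" "J \<in> Pow {1..size A + size B}"
      and eq: "(left_part I, right_part I) = (left_part J, right_part J)"
    have sub: "I - {1..size A} \<subseteq> ?R" "J - {1..size A} \<subseteq> ?R" using IJ by auto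
    have "I - {1..size A} = J - {1..size A}"
      using eq inj_on_image_eq_iff[OF inj sub] by (simp add: right_part_def)
    moreover have "I \<inter> {1..size A} = J \<inter> {1..size A}" using eq by (simp add: left_part_def)
    ultimately show "I = J" by blast
  qed
  show "(\<lambda>I. (left_part I, right_part I)) ` Pow {1..size A + size B} = Pow {1..size A} \<times> Pow {1..size B}"
  proof (intro equalityI subsetI)
    fix z assume "z \<in> Pow {1..size A} \<times> Pow {1..size B}"
    then obtain X Y where z: "z = (X, Y)" "X \<subseteq> {1..size A}" "Y \<subseteq> rank_in ?R ` ?R"
      unfolding im by auto
    then obtain Y' where Y': "Y' \<subseteq> ?R" "Y = rank_in ?R ` Y'" by (meson subset_imageE)
    have "Y' \<inter> {1..size A} = {}" using Y'(1) by fastforce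
    then have "(X \<union> Y') \<inter> {1..size A} = X" "X \<union> Y' - {1..size A} = Y'"
      using z(2) by blast+
    then have "z = (left_part (X \<union> Y'), right_part (X \<union> Y'))"
      by (simp add: left_part_def right_part_def z(1) Y'(2))
    moreover have "X \<union> Y' \<in> Pow {1..size A + size B}" using z(2) Y'(1) by fastforce
    ultimately show "z \<in> (\<lambda>I. (left_part I, right_part I)) ` Pow {1..size A + size B}" by blast
  qed (use part_bounds in blast)
qed

lemma card_parts:
  assumes "I \<subseteq> {1..size A + size B}"
  shows "card (right_part I) = card (I - {1..size A})"
    and "card I = card (left_part I) + card (right_part I)"
proof -
  have sub: "I - {1..size A} \<subseteq> {size A + 1..size A + size B}" using assms by auto
  show r: "card (right_part I) = card (I - {1..size A})"
    unfolding right_part_def by (rule card_image[OF inj_on_subset[OF inj_on_rank_in sub]]) simp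
  show "card I = card (left_part I) + card (right_part I)"
    using card_Un_disjoint[of "I \<inter> {1..size A}" "I - {1..size A}"] finite_subset[OF assms]
    by (simp add: r left_part_def Int_Diff_Un Int_Diff_disjoint)
qed

lemma rank_in_left: "X \<subseteq> {1..size A} \<Longrightarrow> rank_in {1..size A} ` X = X"
  using rank_in_initial[of _ "size A"] by (force simp: image_iff subset_iff)

text \<open>Each equation reaches the part of I in one of the two segments by two routes:
  restricting to the segment first, or to I first.\<close>

lemma restr_parts:
  assumes G: "size G = size A + size B" and I: "I \<subseteq> {1..size A + size B}"
  defines "l \<equiv> card (left_part I)" and "r \<equiv> card (right_part I)"
  shows "restr (restr G {1..size A}) (left_part I) = restr (restr G I) {1..l}"
    and "restr (restr G {size A + 1..size A + size B}) (right_part I) = restr (restr G I) {l + 1..l + r}"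
proof -
  let ?L = "{1..size A}" and ?R = "{size A + 1..size A + size B}"
  have sub: "I \<inter> ?L \<subseteq> ?L" "I - ?L \<subseteq> ?R" "?L \<subseteq> {1..size G}" "?R \<subseteq> {1..size G}"
    and IG: "I \<subseteq> {1..size G}"
    using I G by auto
  have "I \<inter> ?L \<union> (I - ?L) = I" by blast
  moreover have "x < y" if "x \<in> I \<inter> ?L" "y \<in> I - ?L" for x y
    using that I by auto
  ultimately have seg: "rank_in I ` (I \<inter> ?L) = {1..l}" "rank_in I ` (I - ?L) = {l + 1..l + r}"
    using rank_in_initial_segment[OF finite_subset[OF I], of "I \<inter> ?L" "I - ?L"] card_parts(1)[OF I]
    unfolding l_def r_def left_part_def by auto
  show "restr (restr G ?L) (left_part I) = restr (restr G I) {1..l}"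
    unfolding left_part_def seg(1)[symmetric]
    using restr_restr[OF sub(1,3), unfolded rank_in_left[OF sub(1)]] restr_restr[OF Int_lower1 IG, of ?L]
    by simp
  show "restr (restr G ?R) (right_part I) = restr (restr G I) {l + 1..l + r}"
    unfolding right_part_def seg(2)[symmetric]
    using restr_restr[OF sub(2,4)] restr_restr[OF Diff_subset IG, of ?L] by simp
qed

lemma part_comps_iff:
  assumes "I \<subseteq> {1..size A + size B}"
  shows "C \<in> part_comps I \<longleftrightarrow> size C = card I \<and>
    restr C {1..card (left_part I)} = restr A (left_part I) \<and>
    restr C {card (left_part I) + 1..card (left_part I) + card (right_part I)} = restr B (right_part I)"
  unfolding part_comps_def comps_def mem_Collect_eq size_restr[OF part_bounds(1)[OF assms]]
    size_restr[OF part_bounds(2)[OF assms]] card_parts(2)[OF assms] ..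

lemma sep_mono: "sep G X Y \<Longrightarrow> X' \<subseteq> X \<Longrightarrow> Y' \<subseteq> Y \<Longrightarrow> sep G X' Y'"
  by (metis sep_Un_left sep_Un_right subset_Un_eq)

lemma sep_parts:
  assumes G: "size G = size A + size B" and I: "I \<subseteq> {1..size A + size B}"
    and sep: "sep G I ({1..size A + size B} - I)"
  shows "sep (restr G {1..size A}) (left_part I) ({1..size A} - left_part I)"
    and "sep (restr G {size A + 1..size A + size B}) (right_part I) ({1..size B} - right_part I)"
proof -
  let ?V = "{1..size A + size B}" and ?L = "{1..size A}" and ?R = "{size A + 1..size A + size B}"
  have "sep G (I \<inter> ?L) (?L - I)"
    by (rule sep_mono[OF sep]) auto
  then have "sep (restr G ?L) (rank_in ?L ` (I \<inter> ?L)) (rank_in ?L ` (?L - I))"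
    by (subst sep_restr) (use G in auto)
  then show "sep (restr G ?L) (left_part I) (?L - left_part I)"
    unfolding left_part_def using rank_in_left[of "I \<inter> ?L"] rank_in_left[of "?L - I"]
    by (simp add: Diff_Int)
  have sub: "I - ?L \<subseteq> ?R" "?V - I - ?L \<subseteq> ?R" using I by auto
  have "sep G (I - ?L) (?V - I - ?L)"
    by (rule sep_mono[OF sep]) auto
  then have "sep (restr G ?R) (rank_in ?R ` (I - ?L)) (rank_in ?R ` (?V - I - ?L))"
    by (subst sep_restr[OF sub]) (use G in auto)
  then show "sep (restr G ?R) (right_part I) ({1..size B} - right_part I)"
    unfolding right_part_def part_bounds(4)[OF I, unfolded right_part_def, symmetric] .
qed

text \<open>Injectivity is uniqueness of gluing. For surjectivity the two given parts are glued
  along I. The left segment of the result and A then have the same isolated set and the same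
  restrictions to it and to its complement, so they coincide; likewise for B.\<close>

lemma bij_betw_glue:
  assumes I: "I \<subseteq> {1..size A + size B}"
    and QA: "left_part I \<in> cuts sep A {1..size A}" and QB: "right_part I \<in> cuts sep B {1..size B}"
  shows "bij_betw (\<lambda>G. (restr G I, restr G ({1..size A + size B} - I)))
    {G \<in> comps A B. sep G I ({1..size A + size B} - I)}
    (part_comps I \<times> part_comps ({1..size A + size B} - I))"
proof (rule bij_betw_imageI)
  let ?V = "{1..size A + size B}" and ?L = "{1..size A}" and ?R = "{size A + 1..size A + size B}"
  let ?J = "?V - I"
  have J: "?J \<subseteq> ?V" by blast
  have part: "restr G X \<in> part_comps X" if "G \<in> comps A B" "X \<subseteq> ?V" for G X
    using that restr_parts[of G X] size_restr[of X G] unfolding part_comps_iff[OF that(2)] comps_def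
    by (simp del: One_nat_def)
  show "inj_on (\<lambda>G. (restr G I, restr G ?J)) {G \<in> comps A B. sep G I ?J}"
  proof (rule inj_onI)
    fix G G' assume "G \<in> {G \<in> comps A B. sep G I ?J}" "G' \<in> {G \<in> comps A B. sep G I ?J}"
      and "(restr G I, restr G ?J) = (restr G' I, restr G' ?J)"
    then show "G = G'"
      using glue_unique[of G G' I] I by (simp add: comps_def del: One_nat_def)
  qed
  show "(\<lambda>G. (restr G I, restr G ?J)) ` {G \<in> comps A B. sep G I ?J} = part_comps I \<times> part_comps ?J"
  proof (intro equalityI subsetI)
    fix z assume "z \<in> (\<lambda>G. (restr G I, restr G ?J)) ` {G \<in> comps A B. sep G I ?J}"
    then show "z \<in> part_comps I \<times> part_comps ?J"
      using part I J by blast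
  next
    fix z assume "z \<in> part_comps I \<times> part_comps ?J"
    then obtain C D where z: "z = (C, D)" and C: "C \<in> part_comps I" and D: "D \<in> part_comps ?J"
      by blast
    have c: "size C = card I" "size D = card ?J" using C D part_comps_iff I J by blast+
    have sz: "size C + size D = size A + size B"
      using c card_Diff_subset[OF finite_subset[OF I] I] card_mono[OF _ I] by auto
    obtain G where G0: "size G = size C + size D" "sep G I ({1..size G} - I)" "restr G I = C"
      "restr G ({1..size G} - I) = D"
      using glue_exists[OF I[folded sz] c(1)[symmetric]] by blast
    have szG: "size G = size A + size B" using G0(1) sz by simp
    note G = szG G0(2-4)[unfolded szG]
    have halves: "restr (restr G ?L) (left_part X) = restr A (left_part X)"
        "restr (restr G ?R) (right_part X) = restr B (right_part X)"
      if "X \<subseteq> ?V" "restr G X \<in> part_comps X" for X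
      using that restr_parts[OF szG that(1)] part_comps_iff[OF that(1)] by simp_all
    have szL: "size (restr G ?L) = size A" and szR: "size (restr G ?R) = size B"
      using size_restr[of ?L G] size_restr[of ?R G] szG by auto
    have C': "restr G I \<in> part_comps I" and D': "restr G ?J \<in> part_comps ?J"
      using C D G by simp_all
    \<comment> \<open>Uniqueness of gluing inside the left segment; \<open>QA\<close> provides that
      \<open>left_part I\<close> is isolated in A.\<close>
    have A: "restr G ?L = A"
      using glue_unique[of "restr G ?L" A "left_part I"] QA halves(1)[OF I C'] halves(1)[OF J D']
        sep_parts(1)[OF szG I G(2)]
      unfolding szL cuts_def part_bounds(3)[OF I] by blast
    have B: "restr G ?R = B"
      using glue_unique[of "restr G ?R" B "right_part I"] QB halves(2)[OF I C'] halves(2)[OF J D']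
        sep_parts(2)[OF szG I G(2)]
      unfolding szR cuts_def part_bounds(4)[OF I] by blast
    have "G \<in> comps A B" using A B szG by (simp add: comps_def del: One_nat_def)
    then show "z \<in> (\<lambda>G. (restr G I, restr G ?J)) ` {G \<in> comps A B. sep G I ?J}"
      using G z by blast
  qed
qed

text \<open>Both sides list the pairs of a composition and a set isolated in it. The left side picks
  the composition first; the right side picks isolated sets in A and B first and then composes the
  corresponding parts.\<close>

lemma coprod_seg_prod_basis:
  "coprod sep (seg_prod (basis (A, B))) =
    tensor_map seg_prod seg_prod (tensor_swap (tensor_map (coprod sep) (coprod sep) (basis (A, B))))"
proof -
  let ?V = "{1..size A + size B}"
  let ?g = "\<lambda>G I. basis (restr G I, restr G (?V - I))"
  define QA where "QA = cuts sep A {1..size A}"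
  define QB where "QB = cuts sep B {1..size B}"
  let ?Q = "\<lambda>I. left_part I \<in> QA \<and> right_part I \<in> QB"
  have "coprod sep (seg_prod (basis (A, B))) = (\<Sum>G\<in>comps A B. \<Sum>I\<in>{I \<in> Pow ?V. sep G I (?V - I)}. ?g G I)"
    unfolding seg_prod_basis lin_sum[OF lin_coprod]
    by (rule sum.cong[OF refl]) (simp add: coprod_basis comps_def cuts_def del: One_nat_def)
  also have "\<dots> = (\<Sum>I\<in>Pow ?V. \<Sum>G\<in>{G \<in> comps A B. sep G I (?V - I)}. ?g G I)"
    by (rule sum.swap_restrict) (simp_all add: finite_comps)
  also have "\<dots> = (\<Sum>I\<in>Pow ?V. if ?Q I then (\<Sum>CD\<in>part_comps I \<times> part_comps (?V - I). basis CD) else 0)"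
  proof (rule sum.cong[OF refl])
    fix I assume "I \<in> Pow ?V"
    then have I: "I \<subseteq> ?V" by blast
    show "(\<Sum>G\<in>{G \<in> comps A B. sep G I (?V - I)}. ?g G I) =
      (if ?Q I then (\<Sum>CD\<in>part_comps I \<times> part_comps (?V - I). basis CD) else 0)"
    proof (cases "?Q I")
      case True
      with bij_betw_glue[OF I] have "bij_betw (\<lambda>G. (restr G I, restr G (?V - I)))
        {G \<in> comps A B. sep G I (?V - I)} (part_comps I \<times> part_comps (?V - I))"
        by (simp add: QA_def QB_def)
      from sum.reindex_bij_betw[OF this, of basis] True show ?thesis by simp
    next
      case False
      \<comment> \<open>A set isolated in a composition meets both factors in isolated sets, so in
        this case there is no G to sum over.\<close>
      have "?Q I" if "G \<in> comps A B" "sep G I (?V - I)" for G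
        using sep_parts[of G I] part_bounds[OF I] that I
        by (simp add: QA_def QB_def cuts_def comps_def del: One_nat_def)
      then have "{G \<in> comps A B. sep G I (?V - I)} = {}" using False by blast
      then show ?thesis unfolding if_not_P[OF False] by (simp only: sum.empty)
    qed
  qed
  also have "\<dots> = (\<Sum>I\<in>Pow ?V. if ?Q I then tensor (seg_prod (basis (restr A (left_part I), restr B (right_part I))))
      (seg_prod (basis (restr A ({1..size A} - left_part I), restr B ({1..size B} - right_part I)))) else 0)"
  proof (rule sum.cong[OF refl])
    fix I assume "I \<in> Pow ?V"
    then have I: "I \<subseteq> ?V" by blast
    have "tensor (\<Sum>C\<in>X. basis C) (\<Sum>D\<in>Y. basis D) = (\<Sum>CD\<in>X \<times> Y. basis CD)" for X Y :: "'a set"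
      by (subst lin_sum[OF lin_tensor_left])
        (simp add: lin_sum[OF lin_tensor_right] sum.cartesian_product split_beta)
    then show "(if ?Q I then (\<Sum>CD\<in>part_comps I \<times> part_comps (?V - I). basis CD) else 0) =
      (if ?Q I then tensor (seg_prod (basis (restr A (left_part I), restr B (right_part I))))
      (seg_prod (basis (restr A ({1..size A} - left_part I), restr B ({1..size B} - right_part I)))) else 0)"
      by (simp only: seg_prod_basis part_comps_def part_bounds(3,4)[OF I])
  qed
  also have "\<dots> = (\<Sum>(X, Y)\<in>Pow {1..size A} \<times> Pow {1..size B}. if X \<in> QA \<and> Y \<in> QB
      then tensor (seg_prod (basis (restr A X, restr B Y)))
      (seg_prod (basis (restr A ({1..size A} - X), restr B ({1..size B} - Y)))) else 0)"
    using sum.reindex_bij_betw[OF bij_betw_parts, of "\<lambda>(X, Y). if X \<in> QA \<and> Y \<in> QB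
      then tensor (seg_prod (basis (restr A X, restr B Y)))
      (seg_prod (basis (restr A ({1..size A} - X), restr B ({1..size B} - Y)))) else 0"]
    by (simp only: prod.case)
  also have "\<dots> = (\<Sum>(X, Y)\<in>QA \<times> QB. tensor (seg_prod (basis (restr A X, restr B Y)))
      (seg_prod (basis (restr A ({1..size A} - X), restr B ({1..size B} - Y)))))"
    by (rule sum.mono_neutral_cong_right) (auto simp: QA_def QB_def cuts_def split: if_splits)
  also have "\<dots> = tensor_map seg_prod seg_prod (tensor_swap (tensor_map (coprod sep) (coprod sep) (basis (A, B))))"
    unfolding sum.cartesian_product[symmetric] tensor_map_basis coprod_basis QA_def QB_def
    by (simp add: lin_sum[OF lin_tensor_left] lin_sum[OF lin_tensor_right] lin_sum[OF lin_tensor_swap]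
      lin_sum[OF lin_tensor_map] del: One_nat_def) (rule sum.swap)
  finally show ?thesis .
qed

end

text \<open>\<open>seg_prod\<close> gets its algebra laws by transposing the coalgebra of
  \<open>below\<close>. In the same way the counit is multiplicative because that coproduct sends
  the empty structure to its tensor square.\<close>

lemma bialgebra_coprod: "bialgebra seg_prod (basis e) (coprod sep) (dot (basis e))"
proof -
  interpret A: algebra_axms seg_prod "basis e"
    by (rule algebra_transposed[OF coalgebra_coprod[OF admissible_below] transposed_seg_prod_coprod])
  interpret C: coalgebra_axms "coprod sep" "dot (basis e)"
    by (rule coalgebra_coprod[OF admissible_sep])
  have unit: "coprod R (basis e) = basis (e, e)" if "admissible R" for R
  proof -
    have "size e = 0" by (simp add: size_eq_0)
    moreover have "restr e {} = e" using restr_all[of e] calculation by simp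
    moreover have "R e {} {}" using that by (simp add: admissible_def)
    then have "cuts R e {} = {{}}" by (auto simp: cuts_def)
    ultimately show ?thesis by (simp add: coprod_basis)
  qed
  show ?thesis
  proof unfold_locales
    show "coprod sep (seg_prod z) = tensor_map seg_prod seg_prod (tensor_swap (tensor_map (coprod sep) (coprod sep) z))" for z
      by (rule lin_eqI_pair[OF lin_comp[OF lin_seg_prod lin_coprod]
        lin_comp[OF lin_comp[OF lin_tensor_map lin_tensor_swap] lin_tensor_map] coprod_seg_prod_basis])
    show "coprod sep (basis e) = tensor (basis e) (basis e)"
      by (simp add: unit admissible_sep)
    show "dot (basis e) (seg_prod (tensor x y)) = dot (basis e) x * dot (basis e) y" for x y
      using transposedD[OF transposed_sym[OF transposed_seg_prod_coprod], of "basis e" "tensor x y"]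
      by (simp only: unit[OF admissible_below] tensor_basis[symmetric] dot_tensor)
    show "dot (basis e) (basis e) = 1" by (simp add: coef_basis)
  qed
qed

end

section \<open>Half-edges\<close>

text \<open>The half-edge at position \<open>j\<close> of vertex \<open>i\<close> is the pair \<open>(i, j)\<close>, both counted from 1.\<close>

definition pos :: "nat list \<Rightarrow> nat \<times> nat \<Rightarrow> nat" where
  "pos ls p = sum_list (take (fst p - 1) ls) + snd p"

definition halves :: "nat list \<Rightarrow> (nat \<times> nat) set" where
  "halves ls = {(i, j). i \<in> {1..length ls} \<and> j \<in> {1..ls ! (i - 1)}}"

lemma sum_list_take_pred:
  "i \<in> {1..length ls} \<Longrightarrow> sum_list (take i ls) = sum_list (take (i - 1) ls) + ls ! (i - 1 :: nat)"
  for ls :: "nat list"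
  by (cases i) (simp_all add: take_Suc_conv_app_nth)

lemma pos_bounds:
  assumes "p \<in> halves ls"
  shows "sum_list (take (fst p - 1) ls) < pos ls p" "pos ls p \<le> sum_list (take (fst p) ls)"
  using assms sum_list_take_pred[of "fst p" ls] by (auto simp: halves_def pos_def)

lemma pos_range: "p \<in> halves ls \<Longrightarrow> pos ls p \<in> {1..sum_list ls}"
  using pos_bounds[of p ls] sum_take_mono[of "fst p" "length ls" ls] by (auto simp: halves_def)

lemma block_pos: "p \<in> halves ls \<Longrightarrow> block ls (pos ls p) = fst p"
  using pos_bounds[of p ls] by (intro block_eqI) (auto simp: halves_def)

text \<open>Positions list the half-edges lexicographically, so a renumbering that is increasing on
  vertices and keeps the places within them is increasing on positions.\<close>

lemma pos_less:
  assumes "p \<in> halves ls" "q \<in> halves ls" "fst p < fst q \<or> fst p = fst q \<and> snd p < snd q"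
  shows "pos ls p < pos ls q"
  using assms(3)
proof
  assume "fst p < fst q"
  then have "sum_list (take (fst p) ls) \<le> sum_list (take (fst q - 1) ls)"
    by (intro sum_take_mono) simp
  then show ?thesis using pos_bounds(2)[OF assms(1)] pos_bounds(1)[OF assms(2)] by simp
qed (simp add: pos_def)

lemma pos_less_iff:
  assumes "p \<in> halves ls" "q \<in> halves ls"
  shows "pos ls p < pos ls q \<longleftrightarrow> fst p < fst q \<or> fst p = fst q \<and> snd p < snd q"
proof
  assume l: "pos ls p < pos ls q"
  show "fst p < fst q \<or> fst p = fst q \<and> snd p < snd q"
  proof (rule ccontr)
    assume "\<not> ?thesis"
    then have "p = q \<or> fst q < fst p \<or> fst q = fst p \<and> snd q < snd p"
      by (auto simp: prod_eq_iff)
    then have "pos ls q \<le> pos ls p" using pos_less[OF assms(2,1)] by auto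
    with l show False by simp
  qed
qed (rule pos_less[OF assms])

lemma bij_betw_pos: "bij_betw (pos ls) (halves ls) {1..sum_list ls}"
proof (rule bij_betw_imageI)
  show "inj_on (pos ls) (halves ls)"
    by (rule inj_onI) (metis linorder_neqE_nat order_less_irrefl pos_less prod_eq_iff)
  have "k \<in> pos ls ` halves ls" if k: "k \<in> {1..sum_list ls}" for k
  proof
    \<comment> \<open>The vertex carrying position k, and the offset of k within its block.\<close>
    let ?p = "(block ls k, k - sum_list (take (block ls k - 1) ls))"
    note b = block_bounds[OF k]
    show "k = pos ls ?p" using b by (simp add: pos_def)
    show "?p \<in> halves ls" using b sum_list_take_pred[of "block ls k" ls] by (simp add: halves_def) arith
  qed
  then show "pos ls ` halves ls = {1..sum_list ls}" using pos_range by blast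
qed

lemma pos_eq_iff: "p \<in> halves ls \<Longrightarrow> q \<in> halves ls \<Longrightarrow> pos ls p = pos ls q \<longleftrightarrow> p = q"
  using bij_betw_pos[of ls] by (auto simp: bij_betw_def inj_on_def)

lemma pos_cases:
  assumes "k \<in> {1..sum_list ls}"
  obtains p where "p \<in> halves ls" "k = pos ls p"
proof -
  have "k \<in> pos ls ` halves ls" using assms bij_betw_pos[of ls] by (simp add: bij_betw_def)
  then show ?thesis using that by blast
qed

text \<open>In these coordinates renumbering the vertices changes first components only, whereas
  absolute positions depend on the sizes of all earlier blocks.\<close>

definition edg :: "bdiag \<Rightarrow> nat \<times> nat \<Rightarrow> nat \<times> nat \<Rightarrow> bool" where
  "edg G p q \<longleftrightarrow> p \<in> halves (lam G) \<and> q \<in> halves (lam G) \<and> (pos (lam G) p, pos (lam G) q) \<in> edges G"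

definition upf :: "bdiag \<Rightarrow> nat \<times> nat \<Rightarrow> bool" where
  "upf G p \<longleftrightarrow> p \<in> halves (lam G) \<and> pos (lam G) p \<in> up G"

definition dnf :: "bdiag \<Rightarrow> nat \<times> nat \<Rightarrow> bool" where
  "dnf G p \<longleftrightarrow> p \<in> halves (lam G) \<and> pos (lam G) p \<in> down G"

lemma bdiag_valid:
  shows "l \<in> set (lam G) \<Longrightarrow> 1 \<le> l"
    and "(a, b) \<in> edges G \<Longrightarrow> a \<in> {1..sum_list (lam G)}"
    and "(a, b) \<in> edges G \<Longrightarrow> b \<in> {1..sum_list (lam G)}"
    and "(a, b) \<in> edges G \<Longrightarrow> (a, b') \<in> edges G \<Longrightarrow> b = b'"
    and "(a, b) \<in> edges G \<Longrightarrow> (a', b) \<in> edges G \<Longrightarrow> a = a'"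
    and "(a, b) \<in> edges G \<Longrightarrow> block (lam G) a < block (lam G) b"
    and "a \<in> up G \<Longrightarrow> a \<in> {1..sum_list (lam G)}"
    and "a \<in> up G \<Longrightarrow> (a, b) \<notin> edges G"
    and "b \<in> down G \<Longrightarrow> b \<in> {1..sum_list (lam G)}"
    and "b \<in> down G \<Longrightarrow> (a, b) \<notin> edges G"
  using Rep_bdiag[of G]
  by (auto simp: valid_bdiag_def Let_def lam.rep_eq edges.rep_eq up.rep_eq down.rep_eq
    inj_on_fst_iff inj_on_snd_iff simp del: atLeastAtMost_iff) (metis image_eqI fst_conv snd_conv DiffE subsetD)+

lemma edg_D: "edg G p q \<Longrightarrow> p \<in> halves (lam G)" "edg G p q \<Longrightarrow> q \<in> halves (lam G)"
  "edg G p q \<Longrightarrow> fst p < fst q"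
  using bdiag_valid(6)[of "pos (lam G) p" "pos (lam G) q" G] by (auto simp: edg_def block_pos)

lemma bdiag_eq_iff:
  "G = G' \<longleftrightarrow> lam G = lam G' \<and> edges G = edges G' \<and> up G = up G' \<and> down G = down G'"
  by (metis Rep_bdiag_inject down.rep_eq edges.rep_eq lam.rep_eq pre_bdiag.expand up.rep_eq)

lemma bdiag_eqI:
  assumes lam: "lam G = lam G'" and e: "\<And>p q. edg G p q = edg G' p q"
    and u: "\<And>p. upf G p = upf G' p" and d: "\<And>p. dnf G p = dnf G' p"
  shows "G = G'"
proof -
  have 1: "edges G \<subseteq> edges G'" if "lam G = lam G'" "\<And>p q. edg G p q \<Longrightarrow> edg G' p q" for G G'
  proof clarify
    fix a b assume ab: "(a, b) \<in> edges G"
    obtain p where p: "p \<in> halves (lam G)" "a = pos (lam G) p"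
      using bdiag_valid(2)[OF ab] by (rule pos_cases)
    obtain q where q: "q \<in> halves (lam G)" "b = pos (lam G) q"
      using bdiag_valid(3)[OF ab] by (rule pos_cases)
    have "edg G' p q" using ab p q that(2)[of p q] by (simp add: edg_def)
    then show "(a, b) \<in> edges G'" using p q that(1) by (simp add: edg_def)
  qed
  have 2: "up G \<subseteq> up G'" if "lam G = lam G'" "\<And>p. upf G p \<Longrightarrow> upf G' p" for G G'
  proof
    fix a assume a: "a \<in> up G"
    obtain p where p: "p \<in> halves (lam G)" "a = pos (lam G) p"
      using bdiag_valid(7)[OF a] by (rule pos_cases)
    have "upf G' p" using a p that(2)[of p] by (simp add: upf_def)
    then show "a \<in> up G'" using p that(1) by (simp add: upf_def)
  qed
  have 3: "down G \<subseteq> down G'" if "lam G = lam G'" "\<And>p. dnf G p \<Longrightarrow> dnf G' p" for G G'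
  proof
    fix a assume a: "a \<in> down G"
    obtain p where p: "p \<in> halves (lam G)" "a = pos (lam G) p"
      using bdiag_valid(9)[OF a] by (rule pos_cases)
    have "dnf G' p" using a p that(2)[of p] by (simp add: dnf_def)
    then show "a \<in> down G'" using p that(1) by (simp add: dnf_def)
  qed
  show ?thesis
    unfolding bdiag_eq_iff using lam e u d by (intro conjI equalityI 1 2 3) simp_all
qed


section \<open>Restriction of B-diagrams\<close>

text \<open>As \<open>sub_bdiag G I\<close> is meaningful only for isolated \<open>I\<close>, the edges between \<open>I\<close> and its complement
  are first opened into free half-edges.\<close>

lift_definition cut :: "bdiag \<Rightarrow> nat set \<Rightarrow> bdiag" is
  "\<lambda>G I. Pre_bdiag (pre_lam G)
     {(a, b) \<in> pre_edges G. block (pre_lam G) a \<in> I \<longleftrightarrow> block (pre_lam G) b \<in> I}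
     (pre_up G \<union> {a. \<exists>b. (a, b) \<in> pre_edges G \<and> (block (pre_lam G) a \<in> I \<longleftrightarrow> block (pre_lam G) b \<notin> I)})
     (pre_down G \<union> {b. \<exists>a. (a, b) \<in> pre_edges G \<and> (block (pre_lam G) a \<in> I \<longleftrightarrow> block (pre_lam G) b \<notin> I)})"
proof -
  fix G and I :: "nat set" assume "valid_bdiag G"
  then have V: "\<forall>l\<in>set (pre_lam G). 1 \<le> l"
    "pre_edges G \<subseteq> {1..sum_list (pre_lam G)} \<times> {1..sum_list (pre_lam G)}"
    "inj_on fst (pre_edges G)" "inj_on snd (pre_edges G)"
    "\<forall>(a, b)\<in>pre_edges G. block (pre_lam G) a < block (pre_lam G) b"
    "pre_up G \<subseteq> {1..sum_list (pre_lam G)} - fst ` pre_edges G"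
    "pre_down G \<subseteq> {1..sum_list (pre_lam G)} - snd ` pre_edges G"
    unfolding valid_bdiag_def Let_def by blast+
  let ?E = "{(a, b) \<in> pre_edges G. block (pre_lam G) a \<in> I \<longleftrightarrow> block (pre_lam G) b \<in> I}"
  let ?U = "{a. \<exists>b. (a, b) \<in> pre_edges G \<and> (block (pre_lam G) a \<in> I \<longleftrightarrow> block (pre_lam G) b \<notin> I)}"
  let ?D = "{b. \<exists>a. (a, b) \<in> pre_edges G \<and> (block (pre_lam G) a \<in> I \<longleftrightarrow> block (pre_lam G) b \<notin> I)}"
  have E: "?E \<subseteq> pre_edges G" by blast
  have "?U \<subseteq> {1..sum_list (pre_lam G)} - fst ` ?E"
  proof
    fix x assume "x \<in> ?U"
    then obtain y where y: "(x, y) \<in> pre_edges G"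
      "block (pre_lam G) x \<in> I \<longleftrightarrow> block (pre_lam G) y \<notin> I" by blast
    have "x \<notin> fst ` ?E"
    proof
      assume "x \<in> fst ` ?E"
      then obtain z where z: "(x, z) \<in> pre_edges G"
        "block (pre_lam G) x \<in> I \<longleftrightarrow> block (pre_lam G) z \<in> I" by auto
      have "y = z" using V(3) y(1) z(1) unfolding inj_on_fst_iff by blast
      then show False using y(2) z(2) by blast
    qed
    with y(1) V(2) show "x \<in> {1..sum_list (pre_lam G)} - fst ` ?E" by blast
  qed
  moreover have "?D \<subseteq> {1..sum_list (pre_lam G)} - snd ` ?E"
  proof
    fix x assume "x \<in> ?D"
    then obtain y where y: "(y, x) \<in> pre_edges G"
      "block (pre_lam G) x \<in> I \<longleftrightarrow> block (pre_lam G) y \<notin> I" by blast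
    have "x \<notin> snd ` ?E"
    proof
      assume "x \<in> snd ` ?E"
      then obtain z where z: "(z, x) \<in> pre_edges G"
        "block (pre_lam G) x \<in> I \<longleftrightarrow> block (pre_lam G) z \<in> I" by auto
      have "y = z" using V(4) y(1) z(1) unfolding inj_on_snd_iff by blast
      then show False using y(2) z(2) by blast
    qed
    with y(1) V(2) show "x \<in> {1..sum_list (pre_lam G)} - snd ` ?E" by blast
  qed
  ultimately show "valid_bdiag (Pre_bdiag (pre_lam G) ?E (pre_up G \<union> ?U) (pre_down G \<union> ?D))"
    using V E inj_on_subset[OF V(3) E] inj_on_subset[OF V(4) E]
    unfolding valid_bdiag_def Let_def pre_bdiag.sel by blast
qed

definition restr :: "bdiag \<Rightarrow> nat set \<Rightarrow> bdiag" where
  "restr G I = sub_bdiag (cut G I) I"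

definition rank_half :: "nat set \<Rightarrow> nat \<times> nat \<Rightarrow> nat \<times> nat" where
  "rank_half I p = (rank_in I (fst p), snd p)"

section \<open>Vertices and half-edges renumbered by rank\<close>

lemma length_nths_Suc: "I \<subseteq> {1..length ls} \<Longrightarrow> length (nths ls {i. Suc i \<in> I}) = card I"
proof -
  assume I: "I \<subseteq> {1..length ls}"
  have "Suc ` {i. i < length ls \<and> Suc i \<in> I} = I"
  proof (intro equalityI subsetI)
    fix i assume "i \<in> I"
    then show "i \<in> Suc ` {i. i < length ls \<and> Suc i \<in> I}"
      using I by (cases i) auto
  qed auto
  then show ?thesis
    using card_image[of Suc "{i. i < length ls \<and> Suc i \<in> I}"] by (simp add: length_nths)
qed

text \<open>Vertices count from 1 and list entries from 0, hence the shifts. As 0 is not in I,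
  \<open>rank_in I i\<close> is the number of entries kept up to vertex i.\<close>

lemma nth_nths_Suc:
  assumes "i \<in> I" "0 \<notin> I" "i \<le> length ls"
  shows "nths ls {i. Suc i \<in> I} ! (rank_in I i - 1) = ls ! (i - 1)"
  using assms(1,3)
proof (induction ls rule: rev_induct)
  case Nil
  then show ?case using assms(2) by simp
next
  case (snoc x ls)
  let ?A = "{i. Suc i \<in> I}"
  let ?I = "I \<inter> {1..length ls}"
  have len: "length (nths ls ?A) = card ?I"
  proof -
    have "nths ls ?A = nths ls {i. Suc i \<in> ?I}"
      unfolding nths_def by (intro arg_cong[where f = "map fst"] filter_cong) (auto simp: set_zip)
    then show ?thesis using length_nths_Suc[of ?I ls] by simp
  qed
  have i: "0 < i" using snoc.prems(1) assms(2) by (cases i) auto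
  show ?case
  proof (cases "i \<le> length ls")
    case True
    have "{h \<in> I. h \<le> i} \<subseteq> ?I"
    proof
      fix h assume "h \<in> {h \<in> I. h \<le> i}"
      then show "h \<in> ?I" using True assms(2) by (cases h) auto
    qed
    then have "rank_in I i \<le> card ?I" unfolding rank_in_def by (intro card_mono) auto
    moreover have "0 < rank_in I i"
      using snoc.prems(1) by (auto simp: rank_in_def card_gt_0_iff)
    ultimately have "rank_in I i - 1 < length (nths ls ?A)" by (simp add: len)
    moreover have "i - 1 < length ls" using True i by linarith
    ultimately show ?thesis
      using snoc.IH[OF snoc.prems(1) True] by (simp add: nths_append nth_append)
  next
    case False
    then have i': "i = Suc (length ls)" using snoc.prems(2) by simp
    have "{h \<in> I. h \<le> i} = insert i ?I"
      using snoc.prems(1) assms(2) i' by (auto simp: Suc_le_eq le_Suc_eq intro: gr0I)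
    then have "rank_in I i = Suc (card ?I)"
      by (simp add: rank_in_def i')
    then show ?thesis
      using snoc.prems(1) i' by (simp add: nths_append nth_append len nths_singleton)
  qed
qed

context
  fixes ls :: "nat list" and I :: "nat set"
  assumes I: "I \<subseteq> {1..length ls}"
begin

lemma nth_restr: "i \<in> I \<Longrightarrow> nths ls {i. Suc i \<in> I} ! (rank_in I i - 1) = ls ! (i - 1)"
  using I by (intro nth_nths_Suc) auto

lemma finite_I: "finite I"
  using I finite_subset by blast

lemma rank_in_I: "i \<in> I \<Longrightarrow> rank_in I i \<in> {1..card I}"
  using rank_in_image[OF finite_I] by blast

lemma rank_half_halves: "fst p \<in> I \<Longrightarrow> rank_half I p \<in> halves (nths ls {i. Suc i \<in> I}) \<longleftrightarrow> p \<in> halves ls"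
  using nth_restr[of "fst p"] rank_in_I[of "fst p"] I
  by (auto simp: halves_def rank_half_def length_nths_Suc split_beta)

lemma rank_half_image:
  "rank_half I ` {p \<in> halves ls. fst p \<in> I} = halves (nths ls {i. Suc i \<in> I})"
proof (intro equalityI subsetI)
  fix q assume q: "q \<in> halves (nths ls {i. Suc i \<in> I})"
  then have "fst q \<in> rank_in I ` I"
    by (auto simp: halves_def length_nths_Suc[OF I] rank_in_image[OF finite_I])
  then obtain i where i: "i \<in> I" "fst q = rank_in I i" by blast
  then have "rank_half I (i, snd q) = q" by (simp add: rank_half_def prod_eq_iff)
  then show "q \<in> rank_half I ` {p \<in> halves ls. fst p \<in> I}"
    using rank_half_halves[of "(i, snd q)"] i q by force
qed (use rank_half_halves in auto)

text \<open>\<open>sub_bdiag\<close> renumbers absolute positions by rank; on half-edges this only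
  replaces the vertex by its rank. The latter map is increasing and onto, so
  \<open>rank_in_eqI\<close> identifies the two.\<close>

lemma rank_in_pos:
  assumes "p \<in> halves ls" "fst p \<in> I"
  shows "rank_in {a \<in> {1..sum_list ls}. block ls a \<in> I} (pos ls p) =
    pos (nths ls {i. Suc i \<in> I}) (rank_half I p)"
proof -
  let ?H = "{a \<in> {1..sum_list ls}. block ls a \<in> I}"
  let ?ls' = "nths ls {i. Suc i \<in> I}"
  let ?P = "{p \<in> halves ls. fst p \<in> I}"
  define u where "u = inv_into (halves ls) (pos ls)"
  have u: "u (pos ls q) = q" if "q \<in> halves ls" for q
    unfolding u_def using bij_betw_pos[of ls] that by (simp add: bij_betw_def)
  have H: "?H = pos ls ` ?P"
  proof (intro equalityI subsetI)
    fix a assume a: "a \<in> ?H"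
    then obtain q where "q \<in> halves ls" "a = pos ls q" using pos_cases[of a ls] by blast
    then show "a \<in> pos ls ` ?P" using a block_pos[of q ls] by auto
  next
    fix a assume "a \<in> pos ls ` ?P"
    then obtain q where "q \<in> halves ls" "fst q \<in> I" "a = pos ls q" by blast
    then show "a \<in> ?H" using block_pos[of q ls] pos_range[of q ls] by simp
  qed
  have "rank_in ?H (pos ls p) = (\<lambda>a. pos ?ls' (rank_half I (u a))) (pos ls p)"
  proof (rule rank_in_eqI)
    show "pos ls p \<in> ?H" unfolding H using assms by blast
    have "(\<lambda>a. pos ?ls' (rank_half I (u a))) ` ?H = pos ?ls' ` rank_half I ` ?P"
      unfolding H image_image by (rule image_cong[OF refl]) (simp add: u)
    also have "\<dots> = {1..sum_list ?ls'}"
      using bij_betw_pos[of ?ls'] by (simp add: rank_half_image bij_betw_def)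
    finally show "(\<lambda>a. pos ?ls' (rank_half I (u a))) ` ?H = {1..sum_list ?ls'}" .
    fix a b assume ab: "a \<in> ?H" "b \<in> ?H" "a < b"
    then obtain p q where pq: "a = pos ls p" "b = pos ls q" "p \<in> ?P" "q \<in> ?P"
      unfolding H by blast
    then have "fst p < fst q \<or> fst p = fst q \<and> snd p < snd q"
      using ab(3) pos_less_iff[of p ls q] by simp
    then show "pos ?ls' (rank_half I (u a)) < pos ?ls' (rank_half I (u b))"
      using pq rank_half_halves rank_in_less_iff[OF finite_I, of "fst p" "fst q"]
      by (intro pos_less) (auto simp: u rank_half_def)
  qed simp
  then show ?thesis using assms by (simp add: u)
qed

end

section \<open>Edges and free half-edges of a restriction\<close>

lemma lam_cut [simp]: "lam (cut G I) = lam G"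
  by transfer simp

lemma edges_cut: "edges (cut G I) = {(a, b) \<in> edges G. block (lam G) a \<in> I \<longleftrightarrow> block (lam G) b \<in> I}"
  by transfer simp

lemma up_cut: "up (cut G I) =
    up G \<union> {a. \<exists>b. (a, b) \<in> edges G \<and> (block (lam G) a \<in> I \<longleftrightarrow> block (lam G) b \<notin> I)}"
  by transfer simp

lemma down_cut: "down (cut G I) =
    down G \<union> {b. \<exists>a. (a, b) \<in> edges G \<and> (block (lam G) a \<in> I \<longleftrightarrow> block (lam G) b \<notin> I)}"
  by transfer simp

lemma edg_cut: "edg (cut G I) p q \<longleftrightarrow> edg G p q \<and> (fst p \<in> I \<longleftrightarrow> fst q \<in> I)"
  by (auto simp: edg_def edges_cut block_pos)

lemma ex_edge_up:
  "p \<in> halves (lam G) \<Longrightarrow>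
    (\<exists>b. (pos (lam G) p, b) \<in> edges G \<and> P (block (lam G) b)) \<longleftrightarrow> (\<exists>q. edg G p q \<and> P (fst q))"
  by (metis bdiag_valid(3) block_pos edg_def pos_cases)

lemma ex_edge_down:
  "q \<in> halves (lam G) \<Longrightarrow>
    (\<exists>a. (a, pos (lam G) q) \<in> edges G \<and> P (block (lam G) a)) \<longleftrightarrow> (\<exists>p. edg G p q \<and> P (fst p))"
  by (metis bdiag_valid(2) block_pos edg_def pos_cases)

lemma upf_cut:
  "upf (cut G I) p \<longleftrightarrow> upf G p \<or> (\<exists>q. edg G p q \<and> (fst p \<in> I \<longleftrightarrow> fst q \<notin> I))"
proof (cases "p \<in> halves (lam G)")
  case True
  then show ?thesis
    using ex_edge_up[OF True, of "\<lambda>i. fst p \<in> I \<longleftrightarrow> i \<notin> I"] by (auto simp: upf_def up_cut block_pos)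
qed (auto simp: upf_def edg_def)

lemma dnf_cut:
  "dnf (cut G I) q \<longleftrightarrow> dnf G q \<or> (\<exists>p. edg G p q \<and> (fst p \<in> I \<longleftrightarrow> fst q \<notin> I))"
proof (cases "q \<in> halves (lam G)")
  case True
  then show ?thesis
    using ex_edge_down[OF True, of "\<lambda>i. i \<in> I \<longleftrightarrow> fst q \<notin> I"] by (auto simp: dnf_def down_cut block_pos)
qed (auto simp: dnf_def edg_def)

lemma lam_sub: "lam (sub_bdiag G I) = nths (lam G) {i. Suc i \<in> I}"
  by transfer (simp add: sub_pre_def Let_def)

lemma sub_image:
  fixes G I
  defines "H \<equiv> {a \<in> {1..sum_list (lam G)}. block (lam G) a \<in> I}"
  shows "edges (sub_bdiag G I) = (\<lambda>(a, b). (rank_in H a, rank_in H b)) ` (edges G \<inter> H \<times> H)"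
    and "up (sub_bdiag G I) = rank_in H ` (up G \<inter> H)"
    and "down (sub_bdiag G I) = rank_in H ` (down G \<inter> H)"
  unfolding H_def by (transfer, simp add: sub_pre_def Let_def)+

lemma inj_on_pair_image_iff:
  assumes "inj_on f H" "a \<in> H" "b \<in> H"
  shows "(f a, f b) \<in> (\<lambda>(a, b). (f a, f b)) ` (E \<inter> H \<times> H) \<longleftrightarrow> (a, b) \<in> E"
proof
  assume "(f a, f b) \<in> (\<lambda>(a, b). (f a, f b)) ` (E \<inter> H \<times> H)"
  then obtain c d where "f a = f c" "f b = f d" "(c, d) \<in> E" "c \<in> H" "d \<in> H" by auto
  then show "(a, b) \<in> E" using assms by (simp add: inj_on_eq_iff)
next
  assume "(a, b) \<in> E"
  then show "(f a, f b) \<in> (\<lambda>(a, b). (f a, f b)) ` (E \<inter> H \<times> H)"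
    using assms by (intro image_eqI[of _ _ "(a, b)"]) simp_all
qed

lemma inj_on_image_Int_iff: "inj_on f H \<Longrightarrow> a \<in> H \<Longrightarrow> f a \<in> f ` (U \<inter> H) \<longleftrightarrow> a \<in> U"
  by (subst inj_on_image_mem_iff) auto

context
  fixes G :: bdiag and I :: "nat set"
  assumes I: "I \<subseteq> {1..vertices G}"
begin

lemma I_lam: "I \<subseteq> {1..length (lam G)}"
  using I by (simp add: vertices_def)

lemma rank_pos:
  fixes p
  defines "H \<equiv> {a \<in> {1..sum_list (lam G)}. block (lam G) a \<in> I}"
  assumes "p \<in> halves (lam G)" "fst p \<in> I"
  shows "pos (lam (sub_bdiag G I)) (rank_half I p) = rank_in H (pos (lam G) p)"
    and "pos (lam G) p \<in> H"
  using rank_in_pos[OF I_lam assms(2,3)] pos_range[OF assms(2)] block_pos[OF assms(2)] assms(3)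
  by (simp_all add: lam_sub H_def)

lemma edg_sub:
  assumes "fst p \<in> I" "fst q \<in> I"
  shows "edg (sub_bdiag G I) (rank_half I p) (rank_half I q) \<longleftrightarrow> edg G p q"
proof (cases "p \<in> halves (lam G) \<and> q \<in> halves (lam G)")
  case True
  define H where "H = {a \<in> {1..sum_list (lam G)}. block (lam G) a \<in> I}"
  have inj: "inj_on (rank_in H) H" by (rule inj_on_rank_in) (simp add: H_def)
  note rp = rank_pos[of p, folded H_def] and rq = rank_pos[of q, folded H_def]
  have "edg (sub_bdiag G I) (rank_half I p) (rank_half I q) \<longleftrightarrow>
      (rank_in H (pos (lam G) p), rank_in H (pos (lam G) q)) \<in> edges (sub_bdiag G I)"
    using True assms rp rq by (simp add: edg_def lam_sub rank_half_halves[OF I_lam])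
  also have "\<dots> \<longleftrightarrow> (pos (lam G) p, pos (lam G) q) \<in> edges G"
    unfolding sub_image H_def[symmetric]
    by (rule inj_on_pair_image_iff[OF inj]) (use True assms rp(2) rq(2) in auto)
  finally show ?thesis using True by (simp add: edg_def)
next
  case False
  then show ?thesis using assms by (auto simp: edg_def lam_sub rank_half_halves[OF I_lam])
qed

lemma upf_sub:
  assumes "fst p \<in> I"
  shows "upf (sub_bdiag G I) (rank_half I p) \<longleftrightarrow> upf G p"
proof (cases "p \<in> halves (lam G)")
  case True
  define H where "H = {a \<in> {1..sum_list (lam G)}. block (lam G) a \<in> I}"
  have inj: "inj_on (rank_in H) H" by (rule inj_on_rank_in) (simp add: H_def)
  note rp = rank_pos[of p, folded H_def]
  show ?thesis
    using True assms rp inj_on_image_Int_iff[OF inj rp(2)] rank_half_halves[OF I_lam, of p, folded lam_sub]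
    by (simp add: upf_def sub_image(2)[of G I, folded H_def])
next
  case False
  then show ?thesis using assms by (auto simp: upf_def lam_sub rank_half_halves[OF I_lam])
qed

lemma dnf_sub:
  assumes "fst p \<in> I"
  shows "dnf (sub_bdiag G I) (rank_half I p) \<longleftrightarrow> dnf G p"
proof (cases "p \<in> halves (lam G)")
  case True
  define H where "H = {a \<in> {1..sum_list (lam G)}. block (lam G) a \<in> I}"
  have inj: "inj_on (rank_in H) H" by (rule inj_on_rank_in) (simp add: H_def)
  note rp = rank_pos[of p, folded H_def]
  show ?thesis
    using True assms rp inj_on_image_Int_iff[OF inj rp(2)] rank_half_halves[OF I_lam, of p, folded lam_sub]
    by (simp add: dnf_def sub_image(3)[of G I, folded H_def])
next
  case False
  then show ?thesis using assms by (auto simp: dnf_def lam_sub rank_half_halves[OF I_lam])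
qed

end

lemma vertices_cut [simp]: "vertices (cut G I) = vertices G"
  by (simp add: vertices_def)

lemma lam_restr: "lam (restr G I) = nths (lam G) {i. Suc i \<in> I}"
  by (simp add: restr_def lam_sub)

context
  fixes G :: bdiag and I :: "nat set"
  assumes I: "I \<subseteq> {1..vertices G}"
begin

lemma vertices_restr: "vertices (restr G I) = card I"
  using length_nths_Suc[of I "lam G"] I by (simp add: vertices_def lam_restr)

lemma nth_lam_restr: "i \<in> I \<Longrightarrow> lam (restr G I) ! (rank_in I i - 1) = lam G ! (i - 1)"
  using nth_restr[OF I_lam[OF I]] by (simp add: lam_restr)

lemma edg_restr:
  "fst p \<in> I \<Longrightarrow> fst q \<in> I \<Longrightarrow> edg (restr G I) (rank_half I p) (rank_half I q) \<longleftrightarrow> edg G p q"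
  using edg_sub[of I "cut G I" p q] I by (simp add: restr_def edg_cut)

lemma upf_restr:
  "fst p \<in> I \<Longrightarrow> upf (restr G I) (rank_half I p) \<longleftrightarrow> upf G p \<or> (\<exists>q. edg G p q \<and> fst q \<notin> I)"
  using upf_sub[of I "cut G I" p] I by (simp add: restr_def upf_cut)

lemma dnf_restr:
  "fst q \<in> I \<Longrightarrow> dnf (restr G I) (rank_half I q) \<longleftrightarrow> dnf G q \<or> (\<exists>p. edg G p q \<and> fst p \<notin> I)"
  using dnf_sub[of I "cut G I" q] I by (auto simp: restr_def dnf_cut)

lemma halves_restr_cases:
  assumes "q \<in> halves (lam (restr G I))"
  obtains p where "p \<in> halves (lam G)" "fst p \<in> I" "q = rank_half I p"
  using assms rank_half_image[OF I_lam[OF I]] by (force simp: lam_restr)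

text \<open>Every half-edge of the restriction has the form \<open>rank_half I p\<close> with p at a
  vertex of I, so it is enough to compare the two diagrams at these.\<close>

lemma restr_eqI:
  assumes n: "vertices G' = card I"
    and l: "\<And>i. i \<in> I \<Longrightarrow> lam G' ! (rank_in I i - 1) = lam G ! (i - 1)"
    and e: "\<And>p q. fst p \<in> I \<Longrightarrow> fst q \<in> I \<Longrightarrow> edg G' (rank_half I p) (rank_half I q) \<longleftrightarrow> edg G p q"
    and u: "\<And>p. fst p \<in> I \<Longrightarrow> upf G' (rank_half I p) \<longleftrightarrow> upf G p \<or> (\<exists>q. edg G p q \<and> fst q \<notin> I)"
    and d: "\<And>q. fst q \<in> I \<Longrightarrow> dnf G' (rank_half I q) \<longleftrightarrow> dnf G q \<or> (\<exists>p. edg G p q \<and> fst p \<notin> I)"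
  shows "restr G I = G'"
proof (rule bdiag_eqI)
  have fin: "finite I" using I finite_subset by blast
  show lam: "lam (restr G I) = lam G'"
  proof (rule nth_equalityI)
    show "length (lam (restr G I)) = length (lam G')"
      using vertices_restr n by (simp add: vertices_def)
    fix k assume "k < length (lam (restr G I))"
    then have "Suc k \<in> rank_in I ` I"
      using vertices_restr by (simp add: rank_in_image[OF fin] vertices_def)
    then obtain i where "i \<in> I" "Suc k = rank_in I i" by blast
    then show "lam (restr G I) ! k = lam G' ! k"
      using nth_lam_restr[of i] l[of i] by (metis diff_Suc_1)
  qed
  show "edg (restr G I) p q = edg G' p q" for p q
  proof (cases "p \<in> halves (lam (restr G I)) \<and> q \<in> halves (lam (restr G I))")
    case True
    then obtain p' q' where "fst p' \<in> I" "p = rank_half I p'" "fst q' \<in> I" "q = rank_half I q'"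
      using halves_restr_cases by metis
    then show ?thesis using e edg_restr by simp
  qed (auto simp: edg_def lam)
  show "upf (restr G I) p = upf G' p" for p
  proof (cases "p \<in> halves (lam (restr G I))")
    case True
    then obtain p' where "fst p' \<in> I" "p = rank_half I p'"
      using halves_restr_cases by metis
    then show ?thesis using u upf_restr by simp
  qed (auto simp: upf_def lam)
  show "dnf (restr G I) p = dnf G' p" for p
  proof (cases "p \<in> halves (lam (restr G I))")
    case True
    then obtain p' where "fst p' \<in> I" "p = rank_half I p'"
      using halves_restr_cases by metis
    then show ?thesis using d dnf_restr by simp
  qed (auto simp: dnf_def lam)
qed

end

section \<open>Laws of restriction and uniqueness of gluing\<close>

lemma edg_vertices: "edg G p q \<Longrightarrow> fst p \<in> {1..vertices G}" "edg G p q \<Longrightarrow> fst q \<in> {1..vertices G}"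
  by (auto simp: edg_def halves_def vertices_def)

lemma upf_vertices: "upf G p \<Longrightarrow> fst p \<in> {1..vertices G}"
  by (auto simp: upf_def halves_def vertices_def)

lemma dnf_vertices: "dnf G p \<Longrightarrow> fst p \<in> {1..vertices G}"
  by (auto simp: dnf_def halves_def vertices_def)

lemma restr_all_vertices: "restr G {1..vertices G} = G"
proof (rule restr_eqI)
  have r: "rank_half {1..vertices G} p = p" if "fst p \<in> {1..vertices G}" for p
    using rank_in_initial[OF that] by (simp add: rank_half_def prod_eq_iff)
  show "edg G (rank_half {1..vertices G} p) (rank_half {1..vertices G} q) = edg G p q"
    if "fst p \<in> {1..vertices G}" "fst q \<in> {1..vertices G}" for p q
    using that by (simp only: r)
  show "upf G (rank_half {1..vertices G} p) = (upf G p \<or> (\<exists>q. edg G p q \<and> fst q \<notin> {1..vertices G}))"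
    if "fst p \<in> {1..vertices G}" for p
    using edg_vertices r[OF that] by metis
  show "dnf G (rank_half {1..vertices G} q) = (dnf G q \<or> (\<exists>p. edg G p q \<and> fst p \<notin> {1..vertices G}))"
    if "fst q \<in> {1..vertices G}" for q
    using edg_vertices r[OF that] by metis
qed (simp_all add: rank_in_initial del: One_nat_def)

text \<open>An edge leaving K either leaves I, and is opened by the first restriction, or stays in
  I, and is opened by the second; either way its end in K becomes free.\<close>

lemma restr_restr_bdiag:
  assumes K: "K \<subseteq> I" and I: "I \<subseteq> {1..vertices G}"
  shows "restr (restr G I) (rank_in I ` K) = restr G K"
proof -
  have fin: "finite I" using I finite_subset by blast
  have inj: "inj_on (rank_in I) I" by (rule inj_on_rank_in[OF fin])
  let ?K = "rank_in I ` K"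
  have K': "?K \<subseteq> {1..vertices (restr G I)}"
    using image_mono[OF K, of "rank_in I"] by (simp add: vertices_restr[OF I] rank_in_image[OF fin])
  have KV: "K \<subseteq> {1..vertices G}" using K I by blast
  have mem: "rank_in I i \<in> ?K \<longleftrightarrow> i \<in> K" if "i \<in> I" for i
    using that K by (simp add: inj_on_image_mem_iff[OF inj])
  have rr: "rank_half K p = rank_half ?K (rank_half I p)" if "fst p \<in> K" for p
    using rank_in_rank_in[OF fin K that] by (simp add: rank_half_def)
  have "restr G K = restr (restr G I) ?K"
  proof (rule restr_eqI[OF KV])
    show "vertices (restr (restr G I) ?K) = card K"
      using card_image[OF inj_on_subset[OF inj K]] by (simp add: vertices_restr[OF K'])
    show "lam (restr (restr G I) ?K) ! (rank_in K i - 1) = lam G ! (i - 1)" if i: "i \<in> K" for i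
    proof -
      have "lam (restr (restr G I) ?K) ! (rank_in ?K (rank_in I i) - 1) = lam (restr G I) ! (rank_in I i - 1)"
        by (rule nth_lam_restr[OF K']) (use i in blast)
      also have "\<dots> = lam G ! (i - 1)"
        by (rule nth_lam_restr[OF I]) (use i K in blast)
      finally show ?thesis unfolding rank_in_rank_in[OF fin K i] .
    qed
    show "edg (restr (restr G I) ?K) (rank_half K p) (rank_half K q) = edg G p q"
      if "fst p \<in> K" "fst q \<in> K" for p q
      using that K edg_restr[OF K', of "rank_half I p" "rank_half I q"] edg_restr[OF I, of p q]
      by (auto simp: rr[OF that(1)] rr[OF that(2)]) (auto simp: rank_half_def)
    show "upf (restr (restr G I) ?K) (rank_half K p) = (upf G p \<or> (\<exists>q. edg G p q \<and> fst q \<notin> K))"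
      if p: "fst p \<in> K" for p
    proof -
      have pI: "fst p \<in> I" using p K by blast
      have "upf (restr (restr G I) ?K) (rank_half K p) \<longleftrightarrow>
          upf (restr G I) (rank_half I p) \<or> (\<exists>q. edg (restr G I) (rank_half I p) q \<and> fst q \<notin> ?K)"
        unfolding rr[OF p] by (rule upf_restr[OF K']) (use p in \<open>auto simp: rank_half_def\<close>)
      also have "(\<exists>q. edg (restr G I) (rank_half I p) q \<and> fst q \<notin> ?K) \<longleftrightarrow>
          (\<exists>q. fst q \<in> I \<and> edg G p q \<and> fst q \<notin> K)"
      proof
        assume "\<exists>q. edg (restr G I) (rank_half I p) q \<and> fst q \<notin> ?K"
        then obtain q where q: "edg (restr G I) (rank_half I p) q" "fst q \<notin> ?K" by blast
        obtain q' where q': "fst q' \<in> I" "q = rank_half I q'"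
          using halves_restr_cases[OF I edg_D(2)[OF q(1)]] by metis
        then show "\<exists>q. fst q \<in> I \<and> edg G p q \<and> fst q \<notin> K"
          using q edg_restr[OF I pI q'(1)] mem[OF q'(1)] by (intro exI[of _ q']) (auto simp: rank_half_def)
      next
        assume "\<exists>q. fst q \<in> I \<and> edg G p q \<and> fst q \<notin> K"
        then obtain q where q: "fst q \<in> I" "edg G p q" "fst q \<notin> K" by blast
        then show "\<exists>q. edg (restr G I) (rank_half I p) q \<and> fst q \<notin> ?K"
          using edg_restr[OF I pI q(1)] mem[OF q(1)] by (intro exI[of _ "rank_half I q"]) (simp add: rank_half_def)
      qed
      finally show ?thesis unfolding upf_restr[OF I pI] using K by blast
    qed
    show "dnf (restr (restr G I) ?K) (rank_half K p) = (dnf G p \<or> (\<exists>q. edg G q p \<and> fst q \<notin> K))"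
      if p: "fst p \<in> K" for p
    proof -
      have pI: "fst p \<in> I" using p K by blast
      have "dnf (restr (restr G I) ?K) (rank_half K p) \<longleftrightarrow>
          dnf (restr G I) (rank_half I p) \<or> (\<exists>q. edg (restr G I) q (rank_half I p) \<and> fst q \<notin> ?K)"
        unfolding rr[OF p] by (rule dnf_restr[OF K']) (use p in \<open>auto simp: rank_half_def\<close>)
      also have "(\<exists>q. edg (restr G I) q (rank_half I p) \<and> fst q \<notin> ?K) \<longleftrightarrow>
          (\<exists>q. fst q \<in> I \<and> edg G q p \<and> fst q \<notin> K)"
      proof
        assume "\<exists>q. edg (restr G I) q (rank_half I p) \<and> fst q \<notin> ?K"
        then obtain q where q: "edg (restr G I) q (rank_half I p)" "fst q \<notin> ?K" by blast
        obtain q' where q': "fst q' \<in> I" "q = rank_half I q'"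
          using halves_restr_cases[OF I edg_D(1)[OF q(1)]] by metis
        then show "\<exists>q. fst q \<in> I \<and> edg G q p \<and> fst q \<notin> K"
          using q edg_restr[OF I q'(1) pI] mem[OF q'(1)] by (intro exI[of _ q']) (auto simp: rank_half_def)
      next
        assume "\<exists>q. fst q \<in> I \<and> edg G q p \<and> fst q \<notin> K"
        then obtain q where q: "fst q \<in> I" "edg G q p" "fst q \<notin> K" by blast
        then show "\<exists>q. edg (restr G I) q (rank_half I p) \<and> fst q \<notin> ?K"
          using edg_restr[OF I q(1) pI] mem[OF q(1)] by (intro exI[of _ "rank_half I q"]) (simp add: rank_half_def)
      qed
      finally show ?thesis unfolding dnf_restr[OF I pI] using K by blast
    qed
  qed
  then show ?thesis by simp
qed

text \<open>Edges ascend, but X and Y may interleave, so both directions have to be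
  excluded.\<close>

definition sep :: "bdiag \<Rightarrow> nat set \<Rightarrow> nat set \<Rightarrow> bool" where
  "sep G X Y \<longleftrightarrow>
     (\<forall>p q. edg G p q \<longrightarrow> \<not> (fst p \<in> X \<and> fst q \<in> Y) \<and> \<not> (fst p \<in> Y \<and> fst q \<in> X))"

lemma sep_restr_bdiag:
  assumes X: "X \<subseteq> I" and Y: "Y \<subseteq> I" and I: "I \<subseteq> {1..vertices G}"
  shows "sep (restr G I) (rank_in I ` X) (rank_in I ` Y) \<longleftrightarrow> sep G X Y"
proof -
  have inj: "inj_on (rank_in I) I" by (rule inj_on_rank_in[OF finite_subset[OF I]]) simp
  have mem: "rank_in I i \<in> rank_in I ` Z \<longleftrightarrow> i \<in> Z" if "i \<in> I" "Z \<subseteq> I" for i Z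
    using that by (simp add: inj_on_image_mem_iff[OF inj])
  show ?thesis
  proof
    assume s: "sep (restr G I) (rank_in I ` X) (rank_in I ` Y)"
    show "sep G X Y"
      unfolding sep_def
    proof (intro allI impI)
      fix p q assume pq: "edg G p q"
      show "\<not> (fst p \<in> X \<and> fst q \<in> Y) \<and> \<not> (fst p \<in> Y \<and> fst q \<in> X)"
      proof (cases "fst p \<in> I \<and> fst q \<in> I")
        case True
        then have "edg (restr G I) (rank_half I p) (rank_half I q)" using pq edg_restr[OF I] by blast
        with s have "\<not> (fst (rank_half I p) \<in> rank_in I ` X \<and> fst (rank_half I q) \<in> rank_in I ` Y) \<and>
            \<not> (fst (rank_half I p) \<in> rank_in I ` Y \<and> fst (rank_half I q) \<in> rank_in I ` X)"
          unfolding sep_def by blast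
        then show ?thesis using True X Y by (simp add: mem rank_half_def)
      qed (use X Y in blast)
    qed
  next
    assume s: "sep G X Y"
    show "sep (restr G I) (rank_in I ` X) (rank_in I ` Y)"
      unfolding sep_def
    proof (intro allI impI)
      fix p' q' assume pq: "edg (restr G I) p' q'"
      obtain p q where p: "fst p \<in> I" "p' = rank_half I p" and q: "fst q \<in> I" "q' = rank_half I q"
        using halves_restr_cases[OF I edg_D(1)[OF pq]] halves_restr_cases[OF I edg_D(2)[OF pq]] by metis
      then have "edg G p q" using pq edg_restr[OF I] by blast
      with s have "\<not> (fst p \<in> X \<and> fst q \<in> Y) \<and> \<not> (fst p \<in> Y \<and> fst q \<in> X)"
        unfolding sep_def by blast
      then show "\<not> (fst p' \<in> rank_in I ` X \<and> fst q' \<in> rank_in I ` Y) \<and>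
          \<not> (fst p' \<in> rank_in I ` Y \<and> fst q' \<in> rank_in I ` X)"
        using mem[OF p(1) X] mem[OF p(1) Y] mem[OF q(1) X] mem[OF q(1) Y]
        by (simp add: p(2) q(2) rank_half_def)
    qed
  qed
qed

lemma upf_no_edge: "upf G p \<Longrightarrow> \<not> edg G p q"
  using bdiag_valid(8) by (auto simp: upf_def edg_def)

lemma dnf_no_edge: "dnf G q \<Longrightarrow> \<not> edg G p q"
  using bdiag_valid(10) by (auto simp: dnf_def edg_def)

text \<open>The two restrictions show all edges inside I and inside its complement. Once the
  crossing edges are known too, the genuine free half-edges are those of the restrictions at which
  no crossing edge ends. It is applied to isolated sets, where nothing crosses, and to initial
  segments.\<close>

lemma bdiag_eq_partsI:
  assumes n: "vertices G = vertices G'" and I: "I \<subseteq> {1..vertices G}"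
    and r: "restr G I = restr G' I" "restr G ({1..vertices G} - I) = restr G' ({1..vertices G} - I)"
    and cross: "\<And>p q. (fst p \<in> I \<longleftrightarrow> fst q \<notin> I) \<Longrightarrow> edg G p q = edg G' p q"
  shows "G = G'"
proof -
  let ?V = "{1..vertices G}"
  let ?J = "?V - I"
  have J: "?J \<subseteq> ?V" by blast
  have I': "I \<subseteq> {1..vertices G'}" and J': "?J \<subseteq> {1..vertices G'}" using I n by auto
  show ?thesis
  proof (rule bdiag_eqI)
    show "lam G = lam G'"
    proof (rule nth_equalityI)
      show "length (lam G) = length (lam G')" using n by (simp add: vertices_def)
      fix k assume "k < length (lam G)"
      then have "Suc k \<in> I \<or> Suc k \<in> ?J" by (auto simp: vertices_def)
      then show "lam G ! k = lam G' ! k"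
        using nth_lam_restr[OF I, of "Suc k"] nth_lam_restr[OF I', of "Suc k"]
          nth_lam_restr[OF J, of "Suc k"] nth_lam_restr[OF J', of "Suc k"] r
        by (auto simp del: One_nat_def)
    qed
    show e: "edg G p q = edg G' p q" for p q
    proof -
      consider "fst p \<in> I \<longleftrightarrow> fst q \<notin> I" | "fst p \<in> I" "fst q \<in> I" | "fst p \<in> ?J" "fst q \<in> ?J"
        | "fst p \<notin> ?V \<or> fst q \<notin> ?V" by blast
      then show ?thesis
      proof cases
        case 2
        then show ?thesis using edg_restr[OF I 2] edg_restr[OF I' 2] r(1) by simp
      next
        case 3
        then show ?thesis using edg_restr[OF J 3] edg_restr[OF J' 3] r(2) by simp
      next
        case 4
        then show ?thesis
          using edg_vertices[of G p q] edg_vertices[of G' p q, folded n] by blast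
      qed (rule cross)
    qed
    show "upf G p = upf G' p" for p
    proof -
      have *: "upf H p \<longleftrightarrow> upf (restr H K) (rank_half K p) \<and> \<not> (\<exists>q. edg H p q \<and> fst q \<notin> K)"
        if "K \<subseteq> {1..vertices H}" "fst p \<in> K" for H K
        using upf_restr[OF that] upf_no_edge[of H p] by blast
      consider "fst p \<in> I" | "fst p \<in> ?J" | "fst p \<notin> ?V" by blast
      then show ?thesis
      proof cases
        case 1
        then show ?thesis using *[OF I 1] *[OF I' 1] r(1) e by simp
      next
        case 2
        then show ?thesis using *[OF J 2] *[OF J' 2] r(2) e by simp
      next
        case 3
        then show ?thesis using upf_vertices[of G p] upf_vertices[of G' p, folded n] by blast
      qed
    qed
    show "dnf G p = dnf G' p" for p
    proof -
      have *: "dnf H p \<longleftrightarrow> dnf (restr H K) (rank_half K p) \<and> \<not> (\<exists>q. edg H q p \<and> fst q \<notin> K)"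
        if "K \<subseteq> {1..vertices H}" "fst p \<in> K" for H K
        using dnf_restr[OF that] dnf_no_edge[of H p] by blast
      consider "fst p \<in> I" | "fst p \<in> ?J" | "fst p \<notin> ?V" by blast
      then show ?thesis
      proof cases
        case 1
        then show ?thesis using *[OF I 1] *[OF I' 1] r(1) e by simp
      next
        case 2
        then show ?thesis using *[OF J 2] *[OF J' 2] r(2) e by simp
      next
        case 3
        then show ?thesis using dnf_vertices[of G p] dnf_vertices[of G' p, folded n] by blast
      qed
    qed
  qed
qed

lemma glue_unique_bdiag:
  assumes n: "vertices G = vertices G'" and I: "I \<subseteq> {1..vertices G}"
    and s: "sep G I ({1..vertices G} - I)" "sep G' I ({1..vertices G} - I)"
    and r: "restr G I = restr G' I" "restr G ({1..vertices G} - I) = restr G' ({1..vertices G} - I)"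
  shows "G = G'"
proof (rule bdiag_eq_partsI[OF n I r])
  have "\<not> edg H p q" if "sep H I ({1..vertices H} - I)" "fst p \<in> I \<longleftrightarrow> fst q \<notin> I" for H p q
    using that edg_vertices[of H p q] unfolding sep_def by blast
  then show "edg G p q = edg G' p q" if "fst p \<in> I \<longleftrightarrow> fst q \<notin> I" for p q
    using s n that by metis
qed

section \<open>Weights and isolated sets\<close>

lemma vertices_eq_0: "vertices G = 0 \<longleftrightarrow> G = empty_bdiag"
proof
  assume "vertices G = 0"
  then have lam: "lam G = []" by (simp add: vertices_def)
  have e: "lam empty_bdiag = []" "edges empty_bdiag = {}" "up empty_bdiag = {}" "down empty_bdiag = {}"
    by (transfer, simp)+
  have "edges G = {}" "up G = {}" "down G = {}"
    using bdiag_valid(2)[of _ _ G] bdiag_valid(7)[of _ G] bdiag_valid(9)[of _ G] lam by fastforce+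
  with lam e show "G = empty_bdiag" by (simp add: bdiag_eq_iff)
next
  assume "G = empty_bdiag"
  moreover have "lam empty_bdiag = []" by transfer simp
  ultimately show "vertices G = 0" by (simp add: vertices_def)
qed

text \<open>Blocks are nonempty, so weight 0 leaves no vertex: the grading is connected.\<close>

lemma weight_eq_0: "weight G = 0 \<longleftrightarrow> G = empty_bdiag"
proof -
  have "weight G = 0 \<longleftrightarrow> lam G = []"
    using bdiag_valid(1)[of "hd (lam G)" G] by (cases "lam G") (auto simp: weight_def)
  then show ?thesis using vertices_eq_0[of G] by (simp add: vertices_def)
qed

lemma weight_restr:
  assumes "I \<subseteq> {1..vertices G}"
  shows "weight (restr G I) + weight (restr G ({1..vertices G} - I)) = weight G"
proof -
  let ?P = "{1..sum_list (lam G)}"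
  let ?H = "\<lambda>I. {h \<in> ?P. block (lam G) h \<in> I}"
  have w: "weight (restr G I) = card (?H I)" for I
    unfolding weight_def lam_restr by (rule card_block_in[symmetric])
  have "?H I \<union> ?H ({1..vertices G} - I) = ?P"
    using block_bounds(1,2)[of _ "lam G"] by (auto simp: vertices_def)
  moreover have "?H I \<inter> ?H ({1..vertices G} - I) = {}" by blast
  ultimately have "card (?H I) + card (?H ({1..vertices G} - I)) = card ?P"
    using card_Un_disjoint[of "?H I" "?H ({1..vertices G} - I)"] by simp
  then show ?thesis unfolding w by (simp only: weight_def card_atLeastAtMost diff_Suc_1)
qed

text \<open>The weight bounds all data: entries of \<open>lam\<close> are at least 1, so there are
  at most k of them, and edges and free half-edges only use positions up to k.\<close>

lemma finite_weight: "finite {G. weight G = k}"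
proof -
  let ?L = "{xs. set xs \<subseteq> {..k} \<and> length xs \<le> k}"
  let ?T = "?L \<times> Pow ({1..k} \<times> {1..k}) \<times> Pow {1..k} \<times> Pow {1..k}"
  let ?f = "\<lambda>G. (lam G, edges G, up G, down G)"
  have "?f ` {G. weight G = k} \<subseteq> ?T"
  proof (rule image_subsetI)
    fix G assume "G \<in> {G. weight G = k}"
    then have k: "k = weight G" by simp
    have "length xs \<le> sum_list xs" if "\<forall>l\<in>set xs. 1 \<le> l" for xs :: "nat list"
      using that by (induction xs) auto
    then have "length (lam G) \<le> k" using bdiag_valid(1)[of _ G] by (auto simp: k weight_def)
    moreover have "set (lam G) \<subseteq> {..k}"
      using member_le_sum_list[of _ "lam G"] by (auto simp: k weight_def)
    ultimately have "lam G \<in> ?L" by simp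
    moreover have "edges G \<subseteq> {1..k} \<times> {1..k}"
      using bdiag_valid(2,3)[of _ _ G] unfolding k weight_def by (auto simp del: atLeastAtMost_iff)
    moreover have "up G \<subseteq> {1..k}" "down G \<subseteq> {1..k}"
      using bdiag_valid(7,9)[of _ G] unfolding k weight_def by blast+
    ultimately show "?f G \<in> ?T" by blast
  qed
  moreover have "finite ?T" using finite_lists_length_le[of "{..k}" k] by simp
  ultimately have "finite (?f ` {G. weight G = k})" by (rule finite_subset)
  moreover have "inj_on ?f {G. weight G = k}"
    by (rule inj_onI) (simp add: bdiag_eq_iff)
  ultimately show ?thesis by (rule finite_imageD)
qed

lemma Iso_iff: "I \<in> Iso G \<longleftrightarrow> I \<subseteq> {1..vertices G} \<and> sep G I ({1..vertices G} - I)"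
proof (cases "I \<subseteq> {1..vertices G}")
  case True
  have "I \<in> Iso G \<longleftrightarrow> (\<forall>p q. edg G p q \<longrightarrow> (fst p \<in> I \<and> fst q \<in> I) \<or>
      (fst p \<in> {1..vertices G} - I \<and> fst q \<in> {1..vertices G} - I))"
  proof
    assume "I \<in> Iso G"
    then show "\<forall>p q. edg G p q \<longrightarrow> (fst p \<in> I \<and> fst q \<in> I) \<or>
      (fst p \<in> {1..vertices G} - I \<and> fst q \<in> {1..vertices G} - I)"
      unfolding Iso_def edg_def using block_pos[of _ "lam G"] by fastforce
  next
    assume *: "\<forall>p q. edg G p q \<longrightarrow> (fst p \<in> I \<and> fst q \<in> I) \<or>
      (fst p \<in> {1..vertices G} - I \<and> fst q \<in> {1..vertices G} - I)"
    have "(block (lam G) a \<in> I \<and> block (lam G) b \<in> I) \<or>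
        (block (lam G) a \<in> {1..vertices G} - I \<and> block (lam G) b \<in> {1..vertices G} - I)"
      if ab: "(a, b) \<in> edges G" for a b
    proof -
      obtain p where p: "p \<in> halves (lam G)" "a = pos (lam G) p"
        using bdiag_valid(2)[OF ab] by (rule pos_cases)
      obtain q where q: "q \<in> halves (lam G)" "b = pos (lam G) q"
        using bdiag_valid(3)[OF ab] by (rule pos_cases)
      have "edg G p q" using ab p q by (simp add: edg_def)
      with * show ?thesis unfolding p(2) q(2) block_pos[OF p(1)] block_pos[OF q(1)] by blast
    qed
    then show "I \<in> Iso G" unfolding Iso_def using True by fast
  qed
  also have "\<dots> \<longleftrightarrow> sep G I ({1..vertices G} - I)"
    unfolding sep_def using edg_vertices[of G] True by blast
  finally show ?thesis using True by simp
qed (simp add: Iso_def)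

text \<open>No edge joins I to its complement, so \<open>cut\<close> opens nothing.\<close>

lemma sub_bdiag_isolated:
  assumes "sep G I ({1..vertices G} - I)"
  shows "sub_bdiag G I = restr G I" "sub_bdiag G ({1..vertices G} - I) = restr G ({1..vertices G} - I)"
proof -
  have "cut G J = G" if "\<And>p q. edg G p q \<Longrightarrow> fst p \<in> J \<longleftrightarrow> fst q \<in> J" for J
    by (rule bdiag_eqI) (use that in \<open>auto simp: edg_cut upf_cut dnf_cut\<close>)
  moreover have "fst p \<in> I \<longleftrightarrow> fst q \<in> I" if "edg G p q" for p q
    using assms that edg_vertices[OF that] unfolding sep_def by blast
  ultimately show "sub_bdiag G I = restr G I" "sub_bdiag G ({1..vertices G} - I) = restr G ({1..vertices G} - I)"
    using edg_vertices[of G] unfolding restr_def by auto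
qed

section \<open>Compositions\<close>

lemma halves_append_left: "p \<in> halves ls \<Longrightarrow> p \<in> halves (ls @ ls')"
  and pos_append_left: "p \<in> halves ls \<Longrightarrow> pos (ls @ ls') p = pos ls p"
  by (auto simp: halves_def pos_def nth_append)

lemma halves_append_initial: "p \<in> halves (ls @ ls') \<Longrightarrow> fst p \<le> length ls \<Longrightarrow> p \<in> halves ls"
  by (auto simp: halves_def nth_append split: if_splits)

definition shift_half :: "nat \<Rightarrow> nat \<times> nat \<Rightarrow> nat \<times> nat" where
  "shift_half n p = (n + fst p, snd p)"

lemma halves_append_right: "shift_half (length ls) p \<in> halves (ls @ ls') \<longleftrightarrow> p \<in> halves ls'"
  if "1 \<le> fst p"
  using that by (cases p) (auto simp: halves_def shift_half_def nth_append)

lemma halves_fst: "p \<in> halves ls \<Longrightarrow> 1 \<le> fst p" "p \<in> halves ls \<Longrightarrow> fst p \<le> length ls"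
  by (auto simp: halves_def)

lemma pos_append_right:
  assumes "p \<in> halves ls'"
  shows "pos (ls @ ls') (shift_half (length ls) p) = pos ls' p + sum_list ls"
proof -
  have "length ls + fst p - Suc 0 - length ls = fst p - Suc 0" by simp
  then show ?thesis using halves_fst[OF assms] by (simp add: pos_def shift_half_def)
qed

lemma halves_append_cases:
  assumes "q \<in> halves (ls @ ls')"
  obtains "q \<in> halves ls" | p where "p \<in> halves ls'" "q = shift_half (length ls) p"
proof (cases "fst q \<le> length ls")
  case True
  then show ?thesis using that(1) halves_append_initial[OF assms] by blast
next
  case False
  then have q: "q = shift_half (length ls) (fst q - length ls, snd q)"
    by (simp add: shift_half_def)
  then have "(fst q - length ls, snd q) \<in> halves ls'"
    using False assms halves_append_right[of "(fst q - length ls, snd q)" ls ls'] by simp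
  with q show ?thesis using that(2) by blast
qed

context
  fixes A B :: bdiag and as bs :: "nat list"
  assumes comp: "composable A B as bs"
begin

definition composite :: bdiag where
  "composite = Abs_bdiag (compose_pre (Rep_bdiag A) (Rep_bdiag B) as bs)"

lemma Rep_composite: "Rep_bdiag composite = compose_pre (Rep_bdiag A) (Rep_bdiag B) as bs"
  unfolding composite_def using valid_compose_pre[OF comp] by (simp add: Abs_bdiag_inverse)

lemma lam_composite: "lam composite = lam A @ lam B"
  by (simp add: lam.rep_eq Rep_composite compose_pre_def Let_def)

lemma composite_sets:
  fixes w
  defines "w \<equiv> sum_list (lam A)"
  shows "edges composite = edges A \<union> (\<lambda>(a, b). (a + w, b + w)) ` edges B \<union>
      (\<lambda>(a, b). (a, b + w)) ` set (zip as bs)"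
    and "up composite = (up A - set as) \<union> (\<lambda>i. i + w) ` up B"
    and "down composite = down A \<union> (\<lambda>i. i + w) ` (down B - set bs)"
  by (simp_all add: w_def edges.rep_eq up.rep_eq down.rep_eq lam.rep_eq Rep_composite compose_pre_def Let_def)

lemma zip_bounds:
  assumes "(a, b) \<in> set (zip as bs)"
  shows "a \<in> up A" "b \<in> down B" "a \<in> {1..sum_list (lam A)}" "b \<in> {1..sum_list (lam B)}"
proof -
  have "a \<in> set as" "b \<in> set bs" using assms set_zip_leftD set_zip_rightD by fast+
  then show "a \<in> up A" "b \<in> down B" using comp unfolding composable_def by blast+
  then show "a \<in> {1..sum_list (lam A)}" "b \<in> {1..sum_list (lam B)}"
    using bdiag_valid(7,9) by blast+
qed

text \<open>Positions of B lie above w after the shift, so the three kinds of edges are told apart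
  by the ranges of their ends.\<close>

lemma composite_mem:
  fixes w
  defines "w \<equiv> sum_list (lam A)"
  shows "a \<in> {1..w} \<Longrightarrow> 1 \<le> b \<Longrightarrow> b \<le> w \<Longrightarrow> (a, b) \<in> edges composite \<longleftrightarrow> (a, b) \<in> edges A"
    and "1 \<le> a \<Longrightarrow> 1 \<le> b \<Longrightarrow> (a + w, b + w) \<in> edges composite \<longleftrightarrow> (a, b) \<in> edges B"
    and "a \<in> {1..w} \<Longrightarrow> 1 \<le> b \<Longrightarrow> (a, b + w) \<in> edges composite \<longleftrightarrow> (a, b) \<in> set (zip as bs)"
    and "a \<in> {1..w} \<Longrightarrow> a \<in> up composite \<longleftrightarrow> a \<in> up A \<and> a \<notin> set as"
    and "1 \<le> b \<Longrightarrow> b + w \<in> up composite \<longleftrightarrow> b \<in> up B"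
    and "a \<in> {1..w} \<Longrightarrow> a \<in> down composite \<longleftrightarrow> a \<in> down A"
    and "1 \<le> b \<Longrightarrow> b + w \<in> down composite \<longleftrightarrow> b \<in> down B \<and> b \<notin> set bs"
proof -
  have A: "1 \<le> x \<and> x \<le> w \<and> 1 \<le> y \<and> y \<le> w" if "(x, y) \<in> edges A" for x y
    using bdiag_valid(2,3)[OF that] by (simp add: w_def)
  have B: "1 \<le> x \<and> 1 \<le> y" if "(x, y) \<in> edges B" for x y
    using bdiag_valid(2,3)[OF that] by simp
  have M: "1 \<le> x \<and> x \<le> w \<and> 1 \<le> y" if "(x, y) \<in> set (zip as bs)" for x y
    using zip_bounds(3,4)[OF that] by (simp add: w_def)
  have U: "x \<in> up A \<Longrightarrow> x \<le> w" "x \<in> down A \<Longrightarrow> x \<le> w" "x \<in> up B \<Longrightarrow> 1 \<le> x" "x \<in> down B \<Longrightarrow> 1 \<le> x" for x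
    using bdiag_valid(7)[of x A] bdiag_valid(9)[of x A] bdiag_valid(7)[of x B] bdiag_valid(9)[of x B]
    by (auto simp: w_def)
  note s = composite_sets[folded w_def]
  show "(a, b) \<in> edges composite \<longleftrightarrow> (a, b) \<in> edges A" if "a \<in> {1..w}" "1 \<le> b" "b \<le> w"
    unfolding s using that by (auto dest: B M)
  show "(a + w, b + w) \<in> edges composite \<longleftrightarrow> (a, b) \<in> edges B" if "1 \<le> a" "1 \<le> b"
    unfolding s using that by (auto dest: A M)
  show "(a, b + w) \<in> edges composite \<longleftrightarrow> (a, b) \<in> set (zip as bs)" if "a \<in> {1..w}" "1 \<le> b"
    unfolding s using that by (auto dest: A B)
  show "a \<in> up composite \<longleftrightarrow> a \<in> up A \<and> a \<notin> set as" "a \<in> down composite \<longleftrightarrow> a \<in> down A"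
    if "a \<in> {1..w}"
    unfolding s using that by (auto dest: U)
  show "b + w \<in> up composite \<longleftrightarrow> b \<in> up B"
    "b + w \<in> down composite \<longleftrightarrow> b \<in> down B \<and> b \<notin> set bs" if "1 \<le> b"
    unfolding s using that by (auto dest: U)
qed

abbreviation sh :: "nat \<times> nat \<Rightarrow> nat \<times> nat" where
  "sh \<equiv> shift_half (length (lam A))"

lemma vertices_composite: "vertices composite = vertices A + vertices B"
  by (simp add: vertices_def lam_composite)

lemma composite_edg:
  shows "p \<in> halves (lam A) \<Longrightarrow> q \<in> halves (lam A) \<Longrightarrow> edg composite p q \<longleftrightarrow> edg A p q"
    and "p \<in> halves (lam B) \<Longrightarrow> q \<in> halves (lam B) \<Longrightarrow> edg composite (sh p) (sh q) \<longleftrightarrow> edg B p q"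
    and "p \<in> halves (lam A) \<Longrightarrow> q \<in> halves (lam B) \<Longrightarrow>
      edg composite p (sh q) \<longleftrightarrow> (pos (lam A) p, pos (lam B) q) \<in> set (zip as bs)"
    and "q \<in> halves (lam A) \<Longrightarrow> p \<in> halves (lam B) \<Longrightarrow> \<not> edg composite (sh p) q"
proof -
  have sh: "sh p \<in> halves (lam A @ lam B)" if "p \<in> halves (lam B)" for p
    using that halves_append_right[OF halves_fst(1)[OF that]] by blast
  have a1: "1 \<le> pos (lam A) p" "pos (lam A) p \<le> sum_list (lam A)" if "p \<in> halves (lam A)" for p
    using pos_range[OF that] by auto
  have b1: "1 \<le> pos (lam B) p" if "p \<in> halves (lam B)" for p
    using pos_range[OF that] by auto
  show "edg composite p q \<longleftrightarrow> edg A p q" if "p \<in> halves (lam A)" "q \<in> halves (lam A)"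
    using that composite_mem(1)[OF pos_range[OF that(1)] a1[OF that(2)]]
    by (simp add: edg_def lam_composite halves_append_left pos_append_left)
  show "edg composite (sh p) (sh q) \<longleftrightarrow> edg B p q" if "p \<in> halves (lam B)" "q \<in> halves (lam B)"
    using that composite_mem(2)[OF b1[OF that(1)] b1[OF that(2)]]
    by (simp add: edg_def lam_composite sh pos_append_right)
  show "edg composite p (sh q) \<longleftrightarrow> (pos (lam A) p, pos (lam B) q) \<in> set (zip as bs)"
    if "p \<in> halves (lam A)" "q \<in> halves (lam B)"
    using that composite_mem(3)[OF pos_range[OF that(1)] b1[OF that(2)]] sh[OF that(2)]
    by (simp add: edg_def lam_composite halves_append_left pos_append_left pos_append_right)
  show "\<not> edg composite (sh p) q" if "q \<in> halves (lam A)" "p \<in> halves (lam B)"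
    using edg_D(3)[of composite "sh p" q] halves_fst(2)[OF that(1)] by (auto simp: shift_half_def)
qed

lemma composite_free:
  shows "p \<in> halves (lam A) \<Longrightarrow> upf composite p \<longleftrightarrow> upf A p \<and> pos (lam A) p \<notin> set as"
    and "p \<in> halves (lam A) \<Longrightarrow> dnf composite p \<longleftrightarrow> dnf A p"
    and "p \<in> halves (lam B) \<Longrightarrow> upf composite (sh p) \<longleftrightarrow> upf B p"
    and "p \<in> halves (lam B) \<Longrightarrow> dnf composite (sh p) \<longleftrightarrow> dnf B p \<and> pos (lam B) p \<notin> set bs"
proof -
  show "upf composite p \<longleftrightarrow> upf A p \<and> pos (lam A) p \<notin> set as" "dnf composite p \<longleftrightarrow> dnf A p"
    if "p \<in> halves (lam A)"
    using that composite_mem(4,6)[OF pos_range[OF that]]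
    by (simp_all add: upf_def dnf_def lam_composite halves_append_left pos_append_left)
  show "upf composite (sh p) \<longleftrightarrow> upf B p"
    "dnf composite (sh p) \<longleftrightarrow> dnf B p \<and> pos (lam B) p \<notin> set bs"
    if p: "p \<in> halves (lam B)"
  proof -
    have "1 \<le> pos (lam B) p" using pos_range[OF p] by simp
    moreover have "sh p \<in> halves (lam A @ lam B)"
      using p halves_append_right[OF halves_fst(1)[OF p]] by blast
    ultimately show "upf composite (sh p) \<longleftrightarrow> upf B p"
      "dnf composite (sh p) \<longleftrightarrow> dnf B p \<and> pos (lam B) p \<notin> set bs"
      using p composite_mem(5,7)[of "pos (lam B) p"]
      by (simp_all add: upf_def dnf_def lam_composite pos_append_right)
  qed
qed

lemma halves_composite_left:
  "fst p \<in> {1..vertices A} \<Longrightarrow> p \<in> halves (lam composite) \<longleftrightarrow> p \<in> halves (lam A)"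
  using halves_append_initial[of p "lam A" "lam B"] halves_append_left[of p "lam A" "lam B"]
  by (auto simp: lam_composite vertices_def)

lemma halves_composite_right:
  "1 \<le> fst p \<Longrightarrow> sh p \<in> halves (lam composite) \<longleftrightarrow> p \<in> halves (lam B)"
  using halves_append_right[of p "lam A" "lam B"] by (simp add: lam_composite)

lemma zip_set: "set as = fst ` set (zip as bs)" "set bs = snd ` set (zip as bs)"
  using comp by (metis composable_def list.set_map map_fst_zip, metis composable_def list.set_map map_snd_zip)

text \<open>Only the edges added by the composition leave the vertices of A; cutting them frees
  exactly the ends \<open>as\<close>, which were free in A.\<close>

lemma restr_composite_left: "restr composite {1..vertices A} = A"
proof (rule restr_eqI)
  let ?L = "{1..vertices A}"
  have r: "rank_half ?L p = p" if "fst p \<in> ?L" for p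
    using rank_in_initial[OF that] by (simp add: rank_half_def)
  note H = halves_composite_left
  show "edg A (rank_half ?L p) (rank_half ?L q) = edg composite p q" if pq: "fst p \<in> ?L" "fst q \<in> ?L" for p q
    using composite_edg(1)[of p q] H[OF pq(1)] H[OF pq(2)] unfolding r[OF pq(1)] r[OF pq(2)]
    by (auto simp: edg_def[of A] edg_def[of composite])
  show "upf A (rank_half ?L p) = (upf composite p \<or> (\<exists>q. edg composite p q \<and> fst q \<notin> ?L))"
    if p: "fst p \<in> ?L" for p
  proof (cases "p \<in> halves (lam A)")
    case True
    have "(\<exists>q. edg composite p q \<and> fst q \<notin> ?L) \<longleftrightarrow> pos (lam A) p \<in> set as"
    proof
      assume "\<exists>q. edg composite p q \<and> fst q \<notin> ?L"
      then obtain q where q: "edg composite p q" "fst q \<notin> ?L" by blast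
      from edg_D(2)[OF q(1)] have "q \<in> halves (lam A @ lam B)" by (simp add: lam_composite)
      then show "pos (lam A) p \<in> set as"
      proof (cases rule: halves_append_cases)
        case 1
        then show ?thesis using q(2) halves_fst[OF 1] by (simp add: vertices_def)
      next
        case (2 q')
        then show ?thesis using q(1) composite_edg(3)[OF True 2(1)] set_zip_leftD by metis
      qed
    next
      assume "pos (lam A) p \<in> set as"
      then obtain b where b: "(pos (lam A) p, b) \<in> set (zip as bs)" using zip_set(1) by auto
      obtain q where q: "q \<in> halves (lam B)" "b = pos (lam B) q"
        using zip_bounds(4)[OF b] by (rule pos_cases)
      have "edg composite p (sh q)" using composite_edg(3)[OF True q(1)] b q(2) by simp
      moreover have "fst (sh q) \<notin> ?L" using halves_fst[OF q(1)] by (simp add: shift_half_def vertices_def)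
      ultimately show "\<exists>q. edg composite p q \<and> fst q \<notin> ?L" by blast
    qed
    moreover have "upf A p" if "pos (lam A) p \<in> set as"
      using comp True that by (auto simp: upf_def composable_def)
    ultimately show ?thesis using composite_free(1)[OF True] r[OF p] by auto
  next
    case False
    then show ?thesis using H[OF p] unfolding r[OF p] by (auto simp: upf_def edg_def)
  qed
  show "dnf A (rank_half ?L q) = (dnf composite q \<or> (\<exists>p. edg composite p q \<and> fst p \<notin> ?L))"
    if q: "fst q \<in> ?L" for q
  proof -
    have "\<not> (\<exists>p. edg composite p q \<and> fst p \<notin> ?L)"
    proof
      assume "\<exists>p. edg composite p q \<and> fst p \<notin> ?L"
      then obtain p where "edg composite p q" "fst p \<notin> ?L" by blast
      then show False using edg_D(3)[of composite p q] edg_vertices(1)[of composite p q] q by auto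
    qed
    moreover have "dnf A q = dnf composite q"
      using composite_free(2)[of q] H[OF q] by (auto simp: dnf_def)
    ultimately show ?thesis unfolding r[OF q] by blast
  qed
  show "lam A ! (rank_in ?L i - 1) = lam composite ! (i - 1)" if "i \<in> ?L" for i
    unfolding rank_in_initial[OF that] using that by (auto simp: lam_composite nth_append vertices_def)
qed (simp_all add: vertices_composite)

text \<open>Here the ends freed by cutting are the targets \<open>bs\<close>, which were free in B.
  No edge leads from B back to A, since edges ascend.\<close>

lemma restr_composite_right: "restr composite {vertices A + 1..vertices A + vertices B} = B"
proof (rule restr_eqI)
  let ?R = "{vertices A + 1..vertices A + vertices B}"
  have r: "rank_half ?R (sh p) = p" if "fst p \<in> {1..vertices B}" for p
    using rank_in_interval[of "vertices A + fst p" "vertices A" "vertices B"] that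
    by (simp add: rank_half_def shift_half_def vertices_def prod_eq_iff)
  have R: "\<exists>p'. p = sh p' \<and> fst p' \<in> {1..vertices B}" if "fst p \<in> ?R" for p
    using that by (intro exI[of _ "(fst p - vertices A, snd p)"]) (auto simp: shift_half_def vertices_def prod_eq_iff)
  have H: "sh p \<in> halves (lam composite) \<longleftrightarrow> p \<in> halves (lam B)" if "fst p \<in> {1..vertices B}" for p
    using halves_composite_right[of p] that by simp
  show "edg B (rank_half ?R p) (rank_half ?R q) = edg composite p q" if "fst p \<in> ?R" "fst q \<in> ?R" for p q
  proof -
    obtain p' where p: "p = sh p'" "fst p' \<in> {1..vertices B}" using R[OF \<open>fst p \<in> ?R\<close>] by blast
    obtain q' where q: "q = sh q'" "fst q' \<in> {1..vertices B}" using R[OF \<open>fst q \<in> ?R\<close>] by blast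
    show ?thesis
      using composite_edg(2)[of p' q'] H[OF p(2)] H[OF q(2)] unfolding p(1) q(1) r[OF p(2)] r[OF q(2)]
      by (auto simp: edg_def[of B] edg_def[of composite])
  qed
  show "upf B (rank_half ?R p) = (upf composite p \<or> (\<exists>q. edg composite p q \<and> fst q \<notin> ?R))"
    if pR: "fst p \<in> ?R" for p
  proof -
    obtain p' where p: "p = sh p'" "fst p' \<in> {1..vertices B}" using R[OF pR] by blast
    have "\<not> (\<exists>q. edg composite p q \<and> fst q \<notin> ?R)"
    proof
      assume "\<exists>q. edg composite p q \<and> fst q \<notin> ?R"
      then obtain q where "edg composite p q" "fst q \<notin> ?R" by blast
      then show False
        using edg_D(3)[of composite p q] edg_vertices(2)[of composite p q] pR by (auto simp: vertices_composite)
    qed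
    moreover have "upf B p' = upf composite (sh p')"
      using composite_free(3)[of p'] H[OF p(2)] by (auto simp: upf_def)
    ultimately show ?thesis unfolding p(1) r[OF p(2)] by blast
  qed
  show "dnf B (rank_half ?R q) = (dnf composite q \<or> (\<exists>p. edg composite p q \<and> fst p \<notin> ?R))"
    if qR: "fst q \<in> ?R" for q
  proof -
    obtain q' where q: "q = sh q'" "fst q' \<in> {1..vertices B}" using R[OF qR] by blast
    show ?thesis
    proof (cases "q' \<in> halves (lam B)")
      case True
      have "(\<exists>p. edg composite p q \<and> fst p \<notin> ?R) \<longleftrightarrow> pos (lam B) q' \<in> set bs"
      proof
        assume "\<exists>p. edg composite p q \<and> fst p \<notin> ?R"
        then obtain p where p: "edg composite p q" "fst p \<notin> ?R" by blast
        have "fst p \<in> {1..vertices A}"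
          using p edg_vertices(1)[OF p(1)] by (auto simp: vertices_composite)
        then have "p \<in> halves (lam A)" using edg_D(1)[OF p(1)] halves_composite_left by blast
        then show "pos (lam B) q' \<in> set bs"
          using p(1) composite_edg(3)[OF _ True] q(1) set_zip_rightD by metis
      next
        assume "pos (lam B) q' \<in> set bs"
        then obtain a where a: "(a, pos (lam B) q') \<in> set (zip as bs)" using zip_set(2) by auto
        obtain p where p: "p \<in> halves (lam A)" "a = pos (lam A) p"
          using zip_bounds(3)[OF a] by (rule pos_cases)
        have "edg composite p q" using composite_edg(3)[OF p(1) True] a p(2) q(1) by simp
        moreover have "fst p \<notin> ?R" using halves_fst[OF p(1)] by (simp add: vertices_def)
        ultimately show "\<exists>p. edg composite p q \<and> fst p \<notin> ?R" by blast
      qed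
      moreover have "dnf B q'" if "pos (lam B) q' \<in> set bs"
        using comp True that by (auto simp: dnf_def composable_def)
      ultimately show ?thesis using composite_free(4)[OF True] r[OF q(2)] q(1) by auto
    next
      case False
      then show ?thesis using H[OF q(2)] unfolding q(1) r[OF q(2)] by (auto simp: dnf_def edg_def)
    qed
  qed
  show "lam B ! (rank_in ?R i - 1) = lam composite ! (i - 1)" if "i \<in> ?R" for i
    unfolding rank_in_interval[OF that] using that by (auto simp: lam_composite nth_append vertices_def)
qed (simp_all add: vertices_composite)

end

section \<open>Compositions recognised by their restrictions\<close>

lemma compositions_restr:
  assumes "G \<in> compositions A B"
  shows "vertices G = vertices A + vertices B" "restr G {1..vertices A} = A"
    "restr G {vertices A + 1..vertices A + vertices B} = B"
proof -
  obtain as bs where c: "composable A B as bs" and G: "G = composite A B as bs"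
    using assms unfolding compositions_def by (auto simp: composite_def)
  show "vertices G = vertices A + vertices B" "restr G {1..vertices A} = A"
    "restr G {vertices A + 1..vertices A + vertices B} = B"
    unfolding G by (rule vertices_composite[OF c] restr_composite_left[OF c] restr_composite_right[OF c])+
qed

context
  fixes G A B :: bdiag
  assumes n: "vertices G = vertices A + vertices B" and A: "restr G {1..vertices A} = A"
    and B: "restr G {vertices A + 1..vertices A + vertices B} = B"
begin

lemma segment_subset: "{1..vertices A} \<subseteq> {1..vertices G}"
  "{vertices A + 1..vertices A + vertices B} \<subseteq> {1..vertices G}"
  using n by auto

lemma rank_half_left: "fst p \<in> {1..vertices A} \<Longrightarrow> rank_half {1..vertices A} p = p"
  using rank_in_initial by (simp add: rank_half_def)

lemma rank_half_right:
  "fst p \<in> {1..vertices B} \<Longrightarrow>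
    rank_half {vertices A + 1..vertices A + vertices B} (shift_half (vertices A) p) = p"
  using rank_in_interval[of "vertices A + fst p" "vertices A" "vertices B"]
  by (simp add: rank_half_def shift_half_def prod_eq_iff)

lemma halves_left: "fst p \<in> {1..vertices A} \<Longrightarrow> p \<in> halves (lam G) \<longleftrightarrow> p \<in> halves (lam A)"
  using rank_half_halves[OF I_lam[OF segment_subset(1)], of p] rank_half_left[of p]
  by (simp only: A lam_restr[symmetric])

lemma halves_right:
  "fst p \<in> {1..vertices B} \<Longrightarrow> shift_half (vertices A) p \<in> halves (lam G) \<longleftrightarrow> p \<in> halves (lam B)"
  using rank_half_halves[OF I_lam[OF segment_subset(2)], of "shift_half (vertices A) p"] rank_half_right[of p]
  by (simp only: B lam_restr[symmetric]) (simp add: shift_half_def)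

lemma crossing_edg_iff:
  "fst p \<in> {1..vertices A} \<Longrightarrow> fst q \<notin> {1..vertices A} \<Longrightarrow>
    edg G p q \<longleftrightarrow> (\<exists>q'. p \<in> halves (lam A) \<and> q' \<in> halves (lam B) \<and>
      q = shift_half (vertices A) q' \<and> edg G p (shift_half (vertices A) q'))"
proof
  assume p: "fst p \<in> {1..vertices A}" and q: "fst q \<notin> {1..vertices A}" and e: "edg G p q"
  let ?q = "(fst q - vertices A, snd q)"
  have "fst q \<in> {vertices A + 1..vertices A + vertices B}"
    using edg_vertices(2)[OF e] q n by auto
  then have q': "fst ?q \<in> {1..vertices B}" "q = shift_half (vertices A) ?q"
    by (auto simp: shift_half_def prod_eq_iff)
  have "p \<in> halves (lam A)" using edg_D(1)[OF e] halves_left[OF p] by blast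
  moreover have "?q \<in> halves (lam B)" using edg_D(2)[OF e] halves_right[OF q'(1)] q'(2) by simp
  ultimately show "\<exists>q'. p \<in> halves (lam A) \<and> q' \<in> halves (lam B) \<and>
      q = shift_half (vertices A) q' \<and> edg G p (shift_half (vertices A) q')"
    using e q'(2) by metis
qed blast

end

text \<open>The edges of G that cross from A to B tell along which half-edges to compose. The
  resulting composite has the same restrictions and the same crossing edges as G, so it equals
  G.\<close>

lemma mem_compositions:
  assumes n: "vertices G = vertices A + vertices B" and A: "restr G {1..vertices A} = A"
    and B: "restr G {vertices A + 1..vertices A + vertices B} = B"
  shows "G \<in> compositions A B"
proof -
  note segment_subset = segment_subset[OF n A B] and rank_half_left = rank_half_left[OF n A B]
    and rank_half_right = rank_half_right[OF n A B]
  let ?sh = "shift_half (vertices A)"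
  let ?L = "{1..vertices A}" and ?R = "{vertices A + 1..vertices A + vertices B}"
  define M where "M = {(pos (lam A) p, pos (lam B) q) | p q.
    p \<in> halves (lam A) \<and> q \<in> halves (lam B) \<and> edg G p (?sh q)}"
  have M: "(pos (lam A) p, pos (lam B) q) \<in> M \<longleftrightarrow> edg G p (?sh q)"
    if "p \<in> halves (lam A)" "q \<in> halves (lam B)" for p q
  proof
    assume "(pos (lam A) p, pos (lam B) q) \<in> M"
    then obtain p' q' where "pos (lam A) p = pos (lam A) p'" "pos (lam B) q = pos (lam B) q'"
      "p' \<in> halves (lam A)" "q' \<in> halves (lam B)" "edg G p' (?sh q')" unfolding M_def by blast
    then show "edg G p (?sh q)" using that pos_eq_iff by metis
  qed (use that in \<open>unfold M_def, blast\<close>)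
  have fstV: "fst p \<in> {1..vertices H}" if "p \<in> halves (lam H)" for p H
    using halves_fst[OF that] by (simp add: vertices_def)
  have sub: "M \<subseteq> {1..sum_list (lam A)} \<times> {1..sum_list (lam B)}"
    using pos_range by (auto simp: M_def simp del: atLeastAtMost_iff)
  have fin: "finite M" by (rule finite_subset[OF sub]) simp
  have edg_right: "q = q'" if "edg G p q" "edg G p q'" for p q q'
    using that bdiag_valid(4)[of "pos (lam G) p" "pos (lam G) q" G "pos (lam G) q'"]
    by (auto simp: edg_def pos_eq_iff)
  have edg_left: "p = p'" if "edg G p q" "edg G p' q" for p p' q
    using that bdiag_valid(5)[of "pos (lam G) p" "pos (lam G) q" G "pos (lam G) p'"]
    by (auto simp: edg_def pos_eq_iff)
  have sh_inj: "?sh p = ?sh q \<longleftrightarrow> p = q" for p q by (auto simp: shift_half_def prod_eq_iff)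
  have M_E: "\<exists>p q. a = pos (lam A) p \<and> b = pos (lam B) q \<and> p \<in> halves (lam A) \<and>
      q \<in> halves (lam B) \<and> edg G p (?sh q)" if "(a, b) \<in> M" for a b
    using that unfolding M_def by blast
  have injR: "b = b'" if ab: "(a, b) \<in> M" and ab': "(a, b') \<in> M" for a b b'
    using M_E[OF ab] M_E[OF ab'] edg_right sh_inj pos_eq_iff by metis
  have injL: "a = a'" if ab: "(a, b) \<in> M" and ab': "(a', b) \<in> M" for a a' b
    using M_E[OF ab] M_E[OF ab'] edg_left pos_eq_iff by metis
  \<comment> \<open>Compositions list the sources in increasing order; the targets follow in the
    order of their sources.\<close>
  define as where "as = sorted_list_of_set (fst ` M)"
  define f where "f = (\<lambda>a. THE b. (a, b) \<in> M)"
  define bs where "bs = map f as"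
  have set_as: "set as = fst ` M" using fin by (simp add: as_def)
  have f: "f a = b" if "(a, b) \<in> M" for a b
    unfolding f_def using that injR by blast
  have zip: "set (zip as bs) = M"
  proof -
    have "zip as bs = map (\<lambda>a. (a, f a)) as" by (simp add: bs_def zip_map2 zip_same_conv_map)
    then show ?thesis using f by (force simp: set_as image_iff)
  qed
  have comp: "composable A B as bs"
    unfolding composable_def
  proof (intro conjI)
    show "sorted_wrt (<) as" by (simp add: as_def)
    show "set as \<subseteq> up A"
    proof
      fix a assume "a \<in> set as"
      then obtain p q where p: "p \<in> halves (lam A)" "a = pos (lam A) p" and q: "q \<in> halves (lam B)"
        and e: "edg G p (?sh q)" unfolding set_as M_def by auto
      have "fst (?sh q) \<notin> ?L" using halves_fst[OF q] by (simp add: shift_half_def)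
      then have "upf A p"
        using upf_restr[OF segment_subset(1) fstV[OF p(1)]] e
        unfolding A rank_half_left[OF fstV[OF p(1)]] by blast
      then show "a \<in> up A" by (simp add: upf_def p(2))
    qed
    show "distinct bs"
      unfolding bs_def distinct_map
    proof
      show "inj_on f (set as)"
        by (rule inj_onI) (use f injL in \<open>auto simp: set_as\<close>)
    qed (simp add: as_def)
    show "set bs \<subseteq> down B"
    proof
      fix b assume "b \<in> set bs"
      then have "b \<in> snd ` M" unfolding zip[symmetric] set_map[symmetric] by (simp add: bs_def del: set_map)
      then obtain p q where p: "p \<in> halves (lam A)" and q: "q \<in> halves (lam B)" "b = pos (lam B) q"
        and e: "edg G p (?sh q)" unfolding M_def by auto
      have R: "fst (?sh q) \<in> ?R" and "fst p \<notin> ?R"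
        using fstV[OF q(1)] fstV[OF p] by (auto simp: shift_half_def)
      then have "dnf B q"
        using dnf_restr[OF segment_subset(2) R] e
        unfolding B rank_half_right[OF fstV[OF q(1)]] by blast
      then show "b \<in> down B" by (simp add: dnf_def q(2))
    qed
  qed (simp add: bs_def)
  define G' where "G' = composite A B as bs"
  have "G' \<in> compositions A B"
    unfolding compositions_def G'_def composite_def[OF comp] using comp by blast
  note c = compositions_restr[OF this]
  have "G = G'"
  proof (rule bdiag_eq_partsI[of _ _ ?L])
    show "vertices G = vertices G'" using n c(1) by simp
    show "?L \<subseteq> {1..vertices G}" by (rule segment_subset(1))
    show "restr G ?L = restr G' ?L" by (simp only: A c(2))
    have "{1..vertices G} - ?L = ?R" using n by auto
    then show "restr G ({1..vertices G} - ?L) = restr G' ({1..vertices G} - ?L)" by (simp only: B c(3))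
    fix p q :: "nat \<times> nat" assume pq: "fst p \<in> ?L \<longleftrightarrow> fst q \<notin> ?L"
    show "edg G p q = edg G' p q"
    proof (cases "fst p \<in> ?L")
      case True
      have "edg G p (?sh q') \<longleftrightarrow> edg G' p (?sh q')" if "p \<in> halves (lam A)" "q' \<in> halves (lam B)" for q'
        using composite_edg(3)[OF comp that] M[OF that] unfolding zip G'_def by (simp add: vertices_def)
      then show ?thesis
        using crossing_edg_iff[OF n A B, of p q] crossing_edg_iff[OF c, of p q] True pq by blast
    next
      case False
      then have "\<not> edg H p q" for H using edg_D(3)[of H p q] edg_vertices(1)[of H p q] pq by fastforce
      then show ?thesis by blast
    qed
  qed
  then show ?thesis using \<open>G' \<in> compositions A B\<close> by simp
qed


section \<open>Permuting the vertices\<close>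

lemma nth_concat_sum:
  "i < length xss \<Longrightarrow> j < length (xss ! i) \<Longrightarrow>
    concat xss ! (sum_list (map length (take i xss)) + j) = xss ! i ! j"
proof (induction xss arbitrary: i)
  case (Cons xs xss)
  then show ?case by (cases i) (simp_all add: nth_append add.assoc)
qed simp

context
  fixes J :: bdiag and \<sigma> :: "nat \<Rightarrow> nat"
  assumes \<sigma>: "\<sigma> permutes {1..vertices J}" and valid: "valid_bdiag (permute_pre (Rep_bdiag J) \<sigma>)"
begin

definition perm_half :: "nat \<times> nat \<Rightarrow> nat \<times> nat" where
  "perm_half p = (\<sigma> (fst p), snd p)"

lemma Rep_permute: "Rep_bdiag (permute J \<sigma>) = permute_pre (Rep_bdiag J) \<sigma>"
  unfolding permute_def using valid by (simp add: Abs_bdiag_inverse)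

lemma \<sigma>': "\<sigma> permutes {1..length (lam J)}"
  using \<sigma> by (simp add: vertices_def)

lemma lam_permute: "lam (permute J \<sigma>) = map (\<lambda>i. lam J ! (\<sigma> i - 1)) [1..<length (lam J) + 1]"
  by (simp add: lam.rep_eq Rep_permute permute_pre_def Let_def del: upt_Suc)

lemma vertices_permute: "vertices (permute J \<sigma>) = vertices J"
  by (simp add: vertices_def lam_permute del: upt_Suc)

lemma weight_permute: "sum_list (lam (permute J \<sigma>)) = sum_list (lam J)"
  unfolding lam_permute by (rule sum_list_permute[OF \<sigma>'])

lemma nth_lam_permute: "i \<in> {1..vertices J} \<Longrightarrow> lam (permute J \<sigma>) ! (i - 1) = lam J ! (\<sigma> i - 1)"
  by (auto simp: lam_permute vertices_def simp del: upt_Suc)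

lemma perm_half_halves: "p \<in> halves (lam (permute J \<sigma>)) \<longleftrightarrow> perm_half p \<in> halves (lam J)"
proof -
  have "fst p \<in> {1..vertices J} \<longleftrightarrow> \<sigma> (fst p) \<in> {1..vertices J}"
    using permutes_in_image[OF \<sigma>] by blast
  then show ?thesis
    using nth_lam_permute[of "fst p"] vertices_permute
    by (auto simp: halves_def perm_half_def vertices_def split_beta)
qed

text \<open>The word of \<open>block_perm\<close> concatenates whole blocks, the i-th being that of
  vertex \<sigma>(i) in increasing order, so the place within a vertex is kept.\<close>

lemma block_perm_pos:
  assumes p: "p \<in> halves (lam (permute J \<sigma>))"
  shows "block_perm (lam J) \<sigma> (pos (lam (permute J \<sigma>)) p) = pos (lam J) (perm_half p)"
proof -
  let ?ls = "lam J"
  let ?xss = "map (\<lambda>i. sorted_list_of_set {k \<in> {1..sum_list ?ls}. block ?ls k = \<sigma> i}) [1..<length ?ls + 1]"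
  have len: "map length ?xss = lam (permute J \<sigma>)"
    unfolding lam_permute by (rule length_blocks_word[OF \<sigma>'])
  define i where "i = fst p - 1"
  define j where "j = snd p - 1"
  have ij: "fst p = Suc i" "snd p = Suc j" "i < length ?xss" "j < length (?xss ! i)"
  proof -
    have *: "1 \<le> fst p" "fst p \<le> length (map length ?xss)" "1 \<le> snd p"
      "snd p \<le> map length ?xss ! (fst p - 1)"
      using p unfolding len by (auto simp: halves_def)
    then show "fst p = Suc i" "snd p = Suc j" "i < length ?xss" by (auto simp: i_def j_def)
    then show "j < length (?xss ! i)" using *(4) by (simp del: upt_Suc)
  qed
  have "block_perm ?ls \<sigma> (pos (lam (permute J \<sigma>)) p) =
      concat ?xss ! (sum_list (map length (take i ?xss)) + j)"
    by (simp add: block_perm_def block_word_def pos_def ij(1,2) len[symmetric] take_map del: upt_Suc)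
  also have "\<dots> = ?xss ! i ! j" by (rule nth_concat_sum[OF ij(3,4)])
  also have "?xss ! i = sorted_list_of_set {k \<in> {1..sum_list ?ls}. block ?ls k = \<sigma> (fst p)}"
    using ij(3) by (simp add: ij(1) del: upt_Suc)
  \<comment> \<open>A block is an interval of positions, so its sorted list can be indexed
    explicitly.\<close>
  also have "{k \<in> {1..sum_list ?ls}. block ?ls k = \<sigma> (fst p)} =
      {sum_list (take (\<sigma> (fst p) - 1) ?ls) + 1..<sum_list (take (\<sigma> (fst p)) ?ls) + 1}" (is "?A = ?B")
  proof -
    have s: "\<sigma> (fst p) \<in> {1..length ?ls}"
      using perm_half_halves[of p] p by (auto simp: halves_def perm_half_def)
    have "k \<in> ?B" if "k \<in> ?A" for k
      using that block_bounds(3,4)[of k ?ls] by auto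
    moreover have "k \<in> ?A" if "k \<in> ?B" for k
      using that s block_eqI[of "\<sigma> (fst p)" ?ls k] sum_take_mono[of "\<sigma> (fst p)" "length ?ls" ?ls] by auto
    ultimately show ?thesis by blast
  qed
  also have "sorted_list_of_set ?B ! j = sum_list (take (\<sigma> (fst p) - 1) ?ls) + 1 + j"
  proof -
    have "perm_half p \<in> halves ?ls" using perm_half_halves p by blast
    from pos_bounds(2)[OF this] show ?thesis
      by (simp add: pos_def perm_half_def ij(2) del: upt_Suc)
  qed
  also have "\<dots> = pos ?ls (perm_half p)" by (simp add: pos_def perm_half_def ij(2))
  finally show ?thesis .
qed

lemma edg_permute: "edg (permute J \<sigma>) p q \<longleftrightarrow> edg J (perm_half p) (perm_half q)"
proof (cases "p \<in> halves (lam (permute J \<sigma>)) \<and> q \<in> halves (lam (permute J \<sigma>))")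
  case True
  have "edges (permute J \<sigma>) = {(i, j) \<in> {1..sum_list (lam J)} \<times> {1..sum_list (lam J)}.
      (block_perm (lam J) \<sigma> i, block_perm (lam J) \<sigma> j) \<in> edges J}"
    by (simp add: edges.rep_eq lam.rep_eq Rep_permute permute_pre_def Let_def)
  then show ?thesis
    using True pos_range[of p "lam (permute J \<sigma>)"] pos_range[of q "lam (permute J \<sigma>)"]
    by (simp add: edg_def perm_half_halves[symmetric] block_perm_pos weight_permute)
qed (auto simp: edg_def perm_half_halves)

lemma upf_permute: "upf (permute J \<sigma>) p \<longleftrightarrow> upf J (perm_half p)"
proof (cases "p \<in> halves (lam (permute J \<sigma>))")
  case True
  have "up (permute J \<sigma>) = {i \<in> {1..sum_list (lam J)}. block_perm (lam J) \<sigma> i \<in> up J}"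
    by (simp add: up.rep_eq lam.rep_eq Rep_permute permute_pre_def Let_def)
  then show ?thesis
    using True pos_range[of p "lam (permute J \<sigma>)"]
    by (simp add: upf_def perm_half_halves[symmetric] block_perm_pos weight_permute)
qed (auto simp: upf_def perm_half_halves)

lemma dnf_permute: "dnf (permute J \<sigma>) p \<longleftrightarrow> dnf J (perm_half p)"
proof (cases "p \<in> halves (lam (permute J \<sigma>))")
  case True
  have "down (permute J \<sigma>) = {i \<in> {1..sum_list (lam J)}. block_perm (lam J) \<sigma> i \<in> down J}"
    by (simp add: down.rep_eq lam.rep_eq Rep_permute permute_pre_def Let_def)
  then show ?thesis
    using True pos_range[of p "lam (permute J \<sigma>)"]
    by (simp add: dnf_def perm_half_halves[symmetric] block_perm_pos weight_permute)
qed (auto simp: dnf_def perm_half_halves)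

text \<open>As \<sigma> is increasing on I, ranks in I and in its image agree, so both restrictions
  number corresponding vertices alike.\<close>

lemma restr_permute:
  assumes I: "I \<subseteq> {1..vertices J}" and mono: "\<And>i j. i \<in> I \<Longrightarrow> j \<in> I \<Longrightarrow> i < j \<Longrightarrow> \<sigma> i < \<sigma> j"
  shows "restr (permute J \<sigma>) I = restr J (\<sigma> ` I)"
proof (rule restr_eqI)
  have fin: "finite I" using I finite_subset by blast
  have inj: "inj \<sigma>" by (rule permutes_inj[OF \<sigma>])
  have K: "\<sigma> ` I \<subseteq> {1..vertices J}" using I permutes_image[OF \<sigma>] by blast
  show "I \<subseteq> {1..vertices (permute J \<sigma>)}" using I by (simp add: vertices_permute)
  show "vertices (restr J (\<sigma> ` I)) = card I"
    using vertices_restr[OF K] card_image[OF inj_on_subset[OF inj subset_UNIV]] by simp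
  have rank: "rank_in (\<sigma> ` I) (\<sigma> i) = rank_in I i" if i: "i \<in> I" for i
  proof -
    have "rank_in I i = (\<lambda>i. rank_in (\<sigma> ` I) (\<sigma> i)) i"
    proof (rule rank_in_eqI[OF fin _ _ i])
      show "(\<lambda>i. rank_in (\<sigma> ` I) (\<sigma> i)) ` I = {1..card (\<sigma> ` I)}"
        using rank_in_image[of "\<sigma> ` I"] fin by (simp add: image_image)
    qed (use mono rank_in_less[of "\<sigma> ` I"] fin in auto)
    then show ?thesis by simp
  qed
  have half: "rank_half I p = rank_half (\<sigma> ` I) (perm_half p)" if "fst p \<in> I" for p
    using rank[OF that] by (simp add: rank_half_def perm_half_def)
  have mem: "fst (perm_half p) \<in> \<sigma> ` I \<longleftrightarrow> fst p \<in> I" for p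
    using inj by (auto simp: perm_half_def inj_def)
  have surj: "\<exists>q. q' = perm_half q" for q'
    using permutes_surj[OF \<sigma>] by (metis fst_conv perm_half_def prod.collapse snd_conv surjD)
  show "lam (restr J (\<sigma> ` I)) ! (rank_in I i - 1) = lam (permute J \<sigma>) ! (i - 1)" if i: "i \<in> I" for i
    using nth_lam_restr[OF K, of "\<sigma> i"] nth_lam_permute[of i] i I rank[OF i] by auto
  show "edg (restr J (\<sigma> ` I)) (rank_half I p) (rank_half I q) = edg (permute J \<sigma>) p q"
    if "fst p \<in> I" "fst q \<in> I" for p q
    unfolding half[OF that(1)] half[OF that(2)] edg_permute using that mem by (intro edg_restr[OF K]) blast+
  show "upf (restr J (\<sigma> ` I)) (rank_half I p) =
    (upf (permute J \<sigma>) p \<or> (\<exists>q. edg (permute J \<sigma>) p q \<and> fst q \<notin> I))" if p: "fst p \<in> I" for p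
    unfolding half[OF p] edg_permute upf_permute
    using upf_restr[OF K, of "perm_half p"] p mem surj by metis
  show "dnf (restr J (\<sigma> ` I)) (rank_half I p) =
    (dnf (permute J \<sigma>) p \<or> (\<exists>q. edg (permute J \<sigma>) q p \<and> fst q \<notin> I))" if p: "fst p \<in> I" for p
    unfolding half[OF p] edg_permute dnf_permute
    using dnf_restr[OF K, of "perm_half p"] p mem surj by metis
qed

lemma sep_permute:
  assumes "sep J (\<sigma> ` X) (\<sigma> ` Y)"
  shows "sep (permute J \<sigma>) X Y"
  unfolding sep_def edg_permute
proof (intro allI impI)
  fix p q assume "edg J (perm_half p) (perm_half q)"
  with assms have "\<not> (fst (perm_half p) \<in> \<sigma> ` X \<and> fst (perm_half q) \<in> \<sigma> ` Y) \<and>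
      \<not> (fst (perm_half p) \<in> \<sigma> ` Y \<and> fst (perm_half q) \<in> \<sigma> ` X)"
    unfolding sep_def by blast
  then show "\<not> (fst p \<in> X \<and> fst q \<in> Y) \<and> \<not> (fst p \<in> Y \<and> fst q \<in> X)"
    by (auto simp: perm_half_def)
qed

end

lemma juxtapose_composition: "juxtapose A B \<in> compositions A B"
  unfolding juxtapose_def compositions_def by (auto simp: composable_def intro!: exI[of _ "[]"])

text \<open>Composing along empty lists adds no edge from A to B, and edges from B to A are excluded
  because edges ascend.\<close>

lemma sep_juxtapose: "sep (juxtapose A B) {1..vertices A} {vertices A + 1..vertices A + vertices B}"
proof -
  have c: "composable A B [] []" by (simp add: composable_def)
  let ?J = "juxtapose A B"
  have J: "?J = composite A B [] []"
    by (simp add: juxtapose_def composite_def[OF c])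
  note r = compositions_restr[OF juxtapose_composition, of A B]
  have 1: "\<not> edg ?J p q" if p: "fst p \<in> {1..vertices A}" and q: "fst q \<in> {vertices A + 1..vertices A + vertices B}" for p q
  proof
    assume e: "edg ?J p q"
    have "fst q \<notin> {1..vertices A}" using q by auto
    then obtain q' where "p \<in> halves (lam A)" "q' \<in> halves (lam B)" "edg ?J p (shift_half (vertices A) q')"
      using crossing_edg_iff[OF r p, of q] e by blast
    then show False using composite_edg(3)[OF c, of p q'] by (simp add: J vertices_def)
  qed
  have 2: "\<not> edg ?J p q" if "fst q \<in> {1..vertices A}" "fst p \<in> {vertices A + 1..vertices A + vertices B}" for p q
    using edg_D(3)[of ?J p q] that by auto
  show ?thesis unfolding sep_def using 1 2 by blast
qed

section \<open>Shuffles\<close>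

definition shuffle_set :: "nat \<Rightarrow> nat \<Rightarrow> (nat \<Rightarrow> nat) \<Rightarrow> nat set" where
  "shuffle_set n n' \<sigma> = {i \<in> {1..n + n'}. \<sigma> i \<in> {1..n}}"

lemma shuffle:
  assumes "\<sigma> \<in> shuffles_perm n n'"
  defines "I \<equiv> shuffle_set n n' \<sigma>"
  shows "\<sigma> permutes {1..n + n'}" "I \<subseteq> {1..n + n'}"
    and "\<sigma> ` I = {1..n}" "\<sigma> ` ({1..n + n'} - I) = {n + 1..n + n'}"
    and "i \<in> I \<Longrightarrow> j \<in> I \<Longrightarrow> i < j \<Longrightarrow> \<sigma> i < \<sigma> j"
    and "i \<in> {1..n + n'} - I \<Longrightarrow> j \<in> {1..n + n'} - I \<Longrightarrow> i < j \<Longrightarrow> \<sigma> i < \<sigma> j"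
proof -
  show p: "\<sigma> permutes {1..n + n'}" using assms(1) by (simp add: shuffles_perm_def)
  show I: "I \<subseteq> {1..n + n'}" by (auto simp: I_def shuffle_set_def)
  have im: "\<sigma> ` {1..n + n'} = {1..n + n'}" by (rule permutes_image[OF p])
  show 1: "\<sigma> ` I = {1..n}"
  proof (intro equalityI subsetI)
    fix k assume k: "k \<in> {1..n}"
    then have "k \<in> \<sigma> ` {1..n + n'}" unfolding im by auto
    then show "k \<in> \<sigma> ` I" using k by (auto simp: I_def shuffle_set_def)
  qed (auto simp: I_def shuffle_set_def)
  have "\<sigma> ` ({1..n + n'} - I) = {1..n + n'} - {1..n}"
    using image_set_diff[OF permutes_inj[OF p], of "{1..n + n'}" I] by (simp only: im 1)
  then show 2: "\<sigma> ` ({1..n + n'} - I) = {n + 1..n + n'}" by auto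
  have s: "(\<sigma> i \<in> {1..n} \<and> \<sigma> j \<in> {1..n} \<longrightarrow> \<sigma> i < \<sigma> j) \<and>
      (\<sigma> i \<in> {n + 1..n + n'} \<and> \<sigma> j \<in> {n + 1..n + n'} \<longrightarrow> \<sigma> i < \<sigma> j)"
    if "i \<in> {1..n + n'}" "j \<in> {1..n + n'}" "i < j"
    using assms(1) that unfolding shuffles_perm_def by blast
  show "i \<in> I \<Longrightarrow> j \<in> I \<Longrightarrow> i < j \<Longrightarrow> \<sigma> i < \<sigma> j"
    using s I 1 by blast
  show "i \<in> {1..n + n'} - I \<Longrightarrow> j \<in> {1..n + n'} - I \<Longrightarrow> i < j \<Longrightarrow> \<sigma> i < \<sigma> j"
    using s 2 by blast
qed

text \<open>A shuffle is increasing on I and on its complement, with intervals as images, so its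
  values are forced by I.\<close>

lemma shuffle_rank:
  assumes \<sigma>: "\<sigma> \<in> shuffles_perm n n'"
  defines "I \<equiv> shuffle_set n n' \<sigma>"
  shows "i \<in> I \<Longrightarrow> \<sigma> i = rank_in I i"
    and "i \<in> {1..n + n'} - I \<Longrightarrow> \<sigma> i = n + rank_in ({1..n + n'} - I) i"
proof -
  note s = shuffle[OF \<sigma>, folded I_def]
  have fin: "finite I" using s(2) finite_subset by blast
  show "i \<in> I \<Longrightarrow> \<sigma> i = rank_in I i"
    using rank_in_eqI[OF fin s(5) s(3)] by simp
  assume i: "i \<in> {1..n + n'} - I"
  have gt: "n < \<sigma> j" if "j \<in> {1..n + n'} - I" for j
  proof -
    have "\<sigma> j \<in> {n + 1..n + n'}" unfolding s(4)[symmetric] using that by (rule imageI)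
    then show ?thesis by simp
  qed
  have "rank_in ({1..n + n'} - I) i = (\<lambda>i. \<sigma> i - n) i"
  proof (rule rank_in_eqI[OF _ _ _ i])
    show "\<sigma> j - n < \<sigma> k - n" if "j \<in> {1..n + n'} - I" "k \<in> {1..n + n'} - I" "j < k" for j k
      using s(6)[OF that] gt[OF that(1)] by simp
    have "(\<lambda>i. \<sigma> i - n) ` ({1..n + n'} - I) = (\<lambda>k. k - n) ` {n + 1..n + n'}"
      unfolding s(4)[symmetric] image_image ..
    also have "\<dots> = {1..n'}"
      by (auto simp: image_iff intro!: bexI[of _ "_ + n"])
    finally show "(\<lambda>i. \<sigma> i - n) ` ({1..n + n'} - I) = {1..n'}" .
  qed simp
  then show "\<sigma> i = n + rank_in ({1..n + n'} - I) i" using gt[OF i] by simp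
qed

lemma bij_betw_shuffle_set:
  "bij_betw (shuffle_set n n') (shuffles_perm n n') {I. I \<subseteq> {1..n + n'} \<and> card I = n}"
proof (rule bij_betw_imageI)
  let ?V = "{1..n + n'}"
  show "inj_on (shuffle_set n n') (shuffles_perm n n')"
  proof (intro inj_onI ext)
    fix \<sigma> \<tau> i
    assume \<sigma>: "\<sigma> \<in> shuffles_perm n n'" and \<tau>: "\<tau> \<in> shuffles_perm n n'"
      and eq: "shuffle_set n n' \<sigma> = shuffle_set n n' \<tau>"
    consider "i \<in> shuffle_set n n' \<tau>" | "i \<in> ?V - shuffle_set n n' \<tau>" | "i \<notin> ?V" by blast
    then show "\<sigma> i = \<tau> i"
    proof cases
      case 1
      then show ?thesis using shuffle_rank(1)[OF \<sigma>, of i] shuffle_rank(1)[OF \<tau>, of i] eq by simp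
    next
      case 2
      then show ?thesis using shuffle_rank(2)[OF \<sigma>, of i] shuffle_rank(2)[OF \<tau>, of i] eq by simp
    next
      case 3
      then show ?thesis
        using permutes_not_in[OF shuffle(1)[OF \<sigma>]] permutes_not_in[OF shuffle(1)[OF \<tau>]] by simp
    qed
  qed
  show "shuffle_set n n' ` shuffles_perm n n' = {I. I \<subseteq> ?V \<and> card I = n}"
  proof (intro equalityI subsetI)
    fix I assume "I \<in> shuffle_set n n' ` shuffles_perm n n'"
    then obtain \<sigma> where \<sigma>: "\<sigma> \<in> shuffles_perm n n'" "I = shuffle_set n n' \<sigma>" by blast
    note s = shuffle[OF \<sigma>(1), folded \<sigma>(2)]
    have "card I = card (\<sigma> ` I)"
      by (rule card_image[symmetric]) (use permutes_inj[OF s(1)] inj_on_subset in blast)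
    then show "I \<in> {I. I \<subseteq> ?V \<and> card I = n}" using s(2,3) by simp
  next
    fix I assume "I \<in> {I. I \<subseteq> ?V \<and> card I = n}"
    then have I: "I \<subseteq> ?V" "card I = n" by auto
    let ?J = "?V - I"
    have fin: "finite I" using I(1) finite_subset by blast
    have cJ: "card ?J = n'" using card_Diff_subset[OF fin I(1)] I(2) by simp
    \<comment> \<open>Inside the vertex range these are the values forced by
      \<open>shuffle_rank\<close>; outside it is the identity, as \<open>permutes\<close>
      demands.\<close>
    define \<sigma> where "\<sigma> i = (if i \<in> I then rank_in I i else if i \<in> ?V then n + rank_in ?J i else i)" for i
    have 1: "bij_betw \<sigma> I {1..n}"
      using bij_betw_rank_in[OF fin, unfolded I(2)] bij_betw_cong[of I \<sigma> "rank_in I"] by (simp add: \<sigma>_def)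
    have "bij_betw (\<lambda>k. n + k) {1..n'} {n + 1..n + n'}"
      by (rule bij_betw_byWitness[where f' = "\<lambda>k. k - n"]) auto
    from bij_betw_trans[OF bij_betw_rank_in[of ?J, unfolded cJ] this]
    have "bij_betw (\<lambda>i. n + rank_in ?J i) ?J {n + 1..n + n'}" by (simp add: comp_def)
    moreover have "\<sigma> i = n + rank_in ?J i" if "i \<in> ?J" for i using that by (auto simp: \<sigma>_def)
    ultimately have 2: "bij_betw \<sigma> ?J {n + 1..n + n'}"
      using bij_betw_cong[of ?J \<sigma> "\<lambda>i. n + rank_in ?J i"] by blast
    have "{1..n} \<union> {n + 1..n + n'} = ?V" "I \<union> ?J = ?V" using I(1) by auto
    with bij_betw_combine[OF 1 2] have "bij_betw \<sigma> ?V ?V" by auto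
    then have p: "\<sigma> permutes ?V"
    proof (rule bij_imp_permutes)
      fix i assume "i \<notin> ?V"
      then show "\<sigma> i = i" using I(1) by (auto simp: \<sigma>_def)
    qed
    have im: "\<sigma> i \<in> {1..n}" if "i \<in> I" for i using bij_betwE[OF 1] that by blast
    have im': "\<sigma> i \<in> {n + 1..n + n'}" if "i \<in> ?J" for i using bij_betwE[OF 2] that by blast
    have mem: "i \<in> I \<longleftrightarrow> \<sigma> i \<in> {1..n}" if "i \<in> ?V" for i
    proof (cases "i \<in> I")
      case False
      then have "\<sigma> i \<in> {n + 1..n + n'}" using that im' by blast
      with False show ?thesis by simp
    qed (use im in blast)
    have "\<sigma> \<in> shuffles_perm n n'"
      unfolding shuffles_perm_def
    proof (intro CollectI conjI p ballI impI; elim conjE)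
      fix i j assume ij: "i \<in> ?V" "j \<in> ?V" "i < j"
      show "\<sigma> i < \<sigma> j" if "\<sigma> i \<in> {1..n}" "\<sigma> j \<in> {1..n}"
        using mem[OF ij(1)] mem[OF ij(2)] that rank_in_less[OF fin _ ij(3)] by (simp add: \<sigma>_def)
      show "\<sigma> i < \<sigma> j" if "\<sigma> i \<in> {n + 1..n + n'}" "\<sigma> j \<in> {n + 1..n + n'}"
      proof -
        have "i \<in> ?J" "j \<in> ?J" using mem[OF ij(1)] mem[OF ij(2)] that ij by auto
        then show ?thesis using rank_in_less[of ?J j i] ij(3) by (simp add: \<sigma>_def)
      qed
    qed
    moreover have "shuffle_set n n' \<sigma> = I"
      using mem I(1) unfolding shuffle_set_def by blast
    ultimately show "I \<in> shuffle_set n n' ` shuffles_perm n n'" by blast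
  qed
qed

text \<open>The shuffle sends I increasingly onto the vertices of C in the juxtaposition and the
  complement onto those of D, so \<open>restr_permute\<close> recovers C and D. This is the
  existence half of gluing.\<close>

lemma shuffle_glue:
  assumes \<sigma>: "\<sigma> \<in> shuffles_perm (vertices C) (vertices D)"
  defines "I \<equiv> shuffle_set (vertices C) (vertices D) \<sigma>"
    and "G \<equiv> permute (juxtapose C D) \<sigma>"
  shows "vertices G = vertices C + vertices D" "sep G I ({1..vertices G} - I)"
    "restr G I = C" "restr G ({1..vertices G} - I) = D"
proof -
  let ?J = "juxtapose C D"
  note r = compositions_restr[OF juxtapose_composition, of C D]
  note s = shuffle[OF \<sigma>, folded I_def]
  have p: "\<sigma> permutes {1..vertices ?J}" using s(1) r(1) by simp
  note v = valid_permute_shuffle[OF \<sigma>]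
  show n: "vertices G = vertices C + vertices D"
    unfolding G_def vertices_permute[OF p v] by (rule r(1))
  show "sep G I ({1..vertices G} - I)"
    unfolding G_def vertices_permute[OF p v] r(1)
    by (rule sep_permute[OF p v]) (unfold s(3,4), rule sep_juxtapose)
  have "restr G I = restr ?J (\<sigma> ` I)"
    unfolding G_def by (rule restr_permute[OF p v]) (use s(2,5) r(1) in auto)
  then show "restr G I = C" by (simp only: s(3) r(2))
  have "restr G ({1..vertices G} - I) = restr ?J (\<sigma> ` ({1..vertices G} - I))"
    unfolding n unfolding G_def by (rule restr_permute[OF p v]) (use s(6) r(1) in auto)
  then show "restr G ({1..vertices G} - I) = D" by (simp only: n s(4) r(3))
qed


section \<open>The Hopf algebras of B-diagrams\<close>

lemma sep_Un_empty:
  "sep G (X \<union> Y) Z \<longleftrightarrow> sep G X Z \<and> sep G Y Z" "sep G X (Y \<union> Z) \<longleftrightarrow> sep G X Y \<and> sep G X Z"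
  "sep G {} X" "sep G X {}"
  unfolding sep_def by blast+

interpretation bd: restriction_structure vertices restr sep empty_bdiag weight
proof
  show "\<exists>G. vertices G = vertices C + vertices D \<and> sep G I ({1..vertices G} - I) \<and>
      restr G I = C \<and> restr G ({1..vertices G} - I) = D"
    if I: "I \<subseteq> {1..vertices C + vertices D}" "card I = vertices C" for I C D
  proof -
    \<comment> \<open>Every I of the right size comes from a shuffle, and permuting the
      juxtaposition by it gives the gluing.\<close>
    have "I \<in> shuffle_set (vertices C) (vertices D) ` shuffles_perm (vertices C) (vertices D)"
      using I bij_betw_shuffle_set[of "vertices C" "vertices D"] by (simp add: bij_betw_def)
    then show ?thesis using shuffle_glue by blast
  qed
qed (fact vertices_restr restr_all_vertices restr_restr_bdiag sep_restr_bdiag sep_Un_empty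
  glue_unique_bdiag vertices_eq_0 weight_eq_0 weight_restr finite_weight)+

lemma compositions_eq: "compositions A B = bd.comps A B"
  using compositions_restr[of _ A B] mem_compositions[of _ A B] unfolding bd.comps_def by blast

lemma star_eq: "star = bd.seg_prod"
  unfolding star_def bd.seg_prod_def compositions_eq ..

lemma Iso_eq: "Iso G = cuts sep G {1..vertices G}"
  unfolding cuts_def using Iso_iff by blast

lemma Delta_eq: "Delta = bd.coprod sep"
  unfolding Delta_def bd.coprod_def
proof (intro arg_cong[where f = lin_ext] ext)
  fix G
  show "(\<Sum>I\<in>Iso G. basis (sub_bdiag G I, sub_bdiag G ({1..vertices G} - I))) =
      (\<Sum>K\<in>cuts sep G {1..vertices G}. basis (restr G K, restr G ({1..vertices G} - K)))"
    unfolding Iso_eq by (rule sum.cong) (simp_all add: cuts_def sub_bdiag_isolated del: One_nat_def)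
qed

text \<open>Both maps are transposes of \<open>star\<close>: the coefficient of (A, B) in the
  coproduct of D_G is 1 exactly if G is a composition of A and B.\<close>

lemma Delta_star_eq: "Delta_star = bd.coprod below"
proof
  fix x
  \<comment> \<open>A sum over an infinite set would be 0 by convention. The pairs composing to G
    come from cutting G at an initial segment, so there are finitely many.\<close>
  have fin: "finite {(A, B). G \<in> compositions A B}" for G
  proof (rule finite_subset)
    show "{(A, B). G \<in> compositions A B} \<subseteq>
        (\<lambda>r. (restr G {1..r}, restr G {r + 1..vertices G})) ` {..vertices G}"
    proof
      fix AB assume "AB \<in> {(A, B). G \<in> compositions A B}"
      then obtain A B where AB: "AB = (A, B)" "G \<in> compositions A B" by blast
      note r = compositions_restr[OF AB(2)]
      have "AB = (restr G {1..vertices A}, restr G {vertices A + 1..vertices G})"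
        unfolding r(1) r(2,3) by (rule AB(1))
      moreover have "vertices A \<in> {..vertices G}" using r(1) by simp
      ultimately show "AB \<in> (\<lambda>r. (restr G {1..r}, restr G {r + 1..vertices G})) ` {..vertices G}"
        by blast
    qed
  qed simp
  have "transposed Delta_star star"
  proof (rule transposed_basisI)
    show "lin Delta_star" "lin star" by (simp_all add: Delta_star_def star_def lin_lin_ext)
    fix G and AB :: "bdiag \<times> bdiag"
    obtain A B where AB: "AB = (A, B)" by (cases AB)
    have "coef (Delta_star (basis G)) AB =
        coef (\<Sum>AB\<in>{(A, B). G \<in> compositions A B}. basis AB) AB"
      by (simp add: Delta_star_def split_beta)
    also have "\<dots> = (if G \<in> compositions A B then 1 else 0)"
    proof -
      have "{X \<in> {(A, B). G \<in> compositions A B}. X = AB} = (if G \<in> compositions A B then {AB} else {})"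
        by (auto simp: AB)
      then show ?thesis unfolding bd.coef_sum_basis[OF fin] by simp
    qed
    also have "\<dots> = coef (star (basis AB)) G"
    proof -
      have "{X \<in> compositions A B. X = G} = (if G \<in> compositions A B then {G} else {})" by auto
      then show ?thesis
        unfolding star_eq AB bd.seg_prod_basis bd.coef_sum_basis[OF bd.finite_comps] compositions_eq by simp
    qed
    finally show "coef (Delta_star (basis G)) AB = coef (star (basis AB)) G" .
  qed
  then show "Delta_star x = bd.coprod below x"
    using transposed_sym[OF bd.transposed_seg_prod_coprod] unfolding star_eq by (rule transposed_unique)
qed

text \<open>One coefficient counts the shuffles that produce G, the other the isolated sets of G
  with parts C and D. \<open>shuffle_set\<close> matches them: a shuffle yields such a set by
  \<open>shuffle_glue\<close>, and every such set comes from one by uniqueness of gluing.\<close>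

lemma transposed_cup: "transposed cup (bd.coprod sep)"
proof (rule transposed_basisI)
  show "lin cup" "lin (bd.coprod sep)" by (simp_all add: cup_def lin_lin_ext bd.lin_coprod)
  fix CD :: "bdiag \<times> bdiag" and G
  obtain C D where CD: "CD = (C, D)" by (cases CD)
  let ?n = "vertices C" and ?n' = "vertices D"
  let ?S = "{\<sigma> \<in> shuffles_perm ?n ?n'. permute (juxtapose C D) \<sigma> = G}"
  let ?T = "{K \<in> cuts sep G {1..vertices G}. (restr G K, restr G ({1..vertices G} - K)) = (C, D)}"
  have fin: "finite (shuffles_perm ?n ?n')"
    by (rule finite_subset[OF _ finite_permutations[of "{1..?n + ?n'}"]]) (auto simp: shuffles_perm_def)
  have "bij_betw (shuffle_set ?n ?n') ?S ?T"
  proof (rule bij_betw_imageI)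
    show "inj_on (shuffle_set ?n ?n') ?S"
      using bij_betw_shuffle_set[of ?n ?n'] by (auto simp: bij_betw_def intro: inj_on_subset)
    show "shuffle_set ?n ?n' ` ?S = ?T"
    proof (intro equalityI subsetI)
      fix K assume "K \<in> shuffle_set ?n ?n' ` ?S"
      then obtain \<sigma> where \<sigma>: "\<sigma> \<in> shuffles_perm ?n ?n'" "G = permute (juxtapose C D) \<sigma>"
        "K = shuffle_set ?n ?n' \<sigma>" by blast
      note g = shuffle_glue[OF \<sigma>(1), folded \<sigma>(2,3)]
      have "K \<subseteq> {1..vertices G}" unfolding g(1) \<sigma>(3) by (rule shuffle(2)[OF \<sigma>(1)])
      then show "K \<in> ?T" using g by (simp add: cuts_def del: One_nat_def)
    next
      fix K assume "K \<in> ?T"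
      then have K: "K \<subseteq> {1..vertices G}" "sep G K ({1..vertices G} - K)" "restr G K = C"
        "restr G ({1..vertices G} - K) = D"
        by (auto simp: cuts_def simp del: One_nat_def)
      have c: "card K = ?n" "card ({1..vertices G} - K) = ?n'"
        using vertices_restr[OF K(1)] vertices_restr[of "{1..vertices G} - K" G] K(3,4) by auto
      have n: "vertices G = ?n + ?n'"
        using c card_Diff_subset[OF finite_subset[OF K(1)] K(1)] card_mono[OF _ K(1)] by simp
      have "K \<in> shuffle_set ?n ?n' ` shuffles_perm ?n ?n'"
        using bij_betw_shuffle_set[of ?n ?n'] K(1) c(1) unfolding bij_betw_def n by blast
      then obtain \<sigma> where \<sigma>: "\<sigma> \<in> shuffles_perm ?n ?n'" "K = shuffle_set ?n ?n' \<sigma>" by blast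
      note g = shuffle_glue[OF \<sigma>(1), folded \<sigma>(2)]
      have "permute (juxtapose C D) \<sigma> = G"
        by (rule glue_unique_bdiag[of _ _ K]) (use g K n in \<open>simp_all del: One_nat_def\<close>)
      then show "K \<in> shuffle_set ?n ?n' ` ?S" using \<sigma> by blast
    qed
  qed
  then have "card ?S = card ?T" by (rule bij_betw_same_card)
  moreover have "cup (basis CD) = (\<Sum>\<sigma>\<in>shuffles_perm ?n ?n'. basis (permute (juxtapose C D) \<sigma>))"
    by (simp add: cup_def CD)
  ultimately show "coef (cup (basis CD)) G = coef (bd.coprod sep (basis G)) CD"
    unfolding CD bd.coprod_basis by (simp only: bd.coef_sum_basis[OF fin]
      bd.coef_sum_basis[OF bd.finite_cuts[OF finite_atLeastAtMost]])
qed

lemma pairing_eq: "pairing = dot"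
proof (intro ext)
  fix f x :: "bdiag free"
  have "(\<Sum>G'\<in>supp x. coef f G * coef x G' * (if G = G' then 1 else 0)) = coef f G * coef x G" for G
  proof -
    have "(\<Sum>G'\<in>supp x. coef f G * coef x G' * (if G = G' then 1 else 0)) =
        (\<Sum>G'\<in>supp x. if G = G' then coef f G * coef x G else 0)"
      by (rule sum.cong) auto
    then show ?thesis by (simp add: in_keys_iff)
  qed
  then show "pairing f x = dot f x" by (simp add: pairing_def dot_def)
qed

theorem theorem32:
  shows "\<exists>counit antipode unit' counit' antipode'.
    graded_dual_hopf_algebra
      weight star (basis empty_bdiag) Delta counit antipode
      weight cup unit' Delta_star counit' antipode'
      pairing"
  unfolding pairing_eq star_eq Delta_eq Delta_star_eq
  \<comment> \<open>In the notation of \<open>graded_dual_exists\<close>, m and c are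
    \<open>star\<close> and \<open>Delta\<close>, while M and C are \<open>cup\<close> and
    \<open>Delta_star\<close>.\<close>
  by (rule graded_dual_exists[OF bd.bialgebra_coprod bd.coalgebra_coprod[OF bd.admissible_below]
    bd.transposed_seg_prod_coprod transposed_cup finite_weight weight_eq_0
    bd.graded_coprod bd.graded_coprod])

end
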